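(* Let $G_1$ be a $(q_1,q_2)$-semi-regular bipartite graph with bipartition $V_1,V_2$, $|V_1|=n_1\le n_2=|V_2|$; let $G_2$ be a $(q_3,q_4)$-semi-regular bipartite graph with bipartition $V_3,V_4$, $|V_3|=n_3\le n_4=|V_4|$; and let $G_2'$ be a $(q_3',q_4')$-semi-regular bipartite graph with bipartition $V_3',V_4'$, $|V_3'|=n_3'\le n_4'=|V_4'|$. Let $G=G_1\vee G_2$ and $G'=G_1\vee G_2'$. Then $Z_G(u)=Z_{G'}(u)$ if and only if $spec(G)=spec(G')$.
   Context: A bipartite graph with bipartition $(V_1,V_2)$ is $(q_1,q_2)$-semi-regular if every vertex of $V_1$ has degree $q_1$ and every vertex of $V_2$ has degree $q_2$ ($q_1,q_2\ge1$). The join $G_1\vee G_2$ has vertex set $V(G_1)\sqcup V(G_2)$ and edge set $E(G_1)\cup E(G_2)\cup\{uv:u\in V(G_1),v\in V(G_2)\}$. $spec(G)$ is the multiset of eigenvalues of the adjacency matrix of $G$. For a finite connected graph $G$ with no degree-1 vertices, the Ihara zeta function is $Z_G(u)=\prod_{[C]}(1-u^{|C|})^{-1}$ for $|u|$ small, the product over equivalence classes of primitive, backtrackless, tailless closed paths $C$ of length $|C|$; equivalently (Bass) $Z_G(u)^{-1}=(1-u^2)^{m-n}\det(I_n-uA(G)+u^2(D(G)-I_n))$, with $n,m$ the numbers of vertices and edges, $A(G)$ the adjacency matrix and $D(G)$ the degree matrix. *)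

theory Defs
  imports "HOL-Analysis.Analysis" "HOL-Computational_Algebra.Polynomial"
begin

definition simple_graph :: "'a set \<Rightarrow> ('a \<Rightarrow> 'a \<Rightarrow> bool) \<Rightarrow> bool" where
  "simple_graph V E \<longleftrightarrow> finite V \<and> (\<forall>x y. E x y \<longrightarrow> x \<in> V \<and> y \<in> V)
     \<and> (\<forall>x y. E x y \<longrightarrow> E y x) \<and> (\<forall>x. \<not> E x x)"

definition degree :: "'a set \<Rightarrow> ('a \<Rightarrow> 'a \<Rightarrow> bool) \<Rightarrow> 'a \<Rightarrow> nat" where
  "degree V E x = card {y \<in> V. E x y}"

definition semi_regular_bipartite ::
  "'a set \<Rightarrow> ('a \<Rightarrow> 'a \<Rightarrow> bool) \<Rightarrow> 'a set \<Rightarrow> 'a set \<Rightarrow> nat \<Rightarrow> nat \<Rightarrow> bool" where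
  "semi_regular_bipartite V E V1 V2 q1 q2 \<longleftrightarrow>
     simple_graph V E \<and> V \<noteq> {} \<and> V1 \<union> V2 = V \<and> V1 \<inter> V2 = {}
     \<and> (\<forall>x y. E x y \<longrightarrow> (x \<in> V1 \<and> y \<in> V2) \<or> (x \<in> V2 \<and> y \<in> V1))
     \<and> q1 \<ge> 1 \<and> q2 \<ge> 1
     \<and> (\<forall>x\<in>V1. degree V E x = q1) \<and> (\<forall>x\<in>V2. degree V E x = q2)"

definition join_V :: "'a set \<Rightarrow> 'b set \<Rightarrow> ('a + 'b) set" where
  "join_V V W = Inl ` V \<union> Inr ` W"

fun join_E :: "('a \<Rightarrow> 'a \<Rightarrow> bool) \<Rightarrow> 'a set \<Rightarrow> ('b \<Rightarrow> 'b \<Rightarrow> bool) \<Rightarrow> 'b set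
                 \<Rightarrow> ('a + 'b) \<Rightarrow> ('a + 'b) \<Rightarrow> bool" where
  "join_E E V F W (Inl x) (Inl y) = E x y"
| "join_E E V F W (Inr x) (Inr y) = F x y"
| "join_E E V F W (Inl x) (Inr y) = (x \<in> V \<and> y \<in> W)"
| "join_E E V F W (Inr x) (Inl y) = (x \<in> W \<and> y \<in> V)"

definition adj :: "('a \<Rightarrow> 'a \<Rightarrow> bool) \<Rightarrow> 'a \<Rightarrow> 'a \<Rightarrow> complex" where
  "adj E x y = (if E x y then 1 else 0)"

(* Characteristic polynomial det(x I - A(G)), Leibniz formula over the vertex set *)
definition char_poly_graph :: "'a set \<Rightarrow> ('a \<Rightarrow> 'a \<Rightarrow> bool) \<Rightarrow> complex poly" where
  "char_poly_graph V E =
     (\<Sum>p | p permutes V. of_int (sign p) *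
        (\<Prod>v\<in>V. (if p v = v then [:0, 1:] else 0) - [:adj E v (p v):]))"

definition spec :: "'a set \<Rightarrow> ('a \<Rightarrow> 'a \<Rightarrow> bool) \<Rightarrow> complex multiset" where
  "spec V E = proots (char_poly_graph V E)"

(* Closed, backtrackless, tailless paths of length m, given by their cyclic vertex sequence
   c!0, c!1, ..., c!(m-1) (in a simple graph a path is determined by its vertices):
   consecutive vertices adjacent (cyclically), and c!(i+2) \<noteq> c!i cyclically
   (no backtracking; for i = m-2, m-1 this is the tailless condition). *)
definition reduced_cycle :: "('a \<Rightarrow> 'a \<Rightarrow> bool) \<Rightarrow> 'a list \<Rightarrow> bool" where
  "reduced_cycle E c \<longleftrightarrow> (let m = length c in m \<ge> 1 \<and>
     (\<forall>i<m. E (c ! i) (c ! ((i + 1) mod m))) \<and>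
     (\<forall>i<m. c ! ((i + 2) mod m) \<noteq> c ! i))"

definition primitive_cycle :: "'a list \<Rightarrow> bool" where
  "primitive_cycle c \<longleftrightarrow> \<not> (\<exists>d k. k \<ge> 2 \<and> c = concat (replicate k d))"

definition prime_classes :: "('a \<Rightarrow> 'a \<Rightarrow> bool) \<Rightarrow> 'a list set set" where
  "prime_classes E = {{rotate j c | j. True} | c. reduced_cycle E c \<and> primitive_cycle c}"

definition num_primes :: "('a \<Rightarrow> 'a \<Rightarrow> bool) \<Rightarrow> nat \<Rightarrow> nat" where
  "num_primes E m = card {P \<in> prime_classes E. \<forall>c\<in>P. length c = m}"

(* Ihara zeta function Z_G(u) = \<Prod>_[C] (1 - u^|C|)^(-1), the product grouped by length |C| = m *)
definition ihara_zeta :: "('a \<Rightarrow> 'a \<Rightarrow> bool) \<Rightarrow> complex \<Rightarrow> complex" where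
  "ihara_zeta E u = (\<Prod>m. inverse ((1 - u ^ Suc m) ^ num_primes E (Suc m)))"

end

theory Submission
  imports Defs "Jordan_Normal_Form.Schur_Decomposition"
begin

text \<open>
  Grouping the Euler product by length and taking logarithms, \<open>log Z(u)\<close> becomes the generating series
  of the numbers of reduced closed walks, which are the traces of the powers of the non-backtracking arc
  matrix; a block matrix identity then yields Bass's determinant formula.

  Give each cell \<open>Vi\<close> of the join a weight \<open>ai\<close>. Eliminating along the cells,
  \<open>det (diag a - A)\<close> equals
  \<open>a2^(n2-n1) S1(a1 a2) a4^(n4-n3) S2(a3 a4) ((a1 a2 - q1 q2) (a3 a4 - q3 q4) - L1 L2)\<close>, where
  \<open>L1 = n1 a2 + n2 a1 + 2 n1 q1\<close>, \<open>L2\<close> is its analogue for the second graph, and the monic polynomials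
  \<open>S1\<close>, \<open>S2\<close> depend only on the respective graph. All weights equal to \<open>x\<close> give the characteristic
  polynomial; \<open>ai = (1 + (di - 1) u^2) / u\<close> with \<open>di\<close> the degree on the \<open>i\<close>-th cell gives the
  zeta function.

  Both quantities are therefore functions of the parameters of the second graph and of \<open>S2\<close>, and each
  of them determines these data: splitting into even and odd parts separates \<open>L1 L2\<close> from the remaining
  factors, and comparing coefficients (for the zeta function also the degree, which counts the edges)
  recovers first \<open>n3 + n4\<close> and \<open>n3 q3\<close>, then \<open>q3 q4\<close>, and finally \<open>S2\<close>.
\<close>

section \<open>Cyclic words\<close>

text \<open>The four cells form an equitable partition of the join. For a single graph with weighted
  diagonal, the linear system with right-hand side 1 has a solution that is constant on cells, and
  its entries add up to \<open>L1 / (a1 a2 - q1 q2)\<close>. The two graphs are coupled only by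
  all-ones blocks, so these two sums are all that the join sees of them beyond their own
  determinants; this is where \<open>L1 L2\<close> comes from. The factors carrying
  \<open>S1\<close> and \<open>S2\<close> have fixed parity in the variable. Hence only the bracket
  can mix parities, and it does so through the constant terms of \<open>L1\<close> and
  \<open>L2\<close>. In the spectral case the factor of the first graph is common to both sides and
  cancels. For the zeta function it does not: the degrees on \<open>V1\<close> and \<open>V2\<close>
  involve \<open>n3 + n4\<close>, which is not yet known to agree. Multiplying the even part of one
  join by the odd part of the other removes every such factor. The constant coefficient of that
  identity and the edge count form a linear system for the changes in \<open>n3 + n4\<close> and
  \<open>n3 q3\<close>, with determinant \<open>n1 q1 - (n1 + n2)^2\<close> up to sign, which is
  nonzero since \<open>n1 q1 <= n1 n2\<close>.\<close>

definition cyc :: "'a list \<Rightarrow> nat \<Rightarrow> 'a" where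
  "cyc c i = c ! (i mod length c)"

abbreviation word_power :: "nat \<Rightarrow> 'a list \<Rightarrow> 'a list" where
  "word_power k d \<equiv> concat (replicate k d)"

lemma length_word_power [simp]: "length (word_power k d) = k * length d"
  by (induction k) auto

lemma list_eq_cyc:
  assumes "length c = length d" and "\<And>i. cyc c i = cyc d i"
  shows "c = d"
proof (rule nth_equalityI[OF assms(1)])
  fix i assume "i < length c"
  thus "c ! i = d ! i" using assms(2)[of i] assms(1) by (simp add: cyc_def)
qed

lemma cyc_add_length [simp]: "cyc c (i + length c) = cyc c i"
  by (simp add: cyc_def)

lemma cyc_add_mult_length: "cyc c (i + length c * k) = cyc c i"
  by (simp add: cyc_def)

lemma cyc_rotate: "c \<noteq> [] \<Longrightarrow> cyc (rotate j c) i = cyc c (i + j)"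
  by (simp add: cyc_def nth_rotate mod_simps add.commute)

lemma nth_word_power: "j < k * length d \<Longrightarrow> word_power k d ! j = d ! (j mod length d)"
proof (induction k arbitrary: j)
  case (Suc k)
  show ?case
  proof (cases "j < length d")
    case False
    hence "word_power (Suc k) d ! j = word_power k d ! (j - length d)"
      by (simp add: nth_append)
    also have "\<dots> = d ! ((j - length d) mod length d)"
      using Suc False by (intro Suc.IH) auto
    also have "(j - length d) mod length d = j mod length d"
      using False by (simp add: le_mod_geq)
    finally show ?thesis .
  qed (simp add: nth_append)
qed simp

lemma cyc_word_power:
  assumes "d \<noteq> []" "k \<ge> 1"
  shows "cyc (word_power k d) i = cyc d i"
proof -
  have "i mod (k * length d) < k * length d" using assms by simp
  thus ?thesis by (simp add: cyc_def nth_word_power mod_mod_cancel)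
qed

text \<open>In terms of the periodic sequence \<open>cyc c\<close>, the closing edge and the
  tailless condition are no longer special cases. Invariance under rotation and under powers becomes
  immediate, because these operations shift the sequence or leave it unchanged.\<close>

lemma reduced_cycle_cyc:
  "reduced_cycle E c \<longleftrightarrow>
     c \<noteq> [] \<and> (\<forall>i. E (cyc c i) (cyc c (Suc i)) \<and> cyc c (i + 2) \<noteq> cyc c i)"
proof (cases "c = []")
  case False
  show ?thesis
  proof
    assume r: "reduced_cycle E c"
    have "E (cyc c i) (cyc c (Suc i)) \<and> cyc c (i + 2) \<noteq> cyc c i" for i
    proof -
      define j where "j = i mod length c"
      have j: "j < length c" using False by (simp add: j_def)
      have "(j + 1) mod length c = Suc i mod length c" "(j + 2) mod length c = (i + 2) mod length c"
        by (simp_all add: j_def mod_simps)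
      thus ?thesis using r j unfolding reduced_cycle_def Let_def cyc_def j_def[symmetric] by auto
    qed
    thus "c \<noteq> [] \<and> (\<forall>i. E (cyc c i) (cyc c (Suc i)) \<and> cyc c (i + 2) \<noteq> cyc c i)"
      using False by blast
  next
    assume h: "c \<noteq> [] \<and> (\<forall>i. E (cyc c i) (cyc c (Suc i)) \<and> cyc c (i + 2) \<noteq> cyc c i)"
    have "E (c ! i) (c ! ((i + 1) mod length c)) \<and> c ! ((i + 2) mod length c) \<noteq> c ! i"
      if "i < length c" for i
      using h[THEN conjunct2, rule_format, of i] that by (simp add: cyc_def)
    thus "reduced_cycle E c"
      using False unfolding reduced_cycle_def Let_def by (simp add: Suc_le_eq)
  qed
qed (simp add: reduced_cycle_def)

lemma reduced_cycle_rotate: "reduced_cycle E c \<Longrightarrow> reduced_cycle E (rotate j c)"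
  by (auto simp: reduced_cycle_cyc cyc_rotate)

lemma reduced_cycle_word_power:
  "d \<noteq> [] \<Longrightarrow> k \<ge> 1 \<Longrightarrow> reduced_cycle E (word_power k d) \<longleftrightarrow> reduced_cycle E d"
  by (auto simp: reduced_cycle_cyc cyc_word_power)

lemma rotate_eq_iff_cyc:
  "c \<noteq> [] \<Longrightarrow> rotate j c = c \<longleftrightarrow> (\<forall>i. cyc c (i + j) = cyc c i)"
  using cyc_rotate[of c j] list_eq_cyc[of "rotate j c" c] by auto

lemma word_power_take:
  assumes "c \<noteq> []" "p \<ge> 1" "p dvd length c" and per: "\<And>i. cyc c (i + p) = cyc c i"
  shows "c = word_power (length c div p) (take p c)"
proof (rule list_eq_cyc)
  have p: "p \<le> length c" using assms by (simp add: dvd_imp_le)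
  hence ne: "take p c \<noteq> []" using assms by auto
  have len: "length (take p c) = p" using p by simp
  show "length c = length (word_power (length c div p) (take p c))"
    using assms len by simp
  fix i
  have per': "cyc c (j + p * k) = cyc c j" for j k
  proof (induction k)
    case (Suc k)
    thus ?case using per[of "j + p * k"] by (simp add: algebra_simps)
  qed simp
  have k: "length c div p \<ge> 1" using p assms(2) by (simp add: Suc_le_eq div_greater_zero_iff)
  have im: "i mod p < p" using assms(2) by simp
  have "cyc c i = cyc c (i mod p)"
    using per'[of "i mod p" "i div p"] by simp
  also have "\<dots> = cyc (take p c) i"
    using p len im by (simp add: cyc_def)
  also have "\<dots> = cyc (word_power (length c div p) (take p c)) i"
    using cyc_word_power[OF ne k] by simp
  finally show "cyc c i = cyc (word_power (length c div p) (take p c)) i" .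
qed

text \<open>Both \<open>j\<close> and the length are periods of \<open>cyc c\<close>, hence by
  Bezout so is their gcd \<open>g\<close>. A period dividing the length exhibits \<open>c\<close> as
  a power of its first \<open>g\<close> letters, so primitivity forces
  \<open>g = length c\<close>.\<close>

lemma primitive_period_dvd:
  assumes "primitive_cycle c" "c \<noteq> []" "rotate j c = c"
  shows "length c dvd j"
proof (cases "j = 0")
  case False
  define g where "g = gcd j (length c)"
  obtain x y where xy: "j * x = length c * y + g"
    using bezout_nat[OF False] unfolding g_def by metis
  have per: "cyc c (i + j) = cyc c i" for i
    using assms rotate_eq_iff_cyc by blast
  have perx: "cyc c (i + j * x) = cyc c i" for i x
  proof (induction x)
    case (Suc x)
    thus ?case using per[of "i + j * x"] by (simp add: algebra_simps)
  qed simp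
  have perg: "cyc c (i + g) = cyc c i" for i
  proof -
    have "cyc c (i + g) = cyc c ((i + g) + length c * y)"
      by (rule cyc_add_mult_length[symmetric])
    also have "\<dots> = cyc c (i + j * x)" using xy by (simp add: algebra_simps)
    finally show ?thesis using perx by simp
  qed
  have g: "g \<ge> 1" "g dvd length c" using False by (auto simp: g_def Suc_le_eq)
  have "length c div g < 2"
    using word_power_take[OF assms(2) g perg] assms(1) unfolding primitive_cycle_def
    by (meson not_le)
  moreover have "length c div g \<ge> 1"
    using g assms(2) by (simp add: Suc_le_eq div_greater_zero_iff dvd_imp_le)
  ultimately have "length c div g = 1" by simp
  hence "length c = g" using g by (metis dvd_div_mult_self mult_1)
  moreover have "g dvd j" by (simp add: g_def)
  ultimately show ?thesis by simp
qed simp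

lemma rotate_eq_self_iff:
  assumes "primitive_cycle c" "c \<noteq> []"
  shows "rotate j c = c \<longleftrightarrow> length c dvd j"
  using primitive_period_dvd[OF assms] by (auto simp: rotate_id)

lemma primitive_root_exists:
  "c \<noteq> [] \<Longrightarrow> \<exists>d k. primitive_cycle d \<and> d \<noteq> [] \<and> k \<ge> 1 \<and> c = word_power k d"
proof (induction "length c" arbitrary: c rule: less_induct)
  case less
  show ?case
  proof (cases "primitive_cycle c")
    case True
    thus ?thesis using less.prems by (intro exI[of _ c] exI[of _ 1]) auto
  next
    case False
    then obtain d k where dk: "k \<ge> 2" "c = word_power k d"
      unfolding primitive_cycle_def by blast
    have d: "d \<noteq> []" using dk less.prems by (auto simp: concat_replicate_trivial)
    have "length d < length c" using dk d by simp
    from less.hyps[OF this d] obtain e l where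
      e: "primitive_cycle e" "e \<noteq> []" "l \<ge> 1" "d = word_power l e" by blast
    have "c = word_power (k * l) e"
    proof (rule list_eq_cyc)
      fix i
      show "cyc c i = cyc (word_power (k * l) e) i"
        unfolding dk(2) using dk(1) d e by (subst cyc_word_power) (auto simp: cyc_word_power)
    qed (use dk e in simp)
    moreover have "k * l \<ge> 1" using dk e by (simp add: Suc_le_eq)
    ultimately show ?thesis using e by blast
  qed
qed

text \<open>Equal powers unroll to the same periodic sequence. Each length is then a period of the
  other root, and primitivity makes the two lengths divide each other.\<close>

lemma primitive_root_unique:
  assumes "primitive_cycle d" "d \<noteq> []" "k \<ge> 1" "primitive_cycle e" "e \<noteq> []" "l \<ge> 1"
    and eq: "word_power k d = word_power l e"
  shows "d = e"
proof -
  have c: "cyc d i = cyc e i" for i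
    using cyc_word_power[of d k i] cyc_word_power[of e l i] assms by simp
  have "rotate (length e) d = d" "rotate (length d) e = e"
    using assms(2,5) cyc_add_length[of d] cyc_add_length[of e] unfolding c
    by (simp_all add: rotate_eq_iff_cyc c)
  hence "length d dvd length e" "length e dvd length d"
    using assms by (simp_all add: rotate_eq_self_iff)
  hence "length d = length e" by (rule dvd_antisym)
  thus ?thesis using c by (rule list_eq_cyc)
qed

lemma primitive_cycle_rotate:
  assumes "primitive_cycle c"
  shows "primitive_cycle (rotate j c)"
proof (cases "c = []")
  case False
  show ?thesis unfolding primitive_cycle_def
  proof
    assume "\<exists>d k. 2 \<le> k \<and> rotate j c = word_power k d"
    then obtain d k where dk: "k \<ge> 2" "rotate j c = word_power k d" by blast
    have len: "length c = k * length d" using dk(2) by (metis length_rotate length_word_power)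
    hence d: "d \<noteq> []" using False by auto
    have per: "cyc c (i + j + length d) = cyc c (i + j)" for i
    proof -
      have "cyc c (i + j + length d) = cyc (rotate j c) (i + length d)"
        using False by (simp add: cyc_rotate algebra_simps)
      also have "\<dots> = cyc (rotate j c) i"
        unfolding dk(2) using d dk(1) by (simp add: cyc_word_power)
      finally show ?thesis using False by (simp add: cyc_rotate)
    qed
    have "rotate (length d) c = c"
    proof (subst rotate_eq_iff_cyc[OF False], intro allI)
      fix i
      have l: "length c \<ge> 1" using False by (simp add: Suc_le_eq)
      \<comment> \<open>Periodicity is known only from index \<open>j\<close> onwards; adding
        \<open>length c * j\<close> moves any index past \<open>j\<close> without changing its
        letter.\<close>
      have "j \<le> length c * j" using l by simp
      then obtain i' where i': "i + length c * j = i' + j"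
        by (metis add.commute le_add2 le_add_diff_inverse2 le_trans)
      have "cyc c (i + length d) = cyc c (i + length d + length c * j)"
        by (rule cyc_add_mult_length[symmetric])
      also have "i + length d + length c * j = i' + j + length d" using i' by simp
      also have "cyc c (i' + j + length d) = cyc c (i + length c * j)" using per i' by simp
      finally show "cyc c (i + length d) = cyc c i" by (simp add: cyc_add_mult_length)
    qed
    hence "length c dvd length d" using assms False by (simp add: rotate_eq_self_iff)
    moreover have "length d < length c" using len dk(1) d by simp
    ultimately show False using d by (simp add: nat_dvd_not_less)
  qed
qed (use assms in simp)

section \<open>Counting reduced cycles by primes\<close>

definition reduced_cycles :: "('a \<Rightarrow> 'a \<Rightarrow> bool) \<Rightarrow> nat \<Rightarrow> 'a list set" where
  "reduced_cycles E m = {c. reduced_cycle E c \<and> length c = m}"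

definition primitive_cycles :: "('a \<Rightarrow> 'a \<Rightarrow> bool) \<Rightarrow> nat \<Rightarrow> 'a list set" where
  "primitive_cycles E m = {c \<in> reduced_cycles E m. primitive_cycle c}"

lemma reduced_cycles_subset:
  assumes "simple_graph V E"
  shows "reduced_cycles E m \<subseteq> {c. set c \<subseteq> V \<and> length c = m}"
proof safe
  fix c x assume "c \<in> reduced_cycles E m" "x \<in> set c"
  moreover then obtain i where "i < length c" "x = c ! i" by (auto simp: in_set_conv_nth)
  ultimately have "E x (c ! ((i + 1) mod length c))"
    by (auto simp: reduced_cycles_def reduced_cycle_def Let_def)
  thus "x \<in> V" using assms by (auto simp: simple_graph_def)
qed (simp add: reduced_cycles_def)

lemma finite_reduced_cycles:
  "simple_graph V E \<Longrightarrow> finite (reduced_cycles E m)"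
  by (rule finite_subset[OF reduced_cycles_subset], assumption)
     (simp add: finite_lists_length_eq simple_graph_def)

lemma card_reduced_cycles_le:
  assumes "simple_graph V E"
  shows "card (reduced_cycles E m) \<le> card V ^ m"
  using card_mono[OF _ reduced_cycles_subset[OF assms, of m]] assms
  by (simp add: finite_lists_length_eq card_lists_length_eq simple_graph_def)

lemma reduced_cycles_eq_UN:
  assumes "m \<ge> 1"
  shows "reduced_cycles E m = (\<Union>d\<in>{d. d dvd m}. word_power (m div d) ` primitive_cycles E d)"
proof (intro equalityI subsetI)
  fix c assume "c \<in> reduced_cycles E m"
  hence c: "reduced_cycle E c" "length c = m" by (auto simp: reduced_cycles_def)
  hence "c \<noteq> []" using assms by auto
  then obtain d k where d: "primitive_cycle d" "d \<noteq> []" "k \<ge> 1" "c = word_power k d"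
    using primitive_root_exists by blast
  have m: "m = k * length d" using c d by simp
  have "d \<in> primitive_cycles E (length d)"
    using d c by (auto simp: primitive_cycles_def reduced_cycles_def reduced_cycle_word_power)
  moreover have "m div length d = k" using m d by simp
  ultimately show "c \<in> (\<Union>d\<in>{d. d dvd m}. word_power (m div d) ` primitive_cycles E d)"
    using d m by (intro UN_I[of "length d"]) auto
next
  fix c assume "c \<in> (\<Union>d\<in>{d. d dvd m}. word_power (m div d) ` primitive_cycles E d)"
  then obtain l d where d: "l dvd m" "d \<in> primitive_cycles E l" "c = word_power (m div l) d" by auto
  hence r: "reduced_cycle E d" "length d = l"
    by (auto simp: primitive_cycles_def reduced_cycles_def)
  have "d \<noteq> []" using r by (simp add: reduced_cycle_cyc)
  moreover have "m div l \<ge> 1"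
    using d(1) assms by (metis One_nat_def Suc_leI dvd_div_eq_0_iff gr0I not_one_le_zero)
  ultimately show "c \<in> reduced_cycles E m"
    using d r by (simp add: reduced_cycles_def reduced_cycle_word_power)
qed

text \<open>Every reduced cycle has exactly one primitive root, so the union over divisors is
  disjoint and each part is an injective image of the primitive cycles of that length.\<close>

lemma card_reduced_cycles_eq_sum:
  assumes "simple_graph V E" "m \<ge> 1"
  shows "card (reduced_cycles E m) = (\<Sum>d | d dvd m. card (primitive_cycles E d))"
proof -
  have pos: "m div d \<ge> 1" if "d dvd m" for d
    using that assms(2) by (metis One_nat_def Suc_leI dvd_div_eq_0_iff gr0I not_one_le_zero)
  have prim: "primitive_cycle x \<and> x \<noteq> [] \<and> length x = d" if "x \<in> primitive_cycles E d" for x d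
    using that by (auto simp: primitive_cycles_def reduced_cycles_def reduced_cycle_cyc)
  have fin: "finite (primitive_cycles E d)" for d
    using finite_reduced_cycles[OF assms(1), of d] by (simp add: primitive_cycles_def)
  have "card (reduced_cycles E m) = (\<Sum>d | d dvd m. card (word_power (m div d) ` primitive_cycles E d))"
    unfolding reduced_cycles_eq_UN[OF assms(2)]
  proof (rule card_UN_disjoint)
    show "finite {d. d dvd m}" using assms(2) by (simp add: finite_divisors_nat)
    show "\<forall>i\<in>{d. d dvd m}. finite (word_power (m div i) ` primitive_cycles E i)" using fin by simp
    show "\<forall>i\<in>{d. d dvd m}. \<forall>j\<in>{d. d dvd m}. i \<noteq> j \<longrightarrow>
       word_power (m div i) ` primitive_cycles E i \<inter> word_power (m div j) ` primitive_cycles E j = {}"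
    proof (intro ballI impI, rule ccontr)
      fix i j assume ij: "i \<in> {d. d dvd m}" "j \<in> {d. d dvd m}" "i \<noteq> j"
        and "word_power (m div i) ` primitive_cycles E i \<inter> word_power (m div j) ` primitive_cycles E j \<noteq> {}"
      then obtain x y where xy: "x \<in> primitive_cycles E i" "y \<in> primitive_cycles E j"
        "word_power (m div i) x = word_power (m div j) y" by blast
      have "x = y"
        using primitive_root_unique[of x "m div i" y "m div j"] prim[OF xy(1)] prim[OF xy(2)]
          pos[of i] pos[of j] ij xy(3) by simp
      thus False using prim[OF xy(1)] prim[OF xy(2)] ij by simp
    qed
  qed
  also have "\<dots> = (\<Sum>d | d dvd m. card (primitive_cycles E d))"
  proof (rule sum.cong[OF refl], rule card_image, rule inj_onI)
    fix d x y assume h: "d \<in> {d. d dvd m}" "x \<in> primitive_cycles E d" "y \<in> primitive_cycles E d"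
      "word_power (m div d) x = word_power (m div d) y"
    show "x = y"
      using primitive_root_unique[of x "m div d" y "m div d"] prim[OF h(2)] prim[OF h(3)] pos h(1,4)
      by simp
  qed
  finally show ?thesis .
qed

section \<open>Rotation classes of primitive cycles\<close>

definition rotations :: "'a list \<Rightarrow> 'a list set" where
  "rotations c = {rotate j c | j. True}"

lemma rotations_eq: "c \<noteq> [] \<Longrightarrow> rotations c = (\<lambda>j. rotate j c) ` {..<length c}"
proof (intro equalityI subsetI)
  fix d assume "c \<noteq> []" "d \<in> rotations c"
  then obtain j where "d = rotate j c" by (auto simp: rotations_def)
  hence "d = rotate (j mod length c) c" by (simp flip: rotate_conv_mod)
  thus "d \<in> (\<lambda>j. rotate j c) ` {..<length c}" using \<open>c \<noteq> []\<close> by auto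
qed (auto simp: rotations_def)

lemma self_in_rotations: "c \<in> rotations c"
  by (auto simp: rotations_def intro: exI[of _ 0])

lemma rotations_rotate: "rotations (rotate j c) = rotations c"
proof (cases "c = []")
  case False
  have "rotate k c \<in> rotations (rotate j c)" for k
  proof -
    have "j \<le> length c * j" using False by (cases c) auto
    hence "k + (length c * j - j) + j = k + length c * j" by linarith
    hence "rotate (k + (length c * j - j)) (rotate j c) = rotate (k + length c * j) c"
      by (simp only: rotate_rotate)
    also have "\<dots> = rotate k c" by (subst (1 2) rotate_conv_mod) simp
    finally have "rotate (k + (length c * j - j)) (rotate j c) = rotate k c" .
    from this[symmetric] show ?thesis unfolding rotations_def by blast
  qed
  thus ?thesis by (auto simp: rotations_def rotate_rotate)
qed simp

lemma card_rotations:
  assumes "primitive_cycle c" "c \<noteq> []"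
  shows "card (rotations c) = length c"
proof -
  have *: "i = j" if "i \<le> j" "j < length c" "rotate i c = rotate j c" for i j
  proof -
    have "rotate (j - i) c = c"
    proof (subst rotate_eq_iff_cyc[OF assms(2)], intro allI)
      fix k
      have "i \<le> length c * i" using assms(2) by (cases c) auto
      then obtain l where l: "k + length c * i = l + i"
        by (metis add.commute le_add2 le_add_diff_inverse2 le_trans)
      have "cyc c (k + (j - i)) = cyc c (k + (j - i) + length c * i)"
        by (simp add: cyc_add_mult_length)
      also have "\<dots> = cyc c (l + j)" using l that(1) by (simp add: algebra_simps)
      also have "\<dots> = cyc c (l + i)" using that(3) cyc_rotate[OF assms(2)] by metis
      also have "\<dots> = cyc c k" using l by (metis cyc_add_mult_length)
      finally show "cyc c (k + (j - i)) = cyc c k" .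
    qed
    hence "length c dvd j - i" using assms by (simp add: rotate_eq_self_iff)
    thus ?thesis using that nat_dvd_not_less[of "j - i" "length c"] by fastforce
  qed
  have "inj_on (\<lambda>j. rotate j c) {..<length c}"
  proof (rule inj_onI)
    fix i j assume "i \<in> {..<length c}" "j \<in> {..<length c}" "rotate i c = rotate j c"
    thus "i = j" using *[of i j] *[of j i] by (cases "i \<le> j") auto
  qed
  thus ?thesis using assms by (simp add: rotations_eq card_image)
qed

text \<open>A primitive word of length \<open>m\<close> has \<open>m\<close> distinct rotations, so
  each prime class of length \<open>m\<close> accounts for exactly \<open>m\<close> words.\<close>

lemma card_primitive_cycles:
  assumes "simple_graph V E"
  shows "card (primitive_cycles E m) = m * num_primes E m"
proof -
  define C where "C = rotations ` primitive_cycles E m"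
  have fin: "finite (primitive_cycles E m)"
    using finite_reduced_cycles[OF assms, of m] by (simp add: primitive_cycles_def)
  have rot: "rotate j c \<in> primitive_cycles E m" if "c \<in> primitive_cycles E m" for j c
    using that by (auto simp: primitive_cycles_def reduced_cycles_def primitive_cycle_rotate
        reduced_cycle_rotate)
  have un: "\<Union>C = primitive_cycles E m"
  proof (intro equalityI subsetI)
    fix c assume "c \<in> \<Union>C"
    then obtain d j where "d \<in> primitive_cycles E m" "c = rotate j d"
      unfolding C_def rotations_def by blast
    thus "c \<in> primitive_cycles E m" using rot by simp
  qed (auto simp: C_def intro: self_in_rotations)
  have C: "{P \<in> prime_classes E. \<forall>c\<in>P. length c = m} = C"
  proof (intro equalityI subsetI)
    fix P assume P: "P \<in> {P \<in> prime_classes E. \<forall>c\<in>P. length c = m}"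
    then obtain c where "P = rotations c" "reduced_cycle E c" "primitive_cycle c"
      unfolding prime_classes_def rotations_def by blast
    moreover from this have "length c = m" using P self_in_rotations by blast
    ultimately show "P \<in> C" by (auto simp: C_def primitive_cycles_def reduced_cycles_def)
  next
    fix P assume "P \<in> C"
    thus "P \<in> {P \<in> prime_classes E. \<forall>c\<in>P. length c = m}"
      by (auto simp: C_def primitive_cycles_def reduced_cycles_def prime_classes_def rotations_def)
  qed
  have "m * card C = card (\<Union>C)"
  proof (rule card_partition)
    show "finite C" using fin by (simp add: C_def)
    show "finite (\<Union>C)" using fin un by simp
    show "card P = m" if "P \<in> C" for P
      using that card_rotations
      by (auto simp: C_def primitive_cycles_def reduced_cycles_def reduced_cycle_cyc)
    show "P \<inter> Q = {}" if "P \<in> C" "Q \<in> C" "P \<noteq> Q" for P Q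
    proof (rule ccontr)
      assume "P \<inter> Q \<noteq> {}"
      then obtain c where "c \<in> P" "c \<in> Q" by auto
      moreover have "R = rotations c" if R: "R \<in> C" "c \<in> R" for R
      proof -
        obtain d j where "R = rotations d" "c = rotate j d"
          using R unfolding C_def rotations_def by blast
        thus ?thesis by (simp add: rotations_rotate)
      qed
      ultimately show False using that by metis
    qed
  qed
  thus ?thesis unfolding un num_primes_def C by simp
qed

lemma card_reduced_cycles_eq_sum_primes:
  assumes "simple_graph V E" "m \<ge> 1"
  shows "card (reduced_cycles E m) = (\<Sum>d | d dvd m. d * num_primes E d)"
  using card_reduced_cycles_eq_sum[OF assms] card_primitive_cycles[OF assms(1)] by simp

lemma num_primes_le:
  assumes "simple_graph V E" "m \<ge> 1"
  shows "num_primes E m \<le> card V ^ m"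
proof -
  have "num_primes E m \<le> m * num_primes E m" using assms(2) by simp
  also have "\<dots> = card (primitive_cycles E m)" using card_primitive_cycles[OF assms(1)] by simp
  also have "\<dots> \<le> card (reduced_cycles E m)"
    by (rule card_mono[OF finite_reduced_cycles[OF assms(1)]]) (auto simp: primitive_cycles_def)
  also have "\<dots> \<le> card V ^ m" by (rule card_reduced_cycles_le[OF assms(1)])
  finally show ?thesis .
qed

section \<open>The Euler product\<close>

lemma exp_neg_of_nat_Ln: "(z::complex) \<noteq> 0 \<Longrightarrow> exp (- (of_nat k * Ln z)) = inverse (z ^ k)"
  by (simp add: exp_minus exp_of_nat_mult)

lemma log_series_sums:
  assumes "norm (z::complex) < 1"
  shows "(\<lambda>k. z ^ Suc k / of_nat (Suc k)) sums (- Ln (1 - z))"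
proof -
  have "(\<lambda>n. - ((-(-z))^n) / of_nat n) sums Ln (1 + (-z))"
    by (rule Ln_series') (use assms in simp)
  hence "(\<lambda>n. - (- (z^n) / of_nat n)) sums - Ln (1 - z)"
    by (intro sums_minus) simp
  hence "(\<lambda>n. z^n / of_nat n) sums - Ln (1 - z)" by simp
  \<comment> \<open>The term at index 0 is \<open>z^0 / 0\<close>, which is 0, so the series may
    start at index 1.\<close>
  thus ?thesis by (subst sums_Suc_iff) simp
qed

lemma log_series_abs_summable:
  assumes "norm (z::complex) < 1"
  shows "summable (\<lambda>k. norm (z ^ Suc k / of_nat (Suc k)))"
proof (rule summable_comparison_test')
  show "summable (\<lambda>k. norm z ^ k)" using assms by (simp add: summable_geometric)
  fix k :: nat
  have "norm z ^ Suc k \<le> norm z ^ k" by (rule power_decreasing) (use assms in auto)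
  moreover have "norm z ^ Suc k / of_nat (Suc k) \<le> norm z ^ Suc k"
    by (rule order.trans[OF divide_left_mono[of 1]]) auto
  ultimately show "norm (norm (z ^ Suc k / of_nat (Suc k))) \<le> norm z ^ k"
    by (simp add: norm_divide norm_power norm_mult del: of_nat_Suc)
qed

definition log_zeta_term :: "('a \<Rightarrow> 'a \<Rightarrow> bool) \<Rightarrow> complex \<Rightarrow> nat \<Rightarrow> complex" where
  "log_zeta_term E u n = of_nat (card (reduced_cycles E (Suc n))) * u ^ Suc n / of_nat (Suc n)"

text \<open>Expanding the logarithm of each Euler factor gives a double series with terms
  \<open>num_primes E m * u^(m k) / k\<close>. Absolute convergence permits a second summation along
  \<open>m k = n\<close>. There \<open>1 / k = m / n\<close>, and the divisor sum of
  \<open>m * num_primes E m\<close> is the number of reduced cycles of length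
  \<open>n\<close>.\<close>

lemma ihara_zeta_eq_exp:
  assumes G: "simple_graph V E" and u: "norm u * (real (card V) + 1) < 1"
  shows "log_zeta_term E u sums suminf (log_zeta_term E u)"
    and "ihara_zeta E u = exp (suminf (log_zeta_term E u))"
proof -
  \<comment> \<open>The summand 1 makes \<open>x\<close> dominate both
    \<open>norm u * card V\<close>, which controls the number of primes, and \<open>norm u\<close>
    itself, even when \<open>V\<close> is empty.\<close>
  define x where "x = norm u * (real (card V) + 1)"
  have x: "0 \<le> x" "x < 1" using u by (auto simp: x_def)
  have ux: "norm u \<le> x" by (simp add: x_def algebra_simps)
  define g where "g = (\<lambda>(m, k). of_nat (num_primes E (Suc m)) * (u ^ Suc m) ^ Suc k / complex_of_nat (Suc k))"
  have bound: "norm (g (m, k)) \<le> x ^ m * x ^ k" for m k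
  proof -
    have n: "real (num_primes E (Suc m)) \<le> (real (card V) + 1) ^ Suc m"
    proof -
      have "real (num_primes E (Suc m)) \<le> real (card V ^ Suc m)"
        using num_primes_le[OF G, of "Suc m"] by linarith
      also have "\<dots> \<le> (real (card V) + 1) ^ Suc m"
        unfolding of_nat_power by (rule power_mono) auto
      finally show ?thesis .
    qed
    have "norm (g (m, k)) \<le> real (num_primes E (Suc m)) * (norm u ^ Suc m) ^ Suc k"
      unfolding g_def prod.case norm_divide norm_mult norm_power norm_of_nat
      by (rule order.trans[OF divide_left_mono[of 1]]) auto
    also have "\<dots> \<le> (real (card V) + 1) ^ Suc m * (norm u ^ Suc m) ^ Suc k"
      by (rule mult_right_mono[OF n]) auto
    also have "\<dots> = x ^ Suc m * (norm u ^ Suc m) ^ k"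
      by (simp add: x_def power_mult_distrib mult_ac)
    also have "\<dots> \<le> x ^ m * x ^ k"
    proof (rule mult_mono)
      show "x ^ Suc m \<le> x ^ m" by (rule power_decreasing) (use x in auto)
      have "norm u ^ Suc m \<le> x ^ Suc m" by (rule power_mono[OF ux]) auto
      also have "\<dots> \<le> x ^ 1" by (rule power_decreasing) (use x in auto)
      finally show "(norm u ^ Suc m) ^ k \<le> x ^ k" by (intro power_mono) auto
    qed (use x in auto)
    finally show ?thesis .
  qed
  have geo: "((\<lambda>k. c * x ^ k) has_sum c * (1 / (1 - x))) UNIV" if "c \<ge> 0" for c
  proof (rule norm_summable_imp_has_sum)
    show "(\<lambda>k. c * x ^ k) sums (c * (1 / (1 - x)))"
      by (intro sums_mult geometric_sums) (use x in auto)
    thus "summable (\<lambda>k. norm (c * x ^ k))" using x that by (simp add: sums_iff abs_mult)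
  qed
  have "(\<lambda>(m, k). x ^ m * x ^ k) summable_on (UNIV \<times> UNIV)"
  proof (rule summable_on_SigmaI)
    show "((\<lambda>k. case (m, k) of (m, k) \<Rightarrow> x ^ m * x ^ k) has_sum x ^ m * (1 / (1 - x))) UNIV" for m
      using geo[of "x ^ m"] x by simp
    show "(\<lambda>m. x ^ m * (1 / (1 - x))) summable_on UNIV"
      using geo[of "1 / (1 - x)"] x by (auto simp: summable_on_def mult.commute)
  qed (use x in auto)
  hence "(\<lambda>p. norm (g p)) summable_on (UNIV \<times> UNIV)"
    by (rule summable_on_comparison_test) (use bound in auto)
  hence "g summable_on (UNIV \<times> UNIV)" by (rule abs_summable_summable)
  then obtain S where S: "(g has_sum S) (UNIV \<times> UNIV)" by (auto simp: summable_on_def)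

  have small: "norm (u ^ Suc m) < 1" for m
  proof -
    have "norm (u ^ Suc m) \<le> x ^ Suc m" unfolding norm_power by (rule power_mono[OF ux]) auto
    also have "\<dots> \<le> x ^ 1" by (rule power_decreasing) (use x in auto)
    finally show ?thesis using x by simp
  qed
  define a where "a m = - (of_nat (num_primes E (Suc m)) * Ln (1 - u ^ Suc m))" for m
  have "(a has_sum S) UNIV"
  proof (rule has_sum_SigmaD[OF S])
    fix m
    have "((\<lambda>k. (u ^ Suc m) ^ Suc k / of_nat (Suc k)) has_sum - Ln (1 - u ^ Suc m)) UNIV"
      by (rule norm_summable_imp_has_sum[OF log_series_abs_summable log_series_sums]) (use small in auto)
    from has_sum_cmult_right[OF this, of "of_nat (num_primes E (Suc m))"]
    show "((\<lambda>k. g (m, k)) has_sum a m) UNIV" by (simp add: g_def a_def mult_ac)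
  qed
  hence aS: "a sums S" by (rule has_sum_imp_sums)

  \<comment> \<open>All indices are shifted by one: \<open>(m, k)\<close> stands for the length
    \<open>Suc m\<close> and the exponent \<open>Suc k\<close>, and corresponds to
    \<open>Suc n = Suc m * Suc k\<close> with divisor \<open>d = Suc m\<close>.\<close>
  have "((\<lambda>(n, d). g (d - 1, Suc n div d - 1)) has_sum S) (SIGMA n:UNIV. {d. d dvd Suc n}) =
        (g has_sum S) (UNIV \<times> UNIV)"
    by (rule has_sum_reindex_bij_witness[where j = "\<lambda>(n, d). (d - 1, Suc n div d - 1)"
          and i = "\<lambda>(m, k). (Suc m * Suc k - 1, Suc m)"])
       (auto simp del: mult_Suc mult_Suc_right elim!: dvdE; case_tac k; case_tac b;
        auto simp del: mult_Suc mult_Suc_right)+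
  hence "((\<lambda>(n, d). g (d - 1, Suc n div d - 1)) has_sum S) (SIGMA n:UNIV. {d. d dvd Suc n})"
    using S by simp
  hence "(log_zeta_term E u has_sum S) UNIV"
  proof (rule has_sum_SigmaD)
    fix n :: nat
    have "g (d - 1, Suc n div d - 1) = of_nat (d * num_primes E d) * (u ^ Suc n / of_nat (Suc n))"
      if "d dvd Suc n" for d
    proof -
      from that obtain k where k: "Suc n = d * k" by (elim dvdE)
      hence dk: "d > 0" "k > 0" by (metis Zero_not_Suc gr0I mult_0 mult_0_right)+
      hence "Suc n div d - 1 = k - 1" "Suc (d - 1) = d" "Suc (k - 1) = k" using k by auto
      thus ?thesis using dk unfolding g_def prod.case k
        by (simp add: power_mult divide_simps del: mult_Suc)
    qed
    hence "(\<Sum>d | d dvd Suc n. g (d - 1, Suc n div d - 1)) =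
           (\<Sum>d | d dvd Suc n. of_nat (d * num_primes E d)) * (u ^ Suc n / of_nat (Suc n))"
      unfolding sum_distrib_right by (intro sum.cong) auto
    also have "\<dots> = log_zeta_term E u n"
      unfolding log_zeta_term_def card_reduced_cycles_eq_sum_primes[OF G, of "Suc n", simplified] by simp
    finally have *: "(\<Sum>d | d dvd Suc n. g (d - 1, Suc n div d - 1)) = log_zeta_term E u n" .
    show "((\<lambda>d. case (n, d) of (n, d) \<Rightarrow> g (d - 1, Suc n div d - 1)) has_sum log_zeta_term E u n) {d. d dvd Suc n}"
      unfolding *[symmetric] prod.case by (rule has_sum_finite) (simp add: finite_divisors_nat)
  qed
  hence lS: "log_zeta_term E u sums S" by (rule has_sum_imp_sums)
  thus "log_zeta_term E u sums suminf (log_zeta_term E u)" by (simp add: sums_iff)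

  have "ihara_zeta E u = (\<Prod>m. exp (a m))"
    unfolding ihara_zeta_def a_def
  proof (intro arg_cong[where f = prodinf] ext)
    fix m
    have "1 - u ^ Suc m \<noteq> 0" using small[of m] by (metis eq_iff_diff_eq_0 less_irrefl norm_one)
    thus "inverse ((1 - u ^ Suc m) ^ num_primes E (Suc m)) =
          exp (- (of_nat (num_primes E (Suc m)) * Ln (1 - u ^ Suc m)))"
      by (rule exp_neg_of_nat_Ln[symmetric])
  qed
  also have "\<dots> = exp S" using aS by (subst prodinf_exp) (auto simp: sums_iff)
  also have "S = suminf (log_zeta_term E u)" using lS by (simp add: sums_iff)
  finally show "ihara_zeta E u = exp (suminf (log_zeta_term E u))" .
qed

section \<open>Matrices indexed by lists\<close>

text \<open>Vertices and arcs come from arbitrary types, whereas matrix indices are numbers. Listing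
  the index sets keeps entries as functions of vertices or arcs, and appending lists produces block
  matrices.\<close>

definition lmat :: "'a list \<Rightarrow> 'b list \<Rightarrow> ('a \<Rightarrow> 'b \<Rightarrow> 'c) \<Rightarrow> 'c mat" where
  "lmat xs ys f = mat (length xs) (length ys) (\<lambda>(i, j). f (xs ! i) (ys ! j))"

lemma lmat_carrier [simp]: "lmat xs ys f \<in> carrier_mat (length xs) (length ys)"
  by (simp add: lmat_def)

lemma lmat_dim [simp]: "dim_row (lmat xs ys f) = length xs" "dim_col (lmat xs ys f) = length ys"
  by (simp_all add: lmat_def)

lemma lmat_index [simp]:
  "i < length xs \<Longrightarrow> j < length ys \<Longrightarrow> lmat xs ys f $$ (i, j) = f (xs ! i) (ys ! j)"
  by (simp add: lmat_def)

lemma lmat_cong: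
  "(\<And>x y. x \<in> set xs \<Longrightarrow> y \<in> set ys \<Longrightarrow> f x y = g x y) \<Longrightarrow> lmat xs ys f = lmat xs ys g"
  by (rule eq_matI) auto

lemma sum_set_conv_nth:
  "distinct xs \<Longrightarrow> (\<Sum>x\<in>set xs. h x) = (\<Sum>i = 0..<length xs. h (xs ! i))"
  by (rule sum.reindex_bij_betw[OF bij_betw_nth, symmetric]) auto

lemma prod_set_conv_nth:
  "distinct xs \<Longrightarrow> (\<Prod>x\<in>set xs. h x) = (\<Prod>i = 0..<length xs. h (xs ! i))"
  by (rule prod.reindex_bij_betw[OF bij_betw_nth, symmetric]) auto

lemma lmat_mult:
  fixes f :: "'a \<Rightarrow> 'b \<Rightarrow> 'c :: comm_semiring_0"
  assumes "distinct ys"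
  shows "lmat xs ys f * lmat ys zs g = lmat xs zs (\<lambda>x z. \<Sum>y\<in>set ys. f x y * g y z)"
  by (rule eq_matI) (auto simp: scalar_prod_def sum_set_conv_nth[OF assms])

lemma lmat_add: "lmat xs ys f + lmat xs ys g = lmat xs ys (\<lambda>x y. f x y + g x y)"
  by (rule eq_matI) auto

lemma lmat_one: "distinct xs \<Longrightarrow> lmat xs xs (\<lambda>x y. if x = y then 1 else 0) = 1\<^sub>m (length xs)"
  by (rule eq_matI) (auto simp: nth_eq_iff_index_eq)

lemma lmat_zero: "lmat xs ys (\<lambda>x y. 0) = 0\<^sub>m (length xs) (length ys)"
  by (rule eq_matI) auto

lemma lmat_append:
  "lmat (xs @ xs') (ys @ ys') f =
   four_block_mat (lmat xs ys f) (lmat xs ys' f) (lmat xs' ys f) (lmat xs' ys' f)"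
  by (rule eq_matI) (auto simp: nth_append)

lemma lmat_map: "lmat (map p xs) (map q ys) f = lmat xs ys (\<lambda>x y. f (p x) (q y))"
  by (rule eq_matI) auto

lemma mult_four_block_lmat:
  fixes f1 :: "'a \<Rightarrow> 'c \<Rightarrow> 'e :: comm_semiring_0"
  assumes "distinct ys" "distinct ys'"
  shows "four_block_mat (lmat xs ys f1) (lmat xs ys' f2) (lmat xs' ys f3) (lmat xs' ys' f4) *
     four_block_mat (lmat ys zs g1) (lmat ys zs' g2) (lmat ys' zs g3) (lmat ys' zs' g4) =
     four_block_mat
       (lmat xs zs (\<lambda>x z. (\<Sum>y\<in>set ys. f1 x y * g1 y z) + (\<Sum>y\<in>set ys'. f2 x y * g3 y z)))
       (lmat xs zs' (\<lambda>x z. (\<Sum>y\<in>set ys. f1 x y * g2 y z) + (\<Sum>y\<in>set ys'. f2 x y * g4 y z)))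
       (lmat xs' zs (\<lambda>x z. (\<Sum>y\<in>set ys. f3 x y * g1 y z) + (\<Sum>y\<in>set ys'. f4 x y * g3 y z)))
       (lmat xs' zs' (\<lambda>x z. (\<Sum>y\<in>set ys. f3 x y * g2 y z) + (\<Sum>y\<in>set ys'. f4 x y * g4 y z)))"
  unfolding mult_four_block_mat[OF lmat_carrier lmat_carrier lmat_carrier lmat_carrier
      lmat_carrier lmat_carrier lmat_carrier lmat_carrier]
    lmat_mult[OF assms(1)] lmat_mult[OF assms(2)] lmat_add ..

text \<open>The Leibniz sum over permutations of a set needs no enumeration and has the shape of
  \<open>char_poly_graph\<close>.\<close>

definition set_det :: "'a set \<Rightarrow> ('a \<Rightarrow> 'a \<Rightarrow> 'b :: comm_ring_1) \<Rightarrow> 'b" where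
  "set_det V f = (\<Sum>p | p permutes V. of_int (sign p) * (\<Prod>v\<in>V. f v (p v)))"

text \<open>Conjugation with \<open>nth\<close> carries permutations of positions to permutations of
  the listed elements and preserves signs.\<close>

lemma det_lmat:
  fixes f :: "'a \<Rightarrow> 'a \<Rightarrow> 'b :: comm_ring_1"
  assumes "distinct xs"
  shows "det (lmat xs xs f) = set_det (set xs) f"
proof -
  let ?n = "length xs" and ?A = "{0..<length xs}"
  have bij: "bij_betw (nth xs) ?A (set xs)"
    using bij_betw_nth[OF assms, of ?A "set xs"] by (simp add: lessThan_atLeast0)
  hence inj: "inj_on (nth xs) ?A" by (rule bij_betw_imp_inj_on)
  let ?h = "map_permutation ?A (nth xs)"
  have "bij_betw ?h {p. p permutes ?A} {p. p permutes set xs}"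
    using bij_betw_permutations[OF bij] bij_betw_imp_surj_on[OF bij]
    by (simp add: map_permutation_def[abs_def] restrict_id_def o_def)
  hence "set_det (set xs) f = (\<Sum>p | p permutes ?A. of_int (sign (?h p)) * (\<Prod>v\<in>set xs. f v (?h p v)))"
    unfolding set_det_def by (rule sum.reindex_bij_betw[symmetric])
  also have "\<dots> = (\<Sum>p | p permutes ?A. of_int (sign p) * (\<Prod>i\<in>?A. lmat xs xs f $$ (i, p i)))"
  proof (rule sum.cong[OF refl], clarify)
    fix p assume p: "p permutes ?A"
    have "?h p (xs ! i) = xs ! p i" if "i \<in> ?A" for i
      using map_permutation_apply[OF inj that] by simp
    moreover have "p i < ?n" if "i \<in> ?A" for i using permutes_in_image[OF p] that by auto
    ultimately show "of_int (sign (?h p)) * (\<Prod>v\<in>set xs. f v (?h p v)) =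
        of_int (sign p) * (\<Prod>i\<in>?A. lmat xs xs f $$ (i, p i))"
      using sign_map_permutation[OF inj p] by (simp add: prod_set_conv_nth[OF assms])
  qed
  finally show ?thesis by (simp add: det_def)
qed

section \<open>Traces of powers\<close>

definition mat_trace :: "'a :: comm_monoid_add mat \<Rightarrow> 'a" where
  "mat_trace A = (\<Sum>i = 0..<dim_row A. A $$ (i, i))"

lemma mat_trace_lmat: "distinct xs \<Longrightarrow> mat_trace (lmat xs xs f) = (\<Sum>x\<in>set xs. f x x)"
  by (simp add: mat_trace_def sum_set_conv_nth)

lemma mat_trace_mult_comm:
  fixes A :: "'a :: comm_semiring_0 mat"
  assumes "A \<in> carrier_mat n m" "B \<in> carrier_mat m n"
  shows "mat_trace (A * B) = mat_trace (B * A)"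
proof -
  have "mat_trace (A * B) = (\<Sum>i = 0..<n. \<Sum>j = 0..<m. A $$ (i, j) * B $$ (j, i))"
    using assms by (auto simp: mat_trace_def scalar_prod_def)
  also have "\<dots> = (\<Sum>j = 0..<m. \<Sum>i = 0..<n. B $$ (j, i) * A $$ (i, j))"
    by (subst sum.swap) (simp add: mult.commute)
  also have "\<dots> = mat_trace (B * A)"
    using assms by (auto simp: mat_trace_def scalar_prod_def)
  finally show ?thesis .
qed

lemma upper_triangular_mult:
  fixes A :: "'a :: semiring_0 mat"
  assumes A: "A \<in> carrier_mat n n" "upper_triangular A" and B: "B \<in> carrier_mat n n" "upper_triangular B"
  shows "upper_triangular (A * B)" and "i < n \<Longrightarrow> (A * B) $$ (i, i) = A $$ (i, i) * B $$ (i, i)"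
proof -
  have e: "(A * B) $$ (i, j) = (\<Sum>k = 0..<n. A $$ (i, k) * B $$ (k, j))" if "i < n" "j < n" for i j
    using A B that by (simp add: scalar_prod_def)
  show "upper_triangular (A * B)"
  proof (rule upper_triangularI)
    fix i j assume ij: "j < i" "i < dim_row (A * B)"
    hence i: "i < n" using A by simp
    have "A $$ (i, k) * B $$ (k, j) = 0" if "k < n" for k
      using upper_triangularD[OF A(2), of k i] upper_triangularD[OF B(2), of j k] A(1) B(1) i ij(1) that
      by (cases "k < i") auto
    thus "(A * B) $$ (i, j) = 0" using e[of i j] i ij by simp
  qed
  assume i: "i < n"
  have "A $$ (i, k) * B $$ (k, i) = (if k = i then A $$ (i, i) * B $$ (i, i) else 0)" if "k < n" for k
    using upper_triangularD[OF A(2), of k i] upper_triangularD[OF B(2), of i k] A(1) B(1) i that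
    by (cases "k < i"; cases "i < k") auto
  hence "(\<Sum>k = 0..<n. A $$ (i, k) * B $$ (k, i)) = (\<Sum>k = 0..<n. if k = i then A $$ (i, i) * B $$ (i, i) else 0)"
    by (intro sum.cong) auto
  also have "\<dots> = A $$ (i, i) * B $$ (i, i)" using i by simp
  finally show "(A * B) $$ (i, i) = A $$ (i, i) * B $$ (i, i)" using e[of i i] i by metis
qed

lemma upper_triangular_pow:
  fixes B :: "'a :: comm_semiring_1 mat"
  assumes "B \<in> carrier_mat n n" "upper_triangular B"
  shows "upper_triangular (B ^\<^sub>m k) \<and> (\<forall>i<n. (B ^\<^sub>m k) $$ (i, i) = B $$ (i, i) ^ k)"
proof (induction k)
  case 0
  show ?case using assms by simp
next
  case (Suc k)
  have c: "B ^\<^sub>m k \<in> carrier_mat n n" using assms by simp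
  show ?case
    using upper_triangular_mult[OF c _ assms] Suc by (simp add: mult.commute)
qed

text \<open>The diagonal of a Schur triangular form serves both identities: powers of a triangular
  matrix carry the powers of its diagonal, and similarity changes neither trace nor determinant.
  Having one list for both is what links traces to the determinant through logarithms.\<close>

lemma complex_mat_eigenvalue_list:
  fixes A :: "complex mat"
  assumes A: "A \<in> carrier_mat n n"
  obtains es where "\<And>k. mat_trace (A ^\<^sub>m k) = (\<Sum>e\<leftarrow>es. e ^ k)"
    and "\<And>u. det (1\<^sub>m n - u \<cdot>\<^sub>m A) = (\<Prod>e\<leftarrow>es. 1 - u * e)"
proof -
  obtain as where as: "char_poly A = (\<Prod>a\<leftarrow>as. [:- a, 1:])" using char_poly_factorized[OF A] by blast
  obtain B P Q where "schur_decomposition A as = (B, P, Q)" by (metis prod_cases3)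
  from schur_decomposition[OF A as this] have wit: "similar_mat_wit A B P Q"
    and ut: "upper_triangular B" by auto
  note w = similar_mat_witD2(1,2,5-7)[OF A wit]
  have AP: "A = P * B * Q" by (rule similar_mat_witD2(3)[OF A wit])
  define es where "es = diag_mat B"
  have es: "es = map (\<lambda>i. B $$ (i, i)) [0..<n]" using w by (simp add: es_def diag_mat_def)
  have tr: "mat_trace (A ^\<^sub>m k) = (\<Sum>e\<leftarrow>es. e ^ k)" for k
  proof -
    have wk: "similar_mat_wit (A ^\<^sub>m k) (B ^\<^sub>m k) P Q" by (rule similar_mat_wit_pow[OF wit])
    have Bk: "B ^\<^sub>m k \<in> carrier_mat n n" using w by simp
    have "A ^\<^sub>m k = P * (B ^\<^sub>m k) * Q" by (rule similar_mat_witD2(3)[OF pow_carrier_mat[OF A] wk])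
    hence "mat_trace (A ^\<^sub>m k) = mat_trace (Q * (P * (B ^\<^sub>m k)))"
      using mat_trace_mult_comm[of "P * (B ^\<^sub>m k)" n n Q] w Bk by simp
    also have "Q * (P * (B ^\<^sub>m k)) = (Q * P) * (B ^\<^sub>m k)"
      by (rule assoc_mult_mat[symmetric]) (use w Bk in auto)
    also have "\<dots> = B ^\<^sub>m k" using w Bk by simp
    also have "mat_trace \<dots> = (\<Sum>e\<leftarrow>es. e ^ k)"
      using upper_triangular_pow[OF w(3) ut, of k] w(3)
      by (simp add: mat_trace_def es interv_sum_list_conv_sum_set_nat o_def)
    finally show ?thesis .
  qed
  have dt: "det (1\<^sub>m n - u \<cdot>\<^sub>m A) = (\<Prod>e\<leftarrow>es. 1 - u * e)" for u
  proof -
    let ?C = "1\<^sub>m n - u \<cdot>\<^sub>m B"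
    have C: "?C \<in> carrier_mat n n" using w by auto
    have "P * ?C * Q = (P * 1\<^sub>m n - P * (u \<cdot>\<^sub>m B)) * Q"
      by (subst mult_minus_distrib_mat[of _ n n _ n]) (use w in auto)
    also have "\<dots> = P * 1\<^sub>m n * Q - P * (u \<cdot>\<^sub>m B) * Q"
      by (rule minus_mult_distrib_mat[of _ n n _ _ n]) (use w in auto)
    also have "P * 1\<^sub>m n * Q = 1\<^sub>m n" using w by simp
    also have "P * (u \<cdot>\<^sub>m B) * Q = u \<cdot>\<^sub>m A"
      unfolding AP using w by (simp add: mult_smult_distrib[of _ n n _ n] mult_smult_assoc_mat[of _ n n _ n])
    finally have "1\<^sub>m n - u \<cdot>\<^sub>m A = P * ?C * Q" by simp
    hence "det (1\<^sub>m n - u \<cdot>\<^sub>m A) = det P * det ?C * det Q"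
      using w C by (simp add: det_mult[of _ n])
    also have "det P * det Q = 1" using w(1) det_mult[OF w(4,5)] by simp
    hence "det P * det ?C * det Q = det ?C" by (simp add: algebra_simps)
    also have "det ?C = prod_list (diag_mat ?C)"
      by (rule det_upper_triangular[OF upper_triangularI C])
         (use upper_triangularD[OF ut] w in auto)
    also have "\<dots> = (\<Prod>e\<leftarrow>es. 1 - u * e)"
      using w by (auto simp: es diag_mat_def o_def intro!: arg_cong[where f = prod_list])
    finally show ?thesis .
  qed
  show ?thesis using that[OF tr dt] .
qed

section \<open>The non-backtracking arc matrix\<close>

definition arcs :: "('a \<Rightarrow> 'a \<Rightarrow> bool) \<Rightarrow> ('a \<times> 'a) set" where
  "arcs E = {(x, y). E x y}"

definition follows :: "'a \<times> 'a \<Rightarrow> 'a \<times> 'a \<Rightarrow> bool" where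
  "follows a b \<longleftrightarrow> snd a = fst b \<and> fst a \<noteq> snd b"

definition nb_path :: "('a \<Rightarrow> 'a \<Rightarrow> bool) \<Rightarrow> 'a list \<Rightarrow> bool" where
  "nb_path E l \<longleftrightarrow> (\<forall>i. Suc i < length l \<longrightarrow> E (l ! i) (l ! Suc i)) \<and>
     (\<forall>i. i + 2 < length l \<longrightarrow> l ! i \<noteq> l ! (i + 2))"

text \<open>A walk with \<open>k\<close> transitions between arcs runs through \<open>k + 1\<close>
  arcs, hence has \<open>k + 2\<close> vertices; its first two and last two vertices are the arcs
  \<open>a\<close> and \<open>b\<close>.\<close>

definition nb_walks :: "('a \<Rightarrow> 'a \<Rightarrow> bool) \<Rightarrow> nat \<Rightarrow> 'a \<times> 'a \<Rightarrow> 'a \<times> 'a \<Rightarrow> 'a list set" where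
  "nb_walks E k a b =
     {l. length l = k + 2 \<and> nb_path E l \<and> (l ! 0, l ! 1) = a \<and> (l ! k, l ! Suc k) = b}"

lemma finite_arcs: "simple_graph V E \<Longrightarrow> finite (arcs E)"
  by (rule finite_subset[of _ "V \<times> V"]) (auto simp: arcs_def simple_graph_def)

lemma nb_path_snoc:
  assumes "length l = k + 2"
  shows "nb_path E (l @ [z]) \<longleftrightarrow> nb_path E l \<and> E (l ! Suc k) z \<and> l ! k \<noteq> z"
proof
  assume h: "nb_path E (l @ [z])"
  have h1: "E ((l @ [z]) ! i) ((l @ [z]) ! Suc i)" if "i < k + 2" for i
    using h that assms by (simp add: nb_path_def)
  have h2: "(l @ [z]) ! i \<noteq> (l @ [z]) ! (i + 2)" if "i < k + 1" for i
    using h that assms unfolding nb_path_def by simp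
  have "nb_path E l" unfolding nb_path_def
  proof (intro conjI allI impI)
    fix i assume "Suc i < length l"
    thus "E (l ! i) (l ! Suc i)" using h1[of i] assms by (simp add: nth_append)
  next
    fix i assume "i + 2 < length l"
    thus "l ! i \<noteq> l ! (i + 2)" using h2[of i] assms by (simp add: nth_append)
  qed
  thus "nb_path E l \<and> E (l ! Suc k) z \<and> l ! k \<noteq> z"
    using h1[of "Suc k"] h2[of k] assms by (simp add: nth_append)
next
  assume h: "nb_path E l \<and> E (l ! Suc k) z \<and> l ! k \<noteq> z"
  show "nb_path E (l @ [z])" unfolding nb_path_def
  proof (intro conjI allI impI)
    fix i assume "Suc i < length (l @ [z])"
    hence "i = Suc k \<or> Suc i < length l" using assms by auto
    thus "E ((l @ [z]) ! i) ((l @ [z]) ! Suc i)"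
      using h assms by (auto simp: nth_append nb_path_def)
  next
    fix i assume "i + 2 < length (l @ [z])"
    hence "i = k \<or> i + 2 < length l" using assms by auto
    thus "(l @ [z]) ! i \<noteq> (l @ [z]) ! (i + 2)"
      using h assms by (auto simp: nth_append nb_path_def)
  qed
qed

text \<open>This is the recursion of matrix multiplication: without its last vertex, the walk ends
  in an arc \<open>c\<close> that \<open>b\<close> follows. Since \<open>c\<close> can be read off
  from the walk, distinct \<open>c\<close> give disjoint parts.\<close>

lemma nb_walks_Suc:
  assumes "b \<in> arcs E"
  shows "nb_walks E (Suc k) a b =
    (\<Union>c\<in>{c \<in> arcs E. follows c b}. (\<lambda>l. l @ [snd b]) ` nb_walks E k a c)"
proof (intro equalityI subsetI)
  fix w assume w: "w \<in> nb_walks E (Suc k) a b"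
  define l where "l = butlast w"
  have len: "length w = k + 3" using w by (simp add: nb_walks_def)
  have ne: "w \<noteq> []" using len by auto
  have "(w ! Suc k, w ! Suc (Suc k)) = b" using w by (simp add: nb_walks_def)
  moreover have "w ! Suc (Suc k) = last w" using len ne by (simp add: last_conv_nth)
  ultimately have "last w = snd b" by auto
  hence wl: "w = l @ [snd b]" using append_butlast_last_id[OF ne] by (simp add: l_def)
  have ll: "length l = k + 2" using len by (simp add: l_def)
  let ?c = "(l ! k, l ! Suc k)"
  have nb: "nb_path E l" "l ! k \<noteq> snd b"
    using w unfolding wl nb_walks_def by (auto simp: nb_path_snoc[OF ll])
  have "l ! Suc k = fst b" "(l ! 0, l ! 1) = a"
    using w ll unfolding wl nb_walks_def by (auto simp: nth_append prod_eq_iff)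
  moreover have "?c \<in> arcs E" using nb(1) ll by (auto simp: nb_path_def arcs_def)
  ultimately show "w \<in> (\<Union>c\<in>{c \<in> arcs E. follows c b}. (\<lambda>l. l @ [snd b]) ` nb_walks E k a c)"
    using nb ll by (intro UN_I[of ?c]) (auto simp: follows_def nb_walks_def wl)
next
  fix w assume "w \<in> (\<Union>c\<in>{c \<in> arcs E. follows c b}. (\<lambda>l. l @ [snd b]) ` nb_walks E k a c)"
  then obtain c l where c: "c \<in> arcs E" "follows c b" "l \<in> nb_walks E k a c" "w = l @ [snd b]"
    by auto
  have ll: "length l = k + 2" using c by (simp add: nb_walks_def)
  have lc: "l ! k = fst c" "l ! Suc k = snd c" using c by (auto simp: nb_walks_def)
  have "nb_path E w"
    using c lc assms unfolding c(4) nb_path_snoc[OF ll] by (auto simp: nb_walks_def follows_def arcs_def)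
  thus "w \<in> nb_walks E (Suc k) a b"
    using c lc ll by (auto simp: nb_walks_def nth_append follows_def)
qed

lemma nb_walks_0: "a \<in> arcs E \<Longrightarrow> nb_walks E 0 a b = (if a = b then {[fst a, snd a]} else {})"
  by (auto simp: nb_walks_def nb_path_def arcs_def length_Suc_conv numeral_2_eq_2 nth_Cons')

lemma finite_nb_walks:
  assumes "simple_graph V E"
  shows "finite (nb_walks E k a b)"
proof (rule finite_subset)
  show "nb_walks E k a b \<subseteq> {l. set l \<subseteq> V \<and> length l = k + 2}"
  proof safe
    fix l x assume l: "l \<in> nb_walks E k a b" "x \<in> set l"
    then obtain i where i: "i < k + 2" "x = l ! i" by (auto simp: nb_walks_def in_set_conv_nth)
    have E: "E (l ! j) (l ! Suc j)" if "j < k + 1" for j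
      using l that by (auto simp: nb_walks_def nb_path_def)
    have "E (l ! i) (l ! Suc i) \<or> E (l ! k) (l ! i)"
      using E[of i] E[of k] i by (cases "i = Suc k") auto
    thus "x \<in> V" using assms i unfolding simple_graph_def by blast
  qed (auto simp: nb_walks_def)
  show "finite {l. set l \<subseteq> V \<and> length l = k + 2}"
    using assms by (intro finite_lists_length_eq) (auto simp: simple_graph_def)
qed

definition nb_matrix :: "('a \<times> 'a) list \<Rightarrow> complex mat" where
  "nb_matrix es = lmat es es (\<lambda>a b. if follows a b then 1 else 0)"

lemma nb_matrix_pow:
  assumes G: "simple_graph V E" and es: "distinct es" "set es = arcs E"
  shows "nb_matrix es ^\<^sub>m k = lmat es es (\<lambda>a b. of_nat (card (nb_walks E k a b)))"
proof (induction k)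
  case 0
  have "lmat es es (\<lambda>a b. of_nat (card (nb_walks E 0 a b))) =
        lmat es es (\<lambda>a b. if a = b then 1 else (0::complex))"
    by (rule lmat_cong) (auto simp: nb_walks_0 es)
  thus ?case by (simp add: lmat_one es nb_matrix_def)
next
  case (Suc k)
  have "nb_matrix es ^\<^sub>m Suc k = lmat es es (\<lambda>a b. of_nat (card (nb_walks E k a b))) * nb_matrix es"
    using Suc by simp
  also have "\<dots> = lmat es es (\<lambda>a b. \<Sum>c\<in>set es. of_nat (card (nb_walks E k a c)) * (if follows c b then 1 else 0))"
    unfolding nb_matrix_def by (rule lmat_mult[OF es(1)])
  also have "\<dots> = lmat es es (\<lambda>a b. of_nat (card (nb_walks E (Suc k) a b)))"
  proof (rule lmat_cong)
    fix a b assume b: "b \<in> set es"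
    have "card (nb_walks E (Suc k) a b) =
          (\<Sum>c\<in>{c \<in> arcs E. follows c b}. card ((\<lambda>l. l @ [snd b]) ` nb_walks E k a c))"
      unfolding nb_walks_Suc[OF b[unfolded es(2)]]
    proof (rule card_UN_disjoint)
      show "finite {c \<in> arcs E. follows c b}" using finite_arcs[OF G] by simp
      show "\<forall>c\<in>{c \<in> arcs E. follows c b}. finite ((\<lambda>l. l @ [snd b]) ` nb_walks E k a c)"
        using finite_nb_walks[OF G] by simp
      show "\<forall>c\<in>{c \<in> arcs E. follows c b}. \<forall>c'\<in>{c \<in> arcs E. follows c b}. c \<noteq> c' \<longrightarrow>
         (\<lambda>l. l @ [snd b]) ` nb_walks E k a c \<inter> (\<lambda>l. l @ [snd b]) ` nb_walks E k a c' = {}"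
        by (auto simp: nb_walks_def)
    qed
    also have "\<dots> = (\<Sum>c\<in>{c \<in> arcs E. follows c b}. card (nb_walks E k a c))"
      by (intro sum.cong refl card_image) (auto simp: inj_on_def)
    also have "\<dots> = (\<Sum>c\<in>arcs E. if follows c b then card (nb_walks E k a c) else 0)"
      using finite_arcs[OF G] by (rule sum.inter_filter)
    finally show "(\<Sum>c\<in>set es. of_nat (card (nb_walks E k a c)) * (if follows c b then 1 else 0)) =
        complex_of_nat (card (nb_walks E (Suc k) a b))"
      unfolding es(2) by (auto simp: of_nat_sum intro!: sum.cong)
  qed
  finally show ?case .
qed

text \<open>A walk from an arc back to itself repeats its first two vertices at the end. Dropping
  the repetition leaves the cyclic vertex sequence, and unrolling that sequence by two extra letters
  restores it. Non-backtracking across the repetition is the tailless condition.\<close>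

lemma closed_nb_walks_bij:
  assumes "k \<ge> 1"
  shows "bij_betw (take k) (\<Union>a\<in>arcs E. nb_walks E k a a) (reduced_cycles E k)"
proof (rule bij_betw_byWitness[where f' = "\<lambda>c. map (cyc c) [0..<k + 2]"])
  have w: "length l = k + 2 \<and> nb_path E l \<and> l ! k = l ! 0 \<and> l ! Suc k = l ! 1"
    if "l \<in> (\<Union>a\<in>arcs E. nb_walks E k a a)" for l
    using that by (auto simp: nb_walks_def)
  have c: "l ! i = cyc (take k l) i" if l: "l \<in> (\<Union>a\<in>arcs E. nb_walks E k a a)" and i: "i < k + 2" for l i
  proof -
    \<comment> \<open>For \<open>k = 1\<close> the second vertex is not a letter of
      \<open>take k l\<close> of its own; there \<open>l ! 2 = l ! 1 = l ! 0\<close>.\<close>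
    consider "i < k" | "i = k" | "i = Suc k" "k = 1" | "i = Suc k" "k \<ge> 2" using i assms by linarith
    thus ?thesis using w[OF l] assms by cases (auto simp: cyc_def mod_Suc)
  qed
  show "\<forall>l\<in>\<Union>a\<in>arcs E. nb_walks E k a a. map (cyc (take k l)) [0..<k + 2] = l"
  proof
    fix l assume l: "l \<in> (\<Union>a\<in>arcs E. nb_walks E k a a)"
    show "map (cyc (take k l)) [0..<k + 2] = l"
      using w[OF l] c[OF l] by (intro nth_equalityI) (auto simp del: upt_Suc)
  qed
  show "\<forall>c\<in>reduced_cycles E k. take k (map (cyc c) [0..<k + 2]) = c"
    by (auto simp: reduced_cycles_def cyc_def intro!: nth_equalityI simp del: upt_Suc)
  show "take k ` (\<Union>a\<in>arcs E. nb_walks E k a a) \<subseteq> reduced_cycles E k"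
  proof safe
    fix l a assume "a \<in> arcs E" "l \<in> nb_walks E k a a"
    hence l: "l \<in> (\<Union>a\<in>arcs E. nb_walks E k a a)" by auto
    have "E (cyc (take k l) i) (cyc (take k l) (Suc i)) \<and> cyc (take k l) (i + 2) \<noteq> cyc (take k l) i" for i
    proof -
      define j where "j = i mod k"
      have j: "j < k" using assms by (simp add: j_def)
      have len: "length (take k l) = k" using w[OF l] by simp
      have "cyc (take k l) i = cyc (take k l) j" "cyc (take k l) (Suc i) = cyc (take k l) (Suc j)"
        "cyc (take k l) (i + 2) = cyc (take k l) (j + 2)"
        unfolding cyc_def len j_def by (simp_all add: mod_simps)
      moreover have "E (l ! j) (l ! Suc j)" using w[OF l] j by (simp add: nb_path_def)
      moreover have "l ! j \<noteq> l ! (j + 2)" using w[OF l] j unfolding nb_path_def by simp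
      moreover have "cyc (take k l) (j + 2) = l ! (j + 2)" if "j + 2 < k + 2" using c[OF l that] by simp
      ultimately show ?thesis using c[OF l, of j] c[OF l, of "Suc j"] j by simp
    qed
    thus "take k l \<in> reduced_cycles E k"
      using w[OF l] assms by (auto simp: reduced_cycles_def reduced_cycle_cyc)
  qed
  show "(\<lambda>c. map (cyc c) [0..<k + 2]) ` reduced_cycles E k \<subseteq> (\<Union>a\<in>arcs E. nb_walks E k a a)"
  proof safe
    fix c assume c: "c \<in> reduced_cycles E k"
    hence r: "E (cyc c i) (cyc c (Suc i))" "cyc c (i + 2) \<noteq> cyc c i" and len: "length c = k" for i
      by (auto simp: reduced_cycles_def reduced_cycle_cyc)
    have nb: "nb_path E (map (cyc c) [0..<k + 2])"
      unfolding nb_path_def using r by (auto simp del: upt_Suc) (metis add_2_eq_Suc')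
    have "cyc c k = cyc c 0" "cyc c (Suc k) = cyc c 1"
      using cyc_add_length[of c 0] cyc_add_length[of c 1] len by simp_all
    thus "map (cyc c) [0..<k + 2] \<in> (\<Union>a\<in>arcs E. nb_walks E k a a)"
      using nb r(1)[of 0] by (intro UN_I[of "(cyc c 0, cyc c 1)"]) (auto simp: arcs_def nb_walks_def simp del: upt_Suc)
  qed
qed

lemma mat_trace_nb_matrix_pow:
  assumes G: "simple_graph V E" and es: "distinct es" "set es = arcs E" and k: "k \<ge> 1"
  shows "mat_trace (nb_matrix es ^\<^sub>m k) = of_nat (card (reduced_cycles E k))"
proof -
  have "mat_trace (nb_matrix es ^\<^sub>m k) = of_nat (\<Sum>a\<in>arcs E. card (nb_walks E k a a))"
    unfolding nb_matrix_pow[OF G es] mat_trace_lmat[OF es(1)] es(2) by simp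
  also have "(\<Sum>a\<in>arcs E. card (nb_walks E k a a)) = card (\<Union>a\<in>arcs E. nb_walks E k a a)"
    by (rule card_UN_disjoint[symmetric])
       (use finite_arcs[OF G] finite_nb_walks[OF G] in \<open>auto simp: nb_walks_def\<close>)
  also have "\<dots> = card (reduced_cycles E k)" by (rule bij_betw_same_card[OF closed_nb_walks_bij[OF k]])
  finally show ?thesis .
qed

text \<open>By the trace formula the logarithm of the zeta function is a sum over \<open>ls\<close>
  of logarithmic series in \<open>u * e\<close>, each with value \<open>- Ln (1 - u * e)\<close>.
  Exponentiation gives the reciprocal of the determinant.\<close>

lemma ihara_zeta_mult_det:
  assumes G: "simple_graph V E" and es: "distinct es" "set es = arcs E"
  obtains r where "r > 0" and
    "\<And>u. norm u < r \<Longrightarrow> ihara_zeta E u * det (1\<^sub>m (length es) - u \<cdot>\<^sub>m nb_matrix es) = 1"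
proof -
  have W: "nb_matrix es \<in> carrier_mat (length es) (length es)" by (simp add: nb_matrix_def)
  obtain ls where tr: "\<And>k. mat_trace (nb_matrix es ^\<^sub>m k) = (\<Sum>e\<leftarrow>ls. e ^ k)"
    and dt: "\<And>u. det (1\<^sub>m (length es) - u \<cdot>\<^sub>m nb_matrix es) = (\<Prod>e\<leftarrow>ls. 1 - u * e)"
    using complex_mat_eigenvalue_list[OF W] by blast
  \<comment> \<open>\<open>K\<close> bounds the modulus of every entry of \<open>ls\<close> as well
    as the constant required by the Euler product, so the single radius \<open>1 / K\<close> serves
    both series.\<close>
  define K where "K = (\<Sum>e\<leftarrow>ls. norm e) + (real (card V) + 1)"
  have K: "K > 0" "real (card V) + 1 \<le> K" "\<And>e. e \<in> set ls \<Longrightarrow> norm e \<le> K"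
  proof -
    have nn: "(\<Sum>e\<leftarrow>ls. norm e) \<ge> 0" by (rule sum_list_nonneg) auto
    show "K > 0" "real (card V) + 1 \<le> K" using nn by (auto simp: K_def)
    fix e assume "e \<in> set ls"
    hence "norm e \<le> (\<Sum>e\<leftarrow>ls. norm e)"
      by (intro member_le_sum_list) auto
    thus "norm e \<le> K" by (simp add: K_def)
  qed
  show ?thesis
  proof (rule that)
    show "1 / K > 0" using K by simp
    fix u :: complex assume u: "norm u < 1 / K"
    have uK: "norm u * x < 1" if "x \<le> K" for x
    proof -
      have "norm u * x \<le> norm u * K" using that by (intro mult_left_mono) auto
      thus ?thesis using u K(1) by (simp add: field_simps)
    qed
    have ue: "norm (u * e) < 1" if "e \<in> set ls" for e
      using uK[OF K(3)[OF that]] by (simp add: norm_mult)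
    note z = ihara_zeta_eq_exp[OF G uK[OF K(2)]]
    have summand: "log_zeta_term E u n = (\<Sum>e\<leftarrow>ls. (u * e) ^ Suc n / of_nat (Suc n))" for n
    proof -
      have "log_zeta_term E u n = (\<Sum>e\<leftarrow>ls. e ^ Suc n) * (u ^ Suc n / of_nat (Suc n))"
        unfolding log_zeta_term_def using mat_trace_nb_matrix_pow[OF G es, of "Suc n"] tr[of "Suc n"] by simp
      also have "\<dots> = (\<Sum>e\<leftarrow>ls. (u * e) ^ Suc n / of_nat (Suc n))"
        unfolding sum_list_mult_const[symmetric] power_mult_distrib by (simp add: mult_ac)
      finally show ?thesis .
    qed
    have sums: "(\<lambda>n. \<Sum>e\<leftarrow>es. (u * e) ^ Suc n / of_nat (Suc n)) sums (\<Sum>e\<leftarrow>es. - Ln (1 - u * e))"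
      if "set es \<subseteq> set ls" for es
      using that
    proof (induction es)
      case (Cons e es)
      show ?case unfolding list.map sum_list.Cons
        by (rule sums_add[OF log_series_sums Cons.IH]) (use Cons.prems ue in auto)
    qed simp
    have "suminf (log_zeta_term E u) = (\<Sum>e\<leftarrow>ls. - Ln (1 - u * e))"
      using sums[of ls] unfolding summand[symmetric] by (simp add: sums_iff)
    hence "ihara_zeta E u = exp (\<Sum>e\<leftarrow>ls. - Ln (1 - u * e))" using z(2) by simp
    moreover have "exp (\<Sum>e\<leftarrow>es. - Ln (1 - u * e)) * (\<Prod>e\<leftarrow>es. 1 - u * e) = 1"
      if "set es \<subseteq> set ls" for es
      using that
    proof (induction es)
      case (Cons e es)
      have "1 - u * e \<noteq> 0" using ue[of e] Cons.prems by auto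
      hence "exp (- Ln (1 - u * e)) * (1 - u * e) = 1" by (simp add: exp_minus)
      moreover have "exp (\<Sum>e\<leftarrow>es. - Ln (1 - u * e)) * (\<Prod>e\<leftarrow>es. 1 - u * e) = 1"
        using Cons by simp
      ultimately show ?case unfolding list.map sum_list.Cons prod_list.Cons exp_add
        by (metis mult.assoc mult.left_commute mult_1)
    qed simp
    ultimately show "ihara_zeta E u * det (1\<^sub>m (length es) - u \<cdot>\<^sub>m nb_matrix es) = 1"
      unfolding dt by simp
  qed
qed

section \<open>The Ihara--Bass formula\<close>

lemma sum_ind_left:
  "finite A \<Longrightarrow> (\<Sum>y\<in>A. (if x = y then 1 else 0) * g y) = (if x \<in> A then g x else (0::'b::semiring_1))"
  "finite A \<Longrightarrow> (\<Sum>y\<in>A. (if y = x then 1 else 0) * g y) = (if x \<in> A then g x else (0::'b::semiring_1))"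
  by (simp_all add: if_distrib[of "\<lambda>c. c * _"] cong: if_cong)

lemma sum_ind_right:
  "finite A \<Longrightarrow> (\<Sum>y\<in>A. g y * (if x = y then 1 else 0)) = (if x \<in> A then g x else (0::'b::semiring_1))"
  "finite A \<Longrightarrow> (\<Sum>y\<in>A. g y * (if y = x then 1 else 0)) = (if x \<in> A then g x else (0::'b::semiring_1))"
  by (simp_all add: if_distrib[of "\<lambda>c. _ * c"] cong: if_cong)

lemma sum_of_bool_conj:
  "finite A \<Longrightarrow> (\<Sum>e\<in>A. (if P e then 1 else 0) * (if Q e then 1 else 0)) =
     (of_nat (card {e \<in> A. P e \<and> Q e}) :: 'b :: semiring_1)"
proof -
  assume "finite A"
  have "(\<Sum>e\<in>A. (if P e then 1 else 0) * (if Q e then 1 else (0::'b))) = (\<Sum>e\<in>A. if P e \<and> Q e then 1 else 0)"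
    by (rule sum.cong) auto
  also have "\<dots> = (\<Sum>e\<in>{e \<in> A. P e \<and> Q e}. 1)"
    by (rule sum.inter_filter[OF \<open>finite A\<close>, symmetric])
  finally show ?thesis by simp
qed

text \<open>Entry of the matrix \<open>I - u A + u^2 (D - I)\<close> in Bass's formula.\<close>

definition bass_entry :: "'a set \<Rightarrow> ('a \<Rightarrow> 'a \<Rightarrow> bool) \<Rightarrow> complex \<Rightarrow> 'a \<Rightarrow> 'a \<Rightarrow> complex" where
  "bass_entry V E u x y =
     (if x = y then 1 + u\<^sup>2 * (of_nat (Defs.degree V E x) - 1) else 0) - u * adj E x y"

text \<open>With each oriented edge in the first half of the list and its reverse at the same place
  in the second half, arc reversal exchanges the halves, and the matrix has blocks \<open>I\<close>,
  \<open>u I\<close>, \<open>u I\<close>, \<open>I\<close>.\<close>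

lemma det_swap_block:
  fixes u :: "'a :: idom"
  assumes "distinct (es0 @ map prod.swap es0)"
  shows "det (lmat (es0 @ map prod.swap es0) (es0 @ map prod.swap es0)
      (\<lambda>a b. (if a = b then 1 else 0) + u * (if b = prod.swap a then 1 else 0))) =
    (1 - u\<^sup>2) ^ length es0"
proof -
  let ?n = "length es0"
  have d: "distinct es0" and "set es0 \<inter> prod.swap ` set es0 = {}" using assms by auto
  hence ns: "prod.swap a \<notin> set es0" if "a \<in> set es0" for a using that by auto
  have ne: "a \<noteq> prod.swap b \<and> prod.swap b \<noteq> a" if "a \<in> set es0" "b \<in> set es0" for a b
    using ns[of b] that by metis
  have sm: "lmat es0 es0 (\<lambda>a b. c * (if a = b then 1 else 0)) = c \<cdot>\<^sub>m 1\<^sub>m ?n" for c :: 'a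
    unfolding lmat_one[OF d, symmetric] by (rule eq_matI) auto
  have "lmat (es0 @ map prod.swap es0) (es0 @ map prod.swap es0)
      (\<lambda>a b. (if a = b then 1 else 0) + u * (if b = prod.swap a then 1 else 0)) =
    four_block_mat (1\<^sub>m ?n) (u \<cdot>\<^sub>m 1\<^sub>m ?n) (u \<cdot>\<^sub>m 1\<^sub>m ?n) (1\<^sub>m ?n)"
    (is "lmat _ _ ?F = _")
    unfolding lmat_append
  proof (intro arg_cong4[where f = four_block_mat])
    show "lmat es0 es0 ?F = 1\<^sub>m ?n"
      unfolding lmat_one[OF d, symmetric] by (rule lmat_cong) (use ne in auto)
    have "lmat (map prod.swap es0) (map prod.swap es0) ?F = lmat es0 es0 (\<lambda>a b. ?F (prod.swap a) (prod.swap b))"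
      by (rule lmat_map)
    also have "\<dots> = 1\<^sub>m ?n"
      unfolding lmat_one[OF d, symmetric] by (rule lmat_cong) (use ne in auto)
    finally show "lmat (map prod.swap es0) (map prod.swap es0) ?F = 1\<^sub>m ?n" .
    have "lmat es0 (map prod.swap es0) ?F = lmat es0 es0 (\<lambda>a b. ?F a (prod.swap b))"
      using lmat_map[of "\<lambda>x. x" es0 prod.swap es0 ?F] by simp
    also have "\<dots> = u \<cdot>\<^sub>m 1\<^sub>m ?n"
      unfolding sm[symmetric] by (rule lmat_cong) (use ne in auto)
    finally show "lmat es0 (map prod.swap es0) ?F = u \<cdot>\<^sub>m 1\<^sub>m ?n" .
    have "lmat (map prod.swap es0) es0 ?F = lmat es0 es0 (\<lambda>a b. ?F (prod.swap a) b)"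
      using lmat_map[of prod.swap es0 "\<lambda>x. x" es0 ?F] by simp
    also have "\<dots> = u \<cdot>\<^sub>m 1\<^sub>m ?n"
      unfolding sm[symmetric] by (rule lmat_cong) (use ne in auto)
    finally show "lmat (map prod.swap es0) es0 ?F = u \<cdot>\<^sub>m 1\<^sub>m ?n" .
  qed
  also have "det \<dots> = det (1\<^sub>m ?n * 1\<^sub>m ?n - (u \<cdot>\<^sub>m 1\<^sub>m ?n) * (u \<cdot>\<^sub>m 1\<^sub>m ?n))"
    by (rule det_four_block_mat[of _ ?n]) auto
  also have "1\<^sub>m ?n * 1\<^sub>m ?n - (u \<cdot>\<^sub>m 1\<^sub>m ?n) * (u \<cdot>\<^sub>m 1\<^sub>m ?n) = (1 - u\<^sup>2) \<cdot>\<^sub>m 1\<^sub>m ?n"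
    by (rule eq_matI) (auto simp: power2_eq_square)
  finally show ?thesis by simp
qed

text \<open>Let \<open>S\<close> and \<open>T\<close> be the incidence matrices of start and end
  vertices of arcs, \<open>H\<close> the non-backtracking matrix and \<open>J\<close> arc reversal.
  The relations \<open>S T^t = A\<close>, \<open>S S^t = D\<close> and \<open>T^t S = H + J\<close>
  combine into an identity between products of block triangular matrices. Comparing determinants
  requires no inverse of \<open>1 - u^2\<close>, so the result holds for every
  \<open>u\<close>.\<close>

lemma bass_determinant:
  assumes G: "simple_graph V E" and vs: "distinct vs" "set vs = V"
    and es: "es = es0 @ map prod.swap es0" "distinct es" "set es = arcs E"
  shows "(1 - u\<^sup>2) ^ length vs * det (1\<^sub>m (length es) - u \<cdot>\<^sub>m nb_matrix es) =
    det (lmat vs vs (bass_entry V E u)) * (1 - u\<^sup>2) ^ length es0"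
proof -
  let ?n = "length vs" and ?k = "length es"
  let ?I = "\<lambda>x y. if x = y then 1 else (0::complex)"
  define S where "S = (\<lambda>v (e :: 'a \<times> 'a). if v = fst e then 1 else (0::complex))"
  define T where "T = (\<lambda>v (e :: 'a \<times> 'a). if v = snd e then 1 else (0::complex))"
  define J where "J = (\<lambda>a (b :: 'a \<times> 'a). if b = prod.swap a then 1 else (0::complex))"
  define H where "H = (\<lambda>a (b :: 'a \<times> 'a). if follows a b then 1 else (0::complex))"
  have fin: "finite V" "finite (arcs E)" using G finite_arcs by (auto simp: simple_graph_def)
  have arcV: "fst e \<in> V" "snd e \<in> V" "prod.swap e \<in> arcs E" "fst e \<noteq> snd e" if "e \<in> arcs E" for e
    using that G by (auto simp: arcs_def simple_graph_def)
  have ST: "(\<Sum>e\<in>arcs E. S x e * T y e) = adj E x y" for x y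
  proof -
    have "{e \<in> arcs E. x = fst e \<and> y = snd e} = (if E x y then {(x, y)} else {})"
      by (auto simp: arcs_def)
    thus ?thesis unfolding S_def T_def sum_of_bool_conj[OF fin(2)] by (simp add: adj_def)
  qed
  have SS: "(\<Sum>e\<in>arcs E. S x e * S y e) = (if x = y then of_nat (Defs.degree V E x) else 0)" for x y
  proof -
    have "{e \<in> arcs E. x = fst e} = Pair x ` {y \<in> V. E x y}" for x
      using G by (auto simp: arcs_def simple_graph_def)
    hence "card {e \<in> arcs E. x = fst e} = Defs.degree V E x" for x
      by (simp add: card_image inj_on_def Defs.degree_def)
    moreover have "{e \<in> arcs E. x = fst e \<and> y = fst e} = (if x = y then {e \<in> arcs E. x = fst e} else {})"
      by auto
    ultimately show ?thesis unfolding S_def sum_of_bool_conj[OF fin(2)] by simp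
  qed
  \<comment> \<open>An arc that starts where \<open>a\<close> ends either continues without
    backtracking or is the reverse of \<open>a\<close>.\<close>
  have TS: "(\<Sum>v\<in>V. T v a * S v b) = H a b + J a b" if "a \<in> arcs E" "b \<in> arcs E" for a b
  proof -
    have "(\<Sum>v\<in>V. T v a * S v b) = S (snd a) b"
      unfolding T_def using fin arcV(2)[OF that(1)] by (simp add: sum_ind_left)
    also have "\<dots> = H a b + J a b"
      using arcV(4)[OF that(1)] by (cases a; cases b) (auto simp: S_def H_def J_def follows_def)
    finally show ?thesis .
  qed
  have Jsum: "(\<Sum>b\<in>arcs E. J a b * h b) = h (prod.swap a)" if "a \<in> arcs E" for a and h :: "_ \<Rightarrow> complex"
    unfolding J_def using fin arcV(3)[OF that] by (simp add: sum_ind_left)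
  have JT: "T v (prod.swap a) = S v a" "S v (prod.swap a) = T v a" for v a
    by (auto simp: T_def S_def)

  let ?L = "four_block_mat (lmat vs vs ?I) (lmat vs es (\<lambda>_ _. 0)) (lmat es vs (\<lambda>e v. T v e)) (lmat es es ?I)"
  let ?X = "four_block_mat (lmat vs vs (\<lambda>x y. (1 - u\<^sup>2) * ?I x y)) (lmat vs es (\<lambda>v e. u * S v e))
     (lmat es vs (\<lambda>_ _. 0)) (lmat es es (\<lambda>a b. ?I a b - u * H a b))"
  let ?Y = "four_block_mat (lmat vs vs (bass_entry V E u)) (lmat vs es (\<lambda>v e. u * S v e))
     (lmat es vs (\<lambda>_ _. 0)) (lmat es es (\<lambda>a b. ?I a b + u * J a b))"
  \<comment> \<open>The lower left block is chosen because \<open>J\<close> exchanges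
    \<open>S^t\<close> and \<open>T^t\<close>, so that
    \<open>(I + u J) (T^t - u S^t) = (1 - u^2) T^t\<close>.\<close>
  let ?R = "four_block_mat (lmat vs vs ?I) (lmat vs es (\<lambda>_ _. 0))
     (lmat es vs (\<lambda>e v. T v e - u * S v e)) (lmat es es ?I)"
  have c: "?L \<in> carrier_mat (?n + ?k) (?n + ?k)" "?X \<in> carrier_mat (?n + ?k) (?n + ?k)"
    "?Y \<in> carrier_mat (?n + ?k) (?n + ?k)" "?R \<in> carrier_mat (?n + ?k) (?n + ?k)"
    by (rule four_block_carrier_mat; simp)+
  have "?L * ?X = ?Y * ?R"
    unfolding mult_four_block_lmat[OF vs(1) es(2)] vs(2) es(3)
  proof (intro arg_cong4[where f = four_block_mat] lmat_cong; unfold vs(2) es(3))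
    fix x y assume xy: "x \<in> V" "y \<in> V"
    have e1: "(\<Sum>e\<in>arcs E. u * S x e * (T y e - u * S y e)) =
       u * (\<Sum>e\<in>arcs E. S x e * T y e) - u\<^sup>2 * (\<Sum>e\<in>arcs E. S x e * S y e)"
      by (simp add: sum_distrib_left sum_subtractf[symmetric] algebra_simps power2_eq_square)
    have e2: "(\<Sum>z\<in>V. ?I x z * ((1 - u\<^sup>2) * ?I z y)) = (1 - u\<^sup>2) * ?I x y"
      using xy fin by (subst sum_ind_left(1)) simp_all
    have e3: "(\<Sum>z\<in>V. bass_entry V E u x z * ?I z y) = bass_entry V E u x y"
      using xy fin by (subst sum_ind_right(2)) simp_all
    show "(\<Sum>z\<in>V. ?I x z * ((1 - u\<^sup>2) * ?I z y)) + (\<Sum>e\<in>arcs E. 0 * 0) =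
      (\<Sum>z\<in>V. bass_entry V E u x z * ?I z y) + (\<Sum>e\<in>arcs E. u * S x e * (T y e - u * S y e))"
      unfolding e1 e2 e3 ST SS by (simp add: bass_entry_def algebra_simps)
  next
    fix x e assume xy: "x \<in> V" "e \<in> arcs E"
    show "(\<Sum>z\<in>V. ?I x z * (u * S z e)) + (\<Sum>f\<in>arcs E. 0 * (?I f e - u * H f e)) =
      (\<Sum>z\<in>V. bass_entry V E u x z * 0) + (\<Sum>f\<in>arcs E. u * S x f * ?I f e)"
      using xy fin by (simp add: sum_ind_left sum_ind_right)
  next
    fix e y assume xy: "e \<in> arcs E" "y \<in> V"
    have "(\<Sum>f\<in>arcs E. (?I e f + u * J e f) * (T y f - u * S y f)) =
       (\<Sum>f\<in>arcs E. ?I e f * (T y f - u * S y f)) + u * (\<Sum>f\<in>arcs E. J e f * (T y f - u * S y f))"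
      by (simp add: sum_distrib_left sum.distrib[symmetric] algebra_simps)
    also have "\<dots> = T y e - u * S y e + u * (S y e - u * T y e)"
      unfolding Jsum[OF xy(1)] JT using xy fin by (simp add: sum_ind_left)
    also have "\<dots> = T y e * (1 - u\<^sup>2)" by (simp add: algebra_simps power2_eq_square)
    also have "\<dots> = (\<Sum>z\<in>V. (T z e * (1 - u\<^sup>2)) * ?I z y)"
      using xy fin by (subst sum_ind_right(2)) simp_all
    finally show "(\<Sum>z\<in>V. T z e * ((1 - u\<^sup>2) * ?I z y)) + (\<Sum>f\<in>arcs E. ?I e f * 0) =
      (\<Sum>z\<in>V. 0 * ?I z y) + (\<Sum>f\<in>arcs E. (?I e f + u * J e f) * (T y f - u * S y f))"
      by (simp add: mult.assoc)
  next
    fix a b assume xy: "a \<in> arcs E" "b \<in> arcs E"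
    have "(\<Sum>v\<in>V. T v a * (u * S v b)) = u * (H a b + J a b)"
      unfolding TS[OF xy, symmetric] sum_distrib_left by (simp add: mult_ac)
    moreover have "(\<Sum>f\<in>arcs E. ?I a f * (?I f b - u * H f b)) = ?I a b - u * H a b"
      using xy fin by (subst sum_ind_left(1)) simp_all
    moreover have "(\<Sum>f\<in>arcs E. (?I a f + u * J a f) * ?I f b) = ?I a b + u * J a b"
      using xy fin by (subst sum_ind_right(2)) simp_all
    ultimately show "(\<Sum>z\<in>V. T z a * (u * S z b)) + (\<Sum>f\<in>arcs E. ?I a f * (?I f b - u * H f b)) =
      (\<Sum>z\<in>V. 0 * 0) + (\<Sum>f\<in>arcs E. (?I a f + u * J a f) * ?I f b)"
      by (simp only:) (simp add: algebra_simps)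
  qed
  hence "det ?L * det ?X = det ?Y * det ?R"
    using det_mult[OF c(1,2)] det_mult[OF c(3,4)] by simp
  moreover have "det ?L = 1" "det ?R = 1"
    by (subst det_four_block_mat_upper_right_zero[OF lmat_carrier lmat_zero lmat_carrier lmat_carrier];
        simp add: lmat_one vs es(2))+
  moreover have "det ?X = (1 - u\<^sup>2) ^ ?n * det (1\<^sub>m ?k - u \<cdot>\<^sub>m nb_matrix es)"
  proof -
    have "lmat vs vs (\<lambda>x y. (1 - u\<^sup>2) * ?I x y) = (1 - u\<^sup>2) \<cdot>\<^sub>m 1\<^sub>m ?n"
      unfolding lmat_one[OF vs(1), symmetric] by (rule eq_matI) auto
    moreover have "lmat es es (\<lambda>a b. ?I a b - u * H a b) = 1\<^sub>m ?k - u \<cdot>\<^sub>m nb_matrix es"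
      unfolding lmat_one[OF es(2), symmetric] nb_matrix_def H_def by (rule eq_matI) auto
    ultimately show ?thesis
      by (subst det_four_block_mat_lower_left_zero[OF lmat_carrier lmat_carrier lmat_zero lmat_carrier]) simp
  qed
  moreover have "det ?Y = det (lmat vs vs (bass_entry V E u)) * (1 - u\<^sup>2) ^ length es0"
    by (subst det_four_block_mat_lower_left_zero[OF lmat_carrier lmat_carrier lmat_zero lmat_carrier])
       (use det_swap_block[of es0 u] es in \<open>simp add: J_def\<close>)
  ultimately show ?thesis by simp
qed

lemma card_arcs:
  assumes "simple_graph V E"
  shows "card (arcs E) = (\<Sum>x\<in>V. Defs.degree V E x)"
proof -
  have "arcs E = (SIGMA x:V. {y \<in> V. E x y})" using assms by (auto simp: arcs_def simple_graph_def)
  thus ?thesis using assms by (simp add: Defs.degree_def simple_graph_def)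
qed

text \<open>The vertex type carries no order, so an injection into the naturals decides which arc of
  an edge belongs to the first half.\<close>

lemma orientation_exists:
  assumes G: "simple_graph V E"
  obtains es0 where "distinct (es0 @ map prod.swap es0)" "set (es0 @ map prod.swap es0) = arcs E"
proof -
  obtain f :: "'a \<Rightarrow> nat" where f: "inj_on f V"
    using G finite_imp_inj_to_nat_seg[of V] by (auto simp: simple_graph_def)
  define P where "P = {(x, y). E x y \<and> f x < f y}"
  have "finite P" using finite_arcs[OF G] by (rule rev_finite_subset) (auto simp: P_def arcs_def)
  then obtain es0 where es0: "set es0 = P" "distinct es0" using finite_distinct_list by blast
  have "arcs E = P \<union> prod.swap ` P"
  proof (intro equalityI subsetI)
    fix e assume "e \<in> arcs E"
    then obtain x y where e: "e = (x, y)" "E x y" by (auto simp: arcs_def)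
    hence "x \<in> V" "y \<in> V" "x \<noteq> y" "E y x" using G by (auto simp: simple_graph_def)
    hence "f x < f y \<or> f y < f x" using f by (metis inj_onD linorder_neqE_nat)
    thus "e \<in> P \<union> prod.swap ` P" using e \<open>E y x\<close> by (force simp: P_def)
  qed (use G in \<open>auto simp: P_def arcs_def simple_graph_def\<close>)
  moreover have "P \<inter> prod.swap ` P = {}" by (auto simp: P_def)
  ultimately show ?thesis
    using es0 by (intro that[of es0]) (auto simp: distinct_map)
qed

text \<open>The powers of \<open>1 - u^2\<close> stay on separate sides because edges minus vertices
  may be negative. Here \<open>m\<close>, half the degree sum, is the number of edges.\<close>

theorem ihara_bass:
  assumes G: "simple_graph V E" and m: "2 * m = (\<Sum>x\<in>V. Defs.degree V E x)"
  obtains r where "r > 0" and "\<And>u. norm u < r \<Longrightarrow>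
      ihara_zeta E u * (set_det V (bass_entry V E u) * (1 - u\<^sup>2) ^ m) = (1 - u\<^sup>2) ^ card V"
proof -
  obtain es0 where es: "distinct (es0 @ map prod.swap es0)" "set (es0 @ map prod.swap es0) = arcs E"
    using orientation_exists[OF G] by blast
  obtain vs where vs: "distinct vs" "set vs = V"
    using finite_distinct_list[OF conjunct1[OF G[unfolded simple_graph_def]]] by metis
  have "card (arcs E) = 2 * length es0"
    using distinct_card[OF es(1)] unfolding es(2) by simp
  hence "2 * m = 2 * length es0" unfolding card_arcs[OF G] m .
  hence m0: "m = length es0" by linarith
  have n: "length vs = card V" using distinct_card[OF vs(1)] vs(2) by simp
  obtain r where r: "r > 0" "\<And>u. norm u < r \<Longrightarrow> ihara_zeta E u *
      det (1\<^sub>m (length (es0 @ map prod.swap es0)) - u \<cdot>\<^sub>m nb_matrix (es0 @ map prod.swap es0)) = 1"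
    using ihara_zeta_mult_det[OF G es] by blast
  show ?thesis
  proof (rule that[OF r(1)])
    fix u :: complex assume u: "norm u < r"
    have "set_det V (bass_entry V E u) * (1 - u\<^sup>2) ^ m = (1 - u\<^sup>2) ^ card V *
        det (1\<^sub>m (length (es0 @ map prod.swap es0)) - u \<cdot>\<^sub>m nb_matrix (es0 @ map prod.swap es0))"
      using bass_determinant[OF G vs refl es, of u] det_lmat[OF vs(1), of "bass_entry V E u"]
      unfolding m0 n vs(2) by simp
    thus "ihara_zeta E u * (set_det V (bass_entry V E u) * (1 - u\<^sup>2) ^ m) = (1 - u\<^sup>2) ^ card V"
      by (simp only: mult.left_commute[of "ihara_zeta E u"] r(2)[OF u] mult_1_right)
  qed
qed

section \<open>Determinants of joins of semi-regular bipartite graphs\<close>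

text \<open>The matrix determinant lemma, with \<open>h\<close> replacing the inverse matrix applied
  to the all-ones vector. The matrix bordered by a column \<open>c\<close> and a row of ones is
  reduced in two ways: subtracting the last column from all others gives \<open>f - c\<close>, and
  subtracting \<open>c * h\<close> times the other columns from the last one gives \<open>f\<close>
  and the scalar factor.\<close>

lemma det_rank_one_update:
  fixes f :: "'a \<Rightarrow> 'a \<Rightarrow> 'c :: idom"
  assumes ws: "distinct ws" and h: "\<And>x. x \<in> set ws \<Longrightarrow> (\<Sum>y\<in>set ws. f x y * h y) = 1"
  shows "det (lmat ws ws (\<lambda>x y. f x y - c)) = det (lmat ws ws f) * (1 - c * (\<Sum>y\<in>set ws. h y))"
proof -
  let ?n = "length ws" and ?I = "\<lambda>x y. if x = y then 1 else (0::'c)"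
  let ?u = "[()]"
  let ?M = "four_block_mat (lmat ws ws f) (lmat ws ?u (\<lambda>_ _. c)) (lmat ?u ws (\<lambda>_ _. 1)) (lmat ?u ?u (\<lambda>_ _. 1))"
  let ?A = "four_block_mat (lmat ws ws ?I) (lmat ws ?u (\<lambda>_ _. 0)) (lmat ?u ws (\<lambda>_ _. -1)) (lmat ?u ?u (\<lambda>_ _. 1))"
  let ?B = "four_block_mat (lmat ws ws ?I) (lmat ws ?u (\<lambda>x _. - (c * h x))) (lmat ?u ws (\<lambda>_ _. 0)) (lmat ?u ?u (\<lambda>_ _. 1))"
  have cr: "?M \<in> carrier_mat (?n + length ?u) (?n + length ?u)"
    "?A \<in> carrier_mat (?n + length ?u) (?n + length ?u)"
    "?B \<in> carrier_mat (?n + length ?u) (?n + length ?u)"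
    by (rule four_block_carrier_mat; rule lmat_carrier)+
  have u: "distinct ?u" by simp
  have one: "det (lmat ?u ?u g) = g () ()" for g :: "unit \<Rightarrow> unit \<Rightarrow> 'c"
    by (subst det_single) auto
  have "?M * ?A = four_block_mat (lmat ws ws (\<lambda>x y. f x y - c)) (lmat ws ?u (\<lambda>_ _. c))
      (lmat ?u ws (\<lambda>_ _. 0)) (lmat ?u ?u (\<lambda>_ _. 1))"
    unfolding mult_four_block_lmat[OF ws u]
    by (intro arg_cong4[where f = four_block_mat] lmat_cong)
       (simp_all add: sum_ind_right sum_ind_right(2)[where g = "\<lambda>_. 1", simplified])
  moreover have "det ?A = 1"
    by (subst det_four_block_mat_upper_right_zero[OF lmat_carrier lmat_zero lmat_carrier lmat_carrier])
       (simp add: lmat_one ws one)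
  ultimately have 1: "det ?M = det (lmat ws ws (\<lambda>x y. f x y - c))"
    using det_mult[OF cr(1,2)]
      det_four_block_mat_lower_left_zero[OF lmat_carrier[of ws ws "\<lambda>x y. f x y - c"]
        lmat_carrier[of ws ?u "\<lambda>_ _. c"] lmat_zero lmat_carrier[of ?u ?u "\<lambda>_ _. 1"]]
    by (simp add: one)
  have e1: "(\<Sum>y\<in>set ws. f x y * - (c * h y)) = - c * (\<Sum>y\<in>set ws. f x y * h y)" for x
    by (simp add: sum_distrib_left mult_ac sum_negf)
  have "?M * ?B = four_block_mat (lmat ws ws f) (lmat ws ?u (\<lambda>_ _. 0))
      (lmat ?u ws (\<lambda>_ _. 1)) (lmat ?u ?u (\<lambda>_ _. 1 - c * (\<Sum>y\<in>set ws. h y)))"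
    unfolding mult_four_block_lmat[OF ws u]
    by (intro arg_cong4[where f = four_block_mat] lmat_cong)
       (simp_all add: sum_ind_right sum_ind_right(2)[where g = "\<lambda>_. 1", simplified] e1 h
          sum_negf sum_distrib_left del: mult_minus_right)
  moreover have "det ?B = 1"
    by (subst det_four_block_mat_lower_left_zero[OF lmat_carrier lmat_carrier lmat_zero lmat_carrier])
       (simp add: lmat_one ws one)
  ultimately have "det ?M = det (lmat ws ws f) * (1 - c * (\<Sum>y\<in>set ws. h y))"
    using det_mult[OF cr(1,3)]
      det_four_block_mat_upper_right_zero[OF lmat_carrier[of ws ws f] lmat_zero
        lmat_carrier[of ?u ws "\<lambda>_ _. 1"] lmat_carrier[of ?u ?u "\<lambda>_ _. 1 - c * (\<Sum>y\<in>set ws. h y)"]]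
    by (simp add: one)
  thus ?thesis using 1 by simp
qed

text \<open>Adding the columns of \<open>V\<close>, weighted by \<open>h\<close>, to every column of
  \<open>W\<close> clears the upper right block and lowers all entries of \<open>g\<close> by the
  constant \<open>sum h V\<close>, a rank one update.\<close>

lemma set_det_join:
  fixes F :: "'a + 'b \<Rightarrow> 'a + 'b \<Rightarrow> 'c :: idom"
  assumes fin: "finite V" "finite W"
    and F: "\<And>x y. x \<in> V \<Longrightarrow> y \<in> V \<Longrightarrow> F (Inl x) (Inl y) = f x y"
      "\<And>x y. x \<in> W \<Longrightarrow> y \<in> W \<Longrightarrow> F (Inr x) (Inr y) = g x y"
      "\<And>x y. x \<in> V \<Longrightarrow> y \<in> W \<Longrightarrow> F (Inl x) (Inr y) = -1"
      "\<And>x y. x \<in> V \<Longrightarrow> y \<in> W \<Longrightarrow> F (Inr y) (Inl x) = -1"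
    and h: "\<And>x. x \<in> V \<Longrightarrow> (\<Sum>y\<in>V. f x y * h y) = 1"
    and k: "\<And>x. x \<in> W \<Longrightarrow> (\<Sum>y\<in>W. g x y * k y) = 1"
  shows "set_det (join_V V W) F = set_det V f * set_det W g * (1 - (\<Sum>x\<in>V. h x) * (\<Sum>y\<in>W. k y))"
proof -
  obtain vs where vs: "distinct vs" "set vs = V" using finite_distinct_list[OF fin(1)] by metis
  obtain ws where ws: "distinct ws" "set ws = W" using finite_distinct_list[OF fin(2)] by metis
  let ?I = "\<lambda>x y. if x = y then 1 else (0::'c)"
  let ?l = "map Inl vs @ map Inr ws :: ('a + 'b) list"
  have l: "distinct ?l" "set ?l = join_V V W" using vs ws by (auto simp: distinct_map join_V_def)
  let ?M = "four_block_mat (lmat vs vs f) (lmat vs ws (\<lambda>_ _. -1)) (lmat ws vs (\<lambda>_ _. -1)) (lmat ws ws g)"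
  let ?B = "four_block_mat (lmat vs vs ?I) (lmat vs ws (\<lambda>x _. h x)) (lmat ws vs (\<lambda>_ _. 0)) (lmat ws ws ?I)"
  have cr: "?M \<in> carrier_mat (length vs + length ws) (length vs + length ws)"
    "?B \<in> carrier_mat (length vs + length ws) (length vs + length ws)"
    by (rule four_block_carrier_mat; rule lmat_carrier)+
  have "lmat ?l ?l F = ?M"
    unfolding lmat_append lmat_map
    by (intro arg_cong4[where f = four_block_mat] lmat_cong) (simp_all add: F vs ws)
  hence M: "set_det (join_V V W) F = det ?M" using det_lmat[OF l(1), of F] l(2) by simp
  have "?M * ?B = four_block_mat (lmat vs vs f) (lmat vs ws (\<lambda>_ _. 0)) (lmat ws vs (\<lambda>_ _. -1))
     (lmat ws ws (\<lambda>x y. g x y - (\<Sum>x\<in>V. h x)))"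
    unfolding mult_four_block_lmat[OF vs(1) ws(1)] vs(2) ws(2)
    by (intro arg_cong4[where f = four_block_mat] lmat_cong)
       (simp_all add: vs(2) ws(2) fin h sum_negf sum_ind_right sum_ind_right(2)[where g = "\<lambda>_. 1", simplified])
  moreover have "det ?B = 1"
    by (subst det_four_block_mat_lower_left_zero[OF lmat_carrier lmat_carrier lmat_zero lmat_carrier])
       (simp add: lmat_one vs ws)
  ultimately have "det ?M = det (lmat vs vs f) * det (lmat ws ws (\<lambda>x y. g x y - (\<Sum>x\<in>V. h x)))"
    using det_mult[OF cr]
      det_four_block_mat_upper_right_zero[OF lmat_carrier[of vs vs f] lmat_zero
        lmat_carrier[of ws vs "\<lambda>_ _. -1"] lmat_carrier[of ws ws "\<lambda>x y. g x y - (\<Sum>x\<in>V. h x)"]]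
    by simp
  also have "det (lmat ws ws (\<lambda>x y. g x y - (\<Sum>x\<in>V. h x))) =
      det (lmat ws ws g) * (1 - (\<Sum>x\<in>V. h x) * (\<Sum>y\<in>W. k y))"
    using det_rank_one_update[OF ws(1), of g k "\<Sum>x\<in>V. h x"] k ws(2) by simp
  finally show ?thesis unfolding M det_lmat[OF vs(1)] det_lmat[OF ws(1)] vs(2) ws(2) by simp
qed

section \<open>Semi-regular bipartite graphs with weighted cells\<close>

lemma semi_regular_adj_sums:
  assumes "semi_regular_bipartite V E V1 V2 q1 q2"
  shows "x \<in> V1 \<Longrightarrow> (\<Sum>y\<in>V2. adj E x y) = of_nat q1"
    and "x \<in> V2 \<Longrightarrow> (\<Sum>y\<in>V1. adj E x y) = of_nat q2"
    and "x \<in> V1 \<Longrightarrow> y \<in> V1 \<Longrightarrow> adj E x y = 0"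
    and "x \<in> V2 \<Longrightarrow> y \<in> V2 \<Longrightarrow> adj E x y = 0"
    and "finite V1" "finite V2" "V = V1 \<union> V2" "V1 \<inter> V2 = {}" "adj E x y = adj E y x"
proof -
  have G: "simple_graph V E" and V: "V1 \<union> V2 = V" "V1 \<inter> V2 = {}"
    and bip: "\<And>x y. E x y \<Longrightarrow> (x \<in> V1 \<and> y \<in> V2) \<or> (x \<in> V2 \<and> y \<in> V1)"
    and deg: "\<And>x. x \<in> V1 \<Longrightarrow> Defs.degree V E x = q1" "\<And>x. x \<in> V2 \<Longrightarrow> Defs.degree V E x = q2"
    using assms unfolding semi_regular_bipartite_def by auto
  have "finite V" using G unfolding simple_graph_def by blast
  thus fin: "finite V1" "finite V2" using V by (metis finite_Un)+
  show "V = V1 \<union> V2" "V1 \<inter> V2 = {}" using V by auto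
  show "adj E x y = adj E y x" using G unfolding simple_graph_def adj_def by metis
  have s: "(\<Sum>y\<in>A. adj E x y) = of_nat (card {y \<in> A. E x y})" if "finite A" for A x
    using that by (simp add: adj_def sum.inter_filter[symmetric])
  show "(\<Sum>y\<in>V2. adj E x y) = of_nat q1" if "x \<in> V1"
  proof -
    have "{y \<in> V2. E x y} = {y \<in> V. E x y}" using bip V that by blast
    thus ?thesis using s[OF fin(2)] deg(1)[OF that] by (simp add: Defs.degree_def)
  qed
  show "(\<Sum>y\<in>V1. adj E x y) = of_nat q2" if "x \<in> V2"
  proof -
    have "{y \<in> V1. E x y} = {y \<in> V. E x y}" using bip V that by blast
    thus ?thesis using s[OF fin(1)] deg(2)[OF that] by (simp add: Defs.degree_def)
  qed
  show "adj E x y = 0" if "x \<in> V1" "y \<in> V1" using bip V that unfolding adj_def by auto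
  show "adj E x y = 0" if "x \<in> V2" "y \<in> V2" using bip V that unfolding adj_def by auto
qed

text \<open>The diagonal is left free so that one determinant covers both the characteristic matrix
  and, up to the scalar \<open>u\<close>, the Bass matrix.\<close>

definition cell_entry :: "('a \<Rightarrow> 'a \<Rightarrow> bool) \<Rightarrow> ('a \<Rightarrow> complex) \<Rightarrow> 'a \<Rightarrow> 'a \<Rightarrow> complex" where
  "cell_entry E a x y = (if x = y then a x else 0) - adj E x y"

definition two_valued :: "'a set \<Rightarrow> complex \<Rightarrow> complex \<Rightarrow> 'a \<Rightarrow> complex" where
  "two_valued A a b x = (if x \<in> A then a else b)"

lemma semi_regular_counts:
  assumes G: "semi_regular_bipartite V E V1 V2 q1 q2"
  shows "card V1 * q1 = card V2 * q2" "card V1 \<ge> 1" "card V2 \<ge> 1" "q1 \<ge> 1" "q2 \<ge> 1" "q1 \<le> card V2"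
    "card V = card V1 + card V2"
proof -
  note s = semi_regular_adj_sums[OF G]
  have q: "q1 \<ge> 1" "q2 \<ge> 1" "V \<noteq> {}" using G by (auto simp: semi_regular_bipartite_def)
  show "q1 \<ge> 1" "q2 \<ge> 1" by fact+
  have "of_nat (card V1 * q1) = (\<Sum>x\<in>V1. \<Sum>y\<in>V2. adj E x y)" by (simp add: s)
  also have "\<dots> = (\<Sum>y\<in>V2. \<Sum>x\<in>V1. adj E x y)" by (rule sum.swap)
  also have "\<dots> = (\<Sum>y\<in>V2. \<Sum>x\<in>V1. adj E y x)" using s(9) by (intro sum.cong refl) simp
  also have "\<dots> = of_nat (card V2 * q2)" by (simp add: s)
  finally show eq: "card V1 * q1 = card V2 * q2" by (simp only: of_nat_eq_iff)
  show "card V = card V1 + card V2" using s(5-8) by (simp add: card_Un_disjoint)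
  hence "card V1 + card V2 > 0" using q(3) s(5-7) by (metis card_gt_0_iff finite_UnI)
  thus c: "card V1 \<ge> 1" "card V2 \<ge> 1" using eq q by (auto simp: Suc_le_eq intro: gr0I)
  then obtain x where x: "x \<in> V1" by (metis card.empty ex_in_conv not_one_le_zero)
  have "of_nat q1 = (\<Sum>y\<in>V2. adj E x y)" using s(1)[OF x] by simp
  also have "\<dots> = of_nat (card {y \<in> V2. E x y})"
    using s(6) by (simp add: adj_def sum.inter_filter[symmetric])
  finally have "q1 = card {y \<in> V2. E x y}" by (simp only: of_nat_eq_iff)
  also have "\<dots> \<le> card V2" using s(6) by (intro card_mono) auto
  finally show "q1 \<le> card V2" .
qed

text \<open>Eliminating \<open>V2\<close> leaves \<open>a * b - C\<close>, where \<open>C\<close>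
  counts walks of length two between vertices of \<open>V1\<close>; this is why only the product
  \<open>a * b\<close> matters, apart from a power of \<open>b\<close>. All row sums of
  \<open>C\<close> are \<open>q1 * q2\<close>, so this number is an eigenvalue and its factor splits
  off. It will cancel a denominator in the formula for the join.\<close>

lemma set_det_semi_regular:
  assumes G: "semi_regular_bipartite V E V1 V2 q1 q2" and n12: "card V1 \<le> card V2"
  obtains S :: "complex poly" where "lead_coeff S = 1" "Polynomial.degree S = card V1 - 1"
    and "\<And>a b. b \<noteq> 0 \<Longrightarrow> set_det V (cell_entry E (two_valued V1 a b)) =
       b ^ (card V2 - card V1) * poly S (a * b) * (a * b - of_nat (q1 * q2))"
proof -
  note s = semi_regular_adj_sums[OF G]
  obtain xs where xs: "distinct xs" "set xs = V1" using finite_distinct_list[OF s(5)] by metis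
  obtain ys where ys: "distinct ys" "set ys = V2" using finite_distinct_list[OF s(6)] by metis
  have len: "length xs = card V1" "length ys = card V2" using distinct_card xs ys by metis+
  let ?I = "\<lambda>x y. if x = y then 1 else (0::complex)"
  define c where "c x y = (\<Sum>z\<in>V2. adj E x z * adj E z y)" for x y
  define C where "C = lmat xs xs c"
  have C: "C \<in> carrier_mat (card V1) (card V1)" using lmat_carrier[of xs xs c] by (simp add: C_def len)
  have ev: "eigenvalue C (of_nat (q1 * q2))"
  proof -
    let ?v = "vec (card V1) (\<lambda>_. 1 :: complex)"
    have "C *\<^sub>v ?v = of_nat (q1 * q2) \<cdot>\<^sub>v ?v"
    proof (rule eq_vecI)
      fix i assume "i < dim_vec (of_nat (q1 * q2) \<cdot>\<^sub>v ?v)"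
      hence i: "i < length xs" using len by simp
      hence x: "xs ! i \<in> V1" using xs by auto
      have "vec_index (C *\<^sub>v ?v) i = (\<Sum>y\<in>V1. c (xs ! i) y)"
        using i len by (simp add: C_def scalar_prod_def xs(2)[symmetric] sum_set_conv_nth[OF xs(1)])
      also have "\<dots> = (\<Sum>z\<in>V2. adj E (xs ! i) z * (\<Sum>y\<in>V1. adj E z y))"
        unfolding c_def sum_distrib_left by (rule sum.swap)
      also have "\<dots> = of_nat q1 * of_nat q2"
        by (simp add: s(2) sum_distrib_right[symmetric] s(1)[OF x])
      finally show "vec_index (C *\<^sub>v ?v) i = vec_index (of_nat (q1 * q2) \<cdot>\<^sub>v ?v) i" using i len by simp
    qed (use C in auto)
    moreover have "?v \<noteq> 0\<^sub>v (card V1)"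
      using semi_regular_counts(2)[OF G] by (metis Suc_le_eq One_nat_def index_vec index_zero_vec(1) zero_neq_one)
    moreover have "dim_row C = card V1" using C by simp
    ultimately show ?thesis unfolding eigenvalue_def eigenvector_def
      by (intro exI[of _ ?v]) (simp del: of_nat_mult)
  qed
  hence "[:- of_nat (q1 * q2), 1:] dvd char_poly C"
    unfolding eigenvalue_root_char_poly[OF C] poly_eq_0_iff_dvd .
  then obtain S where S: "char_poly C = [:- of_nat (q1 * q2), 1:] * S" by (elim dvdE)
  note dm = degree_monic_char_poly[OF C]
  have S0: "S \<noteq> 0" using S dm semi_regular_counts(2)[OF G] by auto
  have lc: "lead_coeff S = 1" using dm unfolding S lead_coeff_mult by (metis S lead_coeff_mult lead_coeff_pCons(1) mult_1 one_neq_zero one_pCons pCons_eq_0_iff lead_coeff_1)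
  have dg: "Polynomial.degree S = card V1 - 1"
  proof -
    have "Polynomial.degree ([:- of_nat (q1 * q2), 1:] * S) = 1 + Polynomial.degree S"
      by (subst degree_mult_eq) (use S0 in simp_all)
    thus ?thesis using conjunct1[OF dm] unfolding S by linarith
  qed
  show ?thesis
  proof (rule that[OF lc dg])
    fix a b :: complex assume b: "b \<noteq> 0"
    let ?e = "cell_entry E (two_valued V1 a b)"
    let ?M = "four_block_mat (lmat xs xs ?e) (lmat xs ys ?e) (lmat ys xs ?e) (lmat ys ys ?e)"
    \<comment> \<open>Right multiplication by \<open>R\<close> combines \<open>b\<close> times the
      columns of \<open>V1\<close> with columns of \<open>V2\<close> so that the lower left block
      vanishes. The price is the factor \<open>b ^ card V1\<close>, which is cancelled
      later.\<close>
    let ?R = "four_block_mat (lmat xs xs (\<lambda>x y. b * ?I x y)) (lmat xs ys (\<lambda>_ _. 0)) (lmat ys xs (adj E)) (lmat ys ys ?I)"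
    have cr: "?M \<in> carrier_mat (length xs + length ys) (length xs + length ys)"
      "?R \<in> carrier_mat (length xs + length ys) (length xs + length ys)"
      by (rule four_block_carrier_mat; rule lmat_carrier)+
    have xy: "distinct (xs @ ys)" "set (xs @ ys) = V" using xs ys s(7,8) by auto
    have e: "?e x y = (if x = y then a else 0)" if "x \<in> V1" "y \<in> V1" for x y
      using that s(3)[OF that] by (simp add: cell_entry_def two_valued_def)
    have e': "?e x y = (if x = y then b else 0)" if "x \<in> V2" "y \<in> V2" for x y
      using that s(4)[OF that] s(8) by (auto simp: cell_entry_def two_valued_def)
    have e'': "?e x y = - adj E x y" "?e y x = - adj E y x" if "x \<in> V1" "y \<in> V2" for x y
      using that s(8) by (auto simp: cell_entry_def)
    have "?M * ?R = four_block_mat (lmat xs xs (\<lambda>x y. a * b * ?I x y - c x y)) (lmat xs ys ?e)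
      (lmat ys xs (\<lambda>_ _. 0)) (lmat ys ys (\<lambda>x y. b * ?I x y))"
      unfolding mult_four_block_lmat[OF xs(1) ys(1)] xs(2) ys(2)
    proof (intro arg_cong4[where f = four_block_mat] lmat_cong; unfold xs(2) ys(2))
      fix x y assume h: "x \<in> V1" "y \<in> V1"
      have "(\<Sum>z\<in>V1. ?e x z * (b * ?I z y)) = (\<Sum>z\<in>V1. (?e x z * b) * ?I z y)" by (simp add: mult.assoc)
      also have "\<dots> = a * b * ?I x y" using h s(5) by (subst sum_ind_right(2)) (auto simp: e)
      finally show "(\<Sum>z\<in>V1. ?e x z * (b * ?I z y)) + (\<Sum>z\<in>V2. ?e x z * adj E z y) = a * b * ?I x y - c x y"
        using e''(1)[OF h(1)] by (simp add: c_def sum_negf)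
    next
      fix x y assume h: "x \<in> V1" "y \<in> V2"
      show "(\<Sum>z\<in>V1. ?e x z * 0) + (\<Sum>z\<in>V2. ?e x z * ?I z y) = ?e x y"
        using h s(6) by (subst sum_ind_right(2)) auto
    next
      fix x y assume h: "x \<in> V2" "y \<in> V1"
      have "(\<Sum>z\<in>V1. ?e x z * (b * ?I z y)) = (\<Sum>z\<in>V1. (?e x z * b) * ?I z y)" by (simp add: mult.assoc)
      also have "\<dots> = - (b * adj E x y)" using h s(5) by (subst sum_ind_right(2)) (auto simp: e'')
      finally have 1: "(\<Sum>z\<in>V1. ?e x z * (b * ?I z y)) = - (b * adj E x y)" .
      have "(\<Sum>z\<in>V2. ?e x z * adj E z y) = (\<Sum>z\<in>V2. ?I x z * (b * adj E z y))"
        using h by (intro sum.cong) (auto simp: e')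
      also have "\<dots> = b * adj E x y" using h s(6) by (subst sum_ind_left(1)) auto
      finally show "(\<Sum>z\<in>V1. ?e x z * (b * ?I z y)) + (\<Sum>z\<in>V2. ?e x z * adj E z y) = 0" using 1 by simp
    next
      fix x y assume h: "x \<in> V2" "y \<in> V2"
      show "(\<Sum>z\<in>V1. ?e x z * 0) + (\<Sum>z\<in>V2. ?e x z * ?I z y) = b * ?I x y"
        using h s(6) by (subst sum_ind_right(2)) (auto simp: e')
    qed
    moreover have bI: "lmat zs zs (\<lambda>x y. b * ?I x y) = b \<cdot>\<^sub>m 1\<^sub>m (length zs)" if "distinct zs" for zs
      unfolding lmat_one[OF that, symmetric] by (rule eq_matI) auto
    have "det ?R = b ^ card V1"
      by (subst det_four_block_mat_upper_right_zero[OF lmat_carrier lmat_zero lmat_carrier lmat_carrier])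
         (simp add: bI lmat_one xs ys len)
    moreover have "det (lmat xs xs (\<lambda>x y. a * b * ?I x y - c x y)) = poly (char_poly C) (a * b)"
      unfolding char_poly_matrix[OF C]
      by (rule arg_cong[where f = det], rule eq_matI)
         (auto simp: C_def char_matrix_def nth_eq_iff_index_eq[OF xs(1)] len)
    ultimately have "det ?M * b ^ card V1 = poly (char_poly C) (a * b) * b ^ card V2"
      using det_mult[OF cr]
        det_four_block_mat_lower_left_zero[OF lmat_carrier[of xs xs "\<lambda>x y. a * b * ?I x y - c x y"]
          lmat_carrier[of xs ys ?e] lmat_zero lmat_carrier[of ys ys "\<lambda>x y. b * ?I x y"]]
      by (simp add: bI[OF ys(1)] len)
    also have "b ^ card V2 = b ^ (card V2 - card V1) * b ^ card V1"
      using n12 by (simp add: power_add[symmetric])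
    finally have "det ?M = poly (char_poly C) (a * b) * b ^ (card V2 - card V1)"
      using b by simp
    moreover have "set_det V ?e = det ?M"
      using det_lmat[OF xy(1), of ?e] unfolding xy(2) lmat_append by simp
    ultimately show "set_det V ?e = b ^ (card V2 - card V1) * poly S (a * b) * (a * b - of_nat (q1 * q2))"
      unfolding S by (simp add: algebra_simps)
  qed
qed

text \<open>A vector constant on cells reduces the system to two equations with rows
  \<open>a, -q1\<close> and \<open>-q2, b\<close>, and the values in \<open>h\<close> are given by
  Cramer's rule. In the sum, \<open>2 * card V1 * q1\<close> is twice the number of edges, since
  both cells count the same edges.\<close>

lemma cell_entry_system:
  assumes G: "semi_regular_bipartite V E V1 V2 q1 q2"
    and D: "a * b \<noteq> (of_nat (q1 * q2) :: complex)"
  defines "h \<equiv> two_valued V1 ((b + of_nat q1) / (a * b - of_nat (q1 * q2)))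
                              ((a + of_nat q2) / (a * b - of_nat (q1 * q2)))"
  shows "x \<in> V \<Longrightarrow> (\<Sum>y\<in>V. cell_entry E (two_valued V1 a b) x y * h y) = 1"
    and "(\<Sum>y\<in>V. h y) = (of_nat (card V1) * b + of_nat (card V2) * a + 2 * of_nat (card V1 * q1)) /
           (a * b - of_nat (q1 * q2))"
proof -
  note s = semi_regular_adj_sums[OF G]
  let ?D = "a * b - of_nat (q1 * q2)"
  let ?h1 = "(b + of_nat q1) / ?D" and ?h2 = "(a + of_nat q2) / ?D"
  have D0: "?D \<noteq> 0" using D by simp
  have h1: "h y = ?h1" if "y \<in> V1" for y using that by (simp add: h_def two_valued_def)
  have h2: "h y = ?h2" if "y \<in> V2" for y using that s(8) by (auto simp: h_def two_valued_def)
  have split: "(\<Sum>y\<in>V. f y) = (\<Sum>y\<in>V1. f y) + (\<Sum>y\<in>V2. f y)" for f :: "'a \<Rightarrow> complex"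
    unfolding s(7) by (rule sum.union_disjoint[OF s(5,6,8)])
  have "(\<Sum>y\<in>V. h y) = of_nat (card V1) * ?h1 + of_nat (card V2) * ?h2"
    unfolding split using h1 h2 by simp
  also have "\<dots> = (of_nat (card V1) * b + of_nat (card V2) * a + (of_nat (card V1 * q1) + of_nat (card V2 * q2))) / ?D"
    by (simp add: add_divide_distrib algebra_simps)
  also have "of_nat (card V1 * q1) + of_nat (card V2 * q2) = 2 * (of_nat (card V1 * q1) :: complex)"
    unfolding semi_regular_counts(1)[OF G] by simp
  finally show "(\<Sum>y\<in>V. h y) = (of_nat (card V1) * b + of_nat (card V2) * a + 2 * of_nat (card V1 * q1)) / ?D" .
  have row: "(\<Sum>y\<in>V. cell_entry E (two_valued V1 a b) x y * h y) =
      two_valued V1 a b x * h x - ((\<Sum>y\<in>V1. adj E x y) * ?h1 + (\<Sum>y\<in>V2. adj E x y) * ?h2)" if "x \<in> V" for x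
  proof -
    have "(\<Sum>y\<in>V. cell_entry E (two_valued V1 a b) x y * h y) =
      (\<Sum>y\<in>V. (if x = y then 1 else 0) * (two_valued V1 a b y * h y)) - (\<Sum>y\<in>V. adj E x y * h y)"
      unfolding sum_subtractf[symmetric] by (rule sum.cong) (auto simp: cell_entry_def algebra_simps)
    also have "(\<Sum>y\<in>V. (if x = y then 1 else 0) * (two_valued V1 a b y * h y)) = two_valued V1 a b x * h x"
      using that s(5-7) by (subst sum_ind_left(1)) auto
    also have "(\<Sum>y\<in>V. adj E x y * h y) = (\<Sum>y\<in>V1. adj E x y) * ?h1 + (\<Sum>y\<in>V2. adj E x y) * ?h2"
      unfolding split sum_distrib_right using h1 h2 by simp
    finally show ?thesis .
  qed
  assume "x \<in> V"
  then consider "x \<in> V1" | "x \<in> V2" using s(7) by auto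
  thus "(\<Sum>y\<in>V. cell_entry E (two_valued V1 a b) x y * h y) = 1"
  proof cases
    case 1
    hence "(\<Sum>y\<in>V1. adj E x y) = 0" by (simp add: s(3))
    hence "(\<Sum>y\<in>V. cell_entry E (two_valued V1 a b) x y * h y) = a * ?h1 - of_nat q1 * ?h2"
      using row[OF \<open>x \<in> V\<close>] 1 s(1) h1 by (simp add: two_valued_def)
    also have "\<dots> = ?D / ?D" by (simp add: diff_divide_distrib[symmetric] algebra_simps)
    finally show ?thesis using D0 by simp
  next
    case 2
    hence "(\<Sum>y\<in>V2. adj E x y) = 0" "x \<notin> V1" using s(4,8) by auto
    hence "(\<Sum>y\<in>V. cell_entry E (two_valued V1 a b) x y * h y) = b * ?h2 - of_nat q2 * ?h1"
      using row[OF \<open>x \<in> V\<close>] 2 s(2) h2 by (simp add: two_valued_def)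
    also have "\<dots> = ?D / ?D" by (simp add: diff_divide_distrib[symmetric] algebra_simps)
    finally show ?thesis using D0 by simp
  qed
qed

text \<open>Fixes the remaining factor by the properties used afterwards, so that one and the same
  \<open>S\<close> can enter the characteristic polynomial and the zeta function.\<close>

definition is_core :: "'a set \<Rightarrow> ('a \<Rightarrow> 'a \<Rightarrow> bool) \<Rightarrow> 'a set \<Rightarrow> 'a set \<Rightarrow> nat \<Rightarrow> nat \<Rightarrow> complex poly \<Rightarrow> bool" where
  "is_core V E V1 V2 q1 q2 S \<longleftrightarrow> lead_coeff S = 1 \<and> Polynomial.degree S = card V1 - 1 \<and>
     (\<forall>a b. b \<noteq> 0 \<longrightarrow> set_det V (cell_entry E (two_valued V1 a b)) =
       b ^ (card V2 - card V1) * poly S (a * b) * (a * b - of_nat (q1 * q2)))"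

lemma is_core_exists:
  assumes "semi_regular_bipartite V E V1 V2 q1 q2" "card V1 \<le> card V2"
  obtains S where "is_core V E V1 V2 q1 q2 S"
  using set_det_semi_regular[OF assms] unfolding is_core_def by metis

text \<open>The factors \<open>a * b - q1 * q2\<close> and \<open>c * d - q3 * q4\<close> of the two
  determinants are the denominators of the two solution sums, so their product clears the fractions.
  The exclusions \<open>nz\<close> are harmless later, where each application avoids only finitely
  many points.\<close>

lemma set_det_cell_join:
  fixes a b c d :: complex
  assumes G1: "semi_regular_bipartite V E V1 V2 q1 q2" and S1: "is_core V E V1 V2 q1 q2 S1"
    and G2: "semi_regular_bipartite W F V3 V4 q3 q4" and S2: "is_core W F V3 V4 q3 q4 S2"
    and nz: "b \<noteq> 0" "d \<noteq> 0" "a * b \<noteq> of_nat (q1 * q2)" "c * d \<noteq> of_nat (q3 * q4)"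
  shows "set_det (join_V V W) (cell_entry (join_E E V F W) (case_sum (two_valued V1 a b) (two_valued V3 c d))) =
    b ^ (card V2 - card V1) * poly S1 (a * b) * (d ^ (card V4 - card V3) * poly S2 (c * d)) *
    ((a * b - of_nat (q1 * q2)) * (c * d - of_nat (q3 * q4)) -
     (of_nat (card V1) * b + of_nat (card V2) * a + 2 * of_nat (card V1 * q1)) *
     (of_nat (card V3) * d + of_nat (card V4) * c + 2 * of_nat (card V3 * q3)))"
proof -
  have fin: "finite V" "finite W" using semi_regular_adj_sums(5-7)[OF G1] semi_regular_adj_sums(5-7)[OF G2] by auto
  have 1: "set_det V (cell_entry E (two_valued V1 a b)) =
       b ^ (card V2 - card V1) * poly S1 (a * b) * (a * b - of_nat (q1 * q2))"
    using S1 nz(1) unfolding is_core_def by blast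
  have 2: "set_det W (cell_entry F (two_valued V3 c d)) =
       d ^ (card V4 - card V3) * poly S2 (c * d) * (c * d - of_nat (q3 * q4))"
    using S2 nz(2) unfolding is_core_def by blast
  note h1 = cell_entry_system[OF G1 nz(3)] and h2 = cell_entry_system[OF G2 nz(4)]
  have alg: "B * P * X * (D * Q * Y) * (1 - K / X * (L / Y)) = B * P * (D * Q) * (X * Y - K * L)"
    if "X \<noteq> 0" "Y \<noteq> 0" for B P D Q X Y K L :: complex
    using that by (simp add: field_simps)
  have "set_det (join_V V W) (cell_entry (join_E E V F W) (case_sum (two_valued V1 a b) (two_valued V3 c d))) =
    set_det V (cell_entry E (two_valued V1 a b)) * set_det W (cell_entry F (two_valued V3 c d)) *
    (1 - (of_nat (card V1) * b + of_nat (card V2) * a + 2 * of_nat (card V1 * q1)) / (a * b - of_nat (q1 * q2)) *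
     ((of_nat (card V3) * d + of_nat (card V4) * c + 2 * of_nat (card V3 * q3)) / (c * d - of_nat (q3 * q4))))"
    unfolding h1(2)[symmetric] h2(2)[symmetric]
    by (rule set_det_join[OF fin]; (rule h1(1) h2(1), assumption)?) (auto simp: cell_entry_def adj_def)
  also have "\<dots> = b ^ (card V2 - card V1) * poly S1 (a * b) * (d ^ (card V4 - card V3) * poly S2 (c * d)) *
    ((a * b - of_nat (q1 * q2)) * (c * d - of_nat (q3 * q4)) -
     (of_nat (card V1) * b + of_nat (card V2) * a + 2 * of_nat (card V1 * q1)) *
     (of_nat (card V3) * d + of_nat (card V4) * c + 2 * of_nat (card V3 * q3)))"
    unfolding 1 2 by (rule alg) (use nz in auto)
  finally show ?thesis .
qed

section \<open>Order, degrees and size of a join\<close>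

lemma simple_graph_join:
  assumes "simple_graph V E" "simple_graph W F"
  shows "simple_graph (join_V V W) (join_E E V F W)"
  unfolding simple_graph_def
proof (intro conjI allI impI)
  show "finite (join_V V W)" using assms by (auto simp: simple_graph_def join_V_def)
  fix x y assume h: "join_E E V F W x y"
  show "x \<in> join_V V W" "y \<in> join_V V W" "join_E E V F W y x"
    using h assms by (cases x; cases y; simp add: simple_graph_def join_V_def image_iff; blast)+
next
  fix x show "\<not> join_E E V F W x x"
    using assms by (cases x) (simp_all add: simple_graph_def)
qed

lemma degree_join:
  assumes "simple_graph V E" "simple_graph W F"
  shows "x \<in> V \<Longrightarrow> Defs.degree (join_V V W) (join_E E V F W) (Inl x) = Defs.degree V E x + card W"
    and "y \<in> W \<Longrightarrow> Defs.degree (join_V V W) (join_E E V F W) (Inr y) = Defs.degree W F y + card V"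
proof -
  have fin: "finite V" "finite W" using assms unfolding simple_graph_def by blast+
  have c: "card (Inl ` A \<union> Inr ` B) = card A + card B" if "finite A" "finite B" for A :: "'a set" and B :: "'b set"
    using that by (subst card_Un_disjoint) (auto simp: card_image)
  show "Defs.degree (join_V V W) (join_E E V F W) (Inl x) = Defs.degree V E x + card W" if "x \<in> V"
  proof -
    have "{z \<in> join_V V W. join_E E V F W (Inl x) z} = Inl ` {y \<in> V. E x y} \<union> Inr ` W"
      using that by (auto simp: join_V_def)
    thus ?thesis unfolding Defs.degree_def by (simp add: c fin)
  qed
  show "Defs.degree (join_V V W) (join_E E V F W) (Inr y) = Defs.degree W F y + card V" if "y \<in> W"
  proof -
    have "{z \<in> join_V V W. join_E E V F W (Inr y) z} = Inl ` V \<union> Inr ` {z \<in> W. F y z}"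
      using that by (auto simp: join_V_def)
    thus ?thesis unfolding Defs.degree_def by (simp add: c fin)
  qed
qed

lemma card_join_V: "finite V \<Longrightarrow> finite W \<Longrightarrow> card (join_V V W) = card V + card W"
  unfolding join_V_def by (subst card_Un_disjoint) (auto simp: card_image)

lemma sum_degree_join:
  assumes G1: "semi_regular_bipartite V E V1 V2 q1 q2" and G2: "semi_regular_bipartite W F V3 V4 q3 q4"
  shows "(\<Sum>x\<in>join_V V W. Defs.degree (join_V V W) (join_E E V F W) x) =
    2 * (card V1 * q1 + card V * card W + card V3 * q3)"
proof -
  note s1 = semi_regular_adj_sums[OF G1] and s2 = semi_regular_adj_sums[OF G2]
  have g: "simple_graph V E" "simple_graph W F" using G1 G2 by (auto simp: semi_regular_bipartite_def)
  have fin: "finite V" "finite W" using s1(5-7) s2(5-7) by auto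
  have d1: "(\<Sum>x\<in>V. Defs.degree V E x) = card V1 * q1 + card V2 * q2"
    unfolding s1(7) sum.union_disjoint[OF s1(5,6,8)]
    using G1 by (simp add: semi_regular_bipartite_def)
  have d2: "(\<Sum>x\<in>W. Defs.degree W F x) = card V3 * q3 + card V4 * q4"
    unfolding s2(7) sum.union_disjoint[OF s2(5,6,8)]
    using G2 by (simp add: semi_regular_bipartite_def)
  have "(\<Sum>x\<in>join_V V W. Defs.degree (join_V V W) (join_E E V F W) x) =
      (\<Sum>x\<in>V. Defs.degree V E x + card W) + (\<Sum>x\<in>W. Defs.degree W F x + card V)"
    unfolding join_V_def using fin degree_join[OF g]
    by (subst sum.union_disjoint) (auto simp: sum.reindex join_V_def)
  also have "\<dots> = 2 * (card V1 * q1 + card V * card W + card V3 * q3)"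
    using d1 d2 semi_regular_counts(1)[OF G1] semi_regular_counts(1)[OF G2] by (simp add: sum.distrib)
  finally show ?thesis .
qed

section \<open>Characteristic polynomial and zeta function of a join\<close>

lemma poly_eq_off_finite:
  fixes p q :: "'a :: {idom, ring_char_0} poly"
  assumes "finite A" and "\<And>x. x \<notin> A \<Longrightarrow> poly p x = poly q x"
  shows "p = q"
proof (rule ccontr)
  assume "p \<noteq> q"
  hence "finite {x. poly (p - q) x = 0}" by (intro poly_roots_finite) simp
  moreover have "UNIV - A \<subseteq> {x. poly (p - q) x = 0}" using assms(2) by auto
  ultimately have "finite (UNIV - A)" by (rule rev_finite_subset)
  thus False using assms(1) infinite_UNIV_char_0 by (metis finite_Diff2)
qed

lemma eventually_poly_nonzero:
  fixes p :: "complex poly"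
  assumes "p \<noteq> 0"
  shows "\<forall>\<^sub>F x in at a. poly p x \<noteq> 0"
proof -
  have "\<forall>\<^sub>F x in at a. \<forall>r\<in>{x. poly p x = 0}. x \<noteq> r"
    by (rule eventually_ball_finite[OF poly_roots_finite[OF assms]]) (simp add: eventually_neq_at_within)
  thus ?thesis by (rule eventually_mono) auto
qed

lemma set_det_cong:
  "(\<And>x y. x \<in> V \<Longrightarrow> y \<in> V \<Longrightarrow> f x y = g x y) \<Longrightarrow> set_det V f = set_det V g"
  unfolding set_det_def by (intro sum.cong refl arg_cong2[where f = times] prod.cong) (auto simp: permutes_in_image)

lemma set_det_smult: "set_det V (\<lambda>x y. c * f x y) = c ^ card V * set_det V f"
  unfolding set_det_def by (simp add: prod.distrib sum_distrib_left mult_ac)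

lemma poly_char_poly_graph: "poly (char_poly_graph V E) x = set_det V (cell_entry E (\<lambda>_. x))"
proof -
  have "poly (of_int k) x = of_int k" for k :: int by (cases k) (auto simp flip: of_nat_Suc)
  moreover have "poly ((if p v = v then [:0, 1:] else 0) - [:adj E v (p v):]) x = cell_entry E (\<lambda>_. x) v (p v)" for p v
    by (auto simp: cell_entry_def)
  ultimately show ?thesis
    unfolding char_poly_graph_def set_det_def poly_sum poly_mult poly_prod by simp
qed

text \<open>The contribution \<open>x^k S(x^2)\<close> of one graph when both of its cells carry the
  weight \<open>x\<close>; it has the parity of \<open>k\<close>.\<close>

definition core_poly :: "complex poly \<Rightarrow> nat \<Rightarrow> complex poly" where
  "core_poly S k = monom 1 k * pcompose S [:0, 0, 1:]"

lemma poly_core_poly: "poly (core_poly S k) x = x ^ k * poly S (x * x)"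
  by (simp add: core_poly_def poly_monom poly_pcompose)

lemma lead_coeff_core_poly:
  assumes "lead_coeff S = 1"
  shows "lead_coeff (core_poly S k) = 1" "Polynomial.degree (core_poly S k) = k + 2 * Polynomial.degree S"
proof -
  have S: "S \<noteq> 0" using assms by auto
  have l: "lead_coeff (pcompose S [:0, 0, 1:]) = 1"
    by (subst lead_coeff_comp) (use assms in auto)
  thus "lead_coeff (core_poly S k) = 1" unfolding core_poly_def lead_coeff_mult by (simp add: degree_monom_eq)
  have "pcompose S [:0, 0, 1:] \<noteq> 0" using l by auto
  thus "Polynomial.degree (core_poly S k) = k + 2 * Polynomial.degree S"
    unfolding core_poly_def by (subst degree_mult_eq) (auto simp: degree_monom_eq degree_pcompose monom_eq_0_iff)
qed

text \<open>Characteristic polynomial of the 4 by 4 quotient matrix of the join over its four cells.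
  Here \<open>a\<close> and \<open>p\<close> are the degree products, \<open>M\<close> and
  \<open>N\<close> the orders, and \<open>e\<close> and \<open>f\<close> the sizes of the two
  graphs.\<close>

definition quotient_poly :: "nat \<Rightarrow> nat \<Rightarrow> nat \<Rightarrow> nat \<Rightarrow> nat \<Rightarrow> nat \<Rightarrow> complex poly" where
  "quotient_poly a p M N e f = [:- of_nat a, 0, 1:] * [:- of_nat p, 0, 1:]
      - [:2 * of_nat e, of_nat M:] * [:2 * of_nat f, of_nat N:]"

lemma char_poly_join:
  assumes G1: "semi_regular_bipartite V E V1 V2 q1 q2" and S1: "is_core V E V1 V2 q1 q2 S1"
    and G2: "semi_regular_bipartite W F V3 V4 q3 q4" and S2: "is_core W F V3 V4 q3 q4 S2"
  shows "char_poly_graph (join_V V W) (join_E E V F W) =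
    core_poly S1 (card V2 - card V1) * core_poly S2 (card V4 - card V3) *
    quotient_poly (q1 * q2) (q3 * q4) (card V) (card W) (card V1 * q1) (card V3 * q3)"
proof (rule poly_eq_off_finite)
  define A where "A = {0} \<union> {x. poly [:- complex_of_nat (q1 * q2), 0, 1:] x = 0} \<union>
    {x. poly [:- complex_of_nat (q3 * q4), 0, 1:] x = 0}"
  show "finite A" unfolding A_def by (intro finite_UnI poly_roots_finite) auto
  fix x assume "x \<notin> A"
  hence x: "x \<noteq> 0" "x * x \<noteq> of_nat (q1 * q2)" "x * x \<noteq> of_nat (q3 * q4)"
    by (auto simp: A_def)
  have tv: "two_valued B x x = (\<lambda>_. x)" for B :: "'z set" and x by (auto simp: two_valued_def)
  have cs: "case_sum (\<lambda>_. x) (\<lambda>_. x) = (\<lambda>_ :: 'a + 'b. x)" by (auto split: sum.splits)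
  show "poly (char_poly_graph (join_V V W) (join_E E V F W)) x =
    poly (core_poly S1 (card V2 - card V1) * core_poly S2 (card V4 - card V3) *
    quotient_poly (q1 * q2) (q3 * q4) (card V) (card W) (card V1 * q1) (card V3 * q3)) x"
    using set_det_cell_join[OF G1 S1 G2 S2 x(1) x(1) x(2) x(3)]
    unfolding tv cs poly_char_poly_graph poly_mult poly_core_poly
    by (simp add: quotient_poly_def semi_regular_counts(7)[OF G1] semi_regular_counts(7)[OF G2] algebra_simps)
qed

text \<open>For monic \<open>S\<close> and \<open>t = u^2\<close> this is
  \<open>(1 + c t)^k t^(degree S) S((1 + b t) (1 + c t) / t)\<close>, the factor of \<open>S\<close>
  after Bass scaling for cells of degrees \<open>b + 1\<close> and \<open>c + 1\<close>. Writing it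
  over the roots of \<open>S\<close> makes it visibly a polynomial with value 1 at 0.\<close>

definition homog_poly :: "complex poly \<Rightarrow> nat \<Rightarrow> complex \<Rightarrow> complex \<Rightarrow> complex poly" where
  "homog_poly S k b c = [:1, c:] ^ k * (\<Prod>z\<in>#proots S. [:1, b:] * [:1, c:] - [:0, z:])"

lemma poly_homog_poly:
  assumes "lead_coeff S = 1" "t \<noteq> 0"
  shows "poly (homog_poly S k b c) t =
    (1 + c * t) ^ k * t ^ Polynomial.degree S * poly S ((1 + b * t) * (1 + c * t) / t)"
proof -
  let ?z = "(1 + b * t) * (1 + c * t) / t"
  have S: "poly S ?z = (\<Prod>z\<in>#proots S. ?z - z)"
    by (subst complex_poly_decompose_multiset[of S, symmetric]) (simp add: assms(1) poly_prod_mset)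
  have "(\<Prod>z\<in>#proots S. poly ([:1, b:] * [:1, c:] - [:0, z:]) t) = (\<Prod>z\<in>#proots S. t * (?z - z))"
    using assms(2) by (intro arg_cong[where f = prod_mset] image_mset_cong) (simp add: field_simps)
  also have "\<dots> = t ^ size (proots S) * (\<Prod>z\<in>#proots S. ?z - z)"
    by (simp add: prod_mset.distrib)
  finally show ?thesis
    unfolding S homog_poly_def size_proots_complex poly_mult poly_prod_mset
    by (simp add: mult_ac add_ac)
qed

lemma poly_homog_poly_0: "poly (homog_poly S k b c) 0 = 1"
  by (simp add: homog_poly_def poly_prod_mset)

lemma degree_homog_poly:
  assumes "b \<noteq> 0" "c \<noteq> 0"
  shows "Polynomial.degree (homog_poly S k b c) = k + 2 * Polynomial.degree S"
proof -
  have f: "Polynomial.degree ([:1, b:] * [:1, c:] - [:0, z:]) = 2" for z :: complex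
    using assms by simp
  hence nz: "[:1, b:] * [:1, c:] - [:0, z:] \<noteq> 0" for z :: complex
    by (metis degree_0 zero_neq_numeral)
  have "Polynomial.degree (\<Prod>z\<in>#A. [:1, b:] * [:1, c:] - [:0, z:]) = 2 * size A \<and>
     (\<Prod>z\<in>#A. [:1, b:] * [:1, c:] - [:0, z:]) \<noteq> 0" for A :: "complex multiset"
  proof (induction A)
    case (add z A)
    have "Polynomial.degree (([:1, b:] * [:1, c:] - [:0, z:]) * (\<Prod>z\<in>#A. [:1, b:] * [:1, c:] - [:0, z:])) = 2 + 2 * size A"
      using add nz[of z] f[of z] by (subst degree_mult_eq) auto
    thus ?case using add nz[of z] by (simp del: mult_pCons_left mult_pCons_right)
  qed simp
  from this[of "proots S"] show ?thesis
    unfolding homog_poly_def size_proots_complex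
    by (subst degree_mult_eq) (auto simp: degree_power_eq assms simp del: mult_pCons_left mult_pCons_right)
qed

definition weight_poly :: "nat \<Rightarrow> nat \<Rightarrow> complex \<Rightarrow> complex \<Rightarrow> complex poly" where
  "weight_poly n k b c = Polynomial.smult (of_nat n) [:1, c:] + Polynomial.smult (of_nat k) [:1, b:]"

text \<open>Scaled by \<open>u^4\<close>, the bracket reads
  \<open>D - t (W1 + 2 e u) (W2 + 2 f u)\<close>, where \<open>D\<close>, \<open>W1\<close>,
  \<open>W2\<close> are polynomials in \<open>t = u^2\<close>. Its even part in \<open>u\<close> is
  \<open>even_poly\<close>; its odd part is \<open>- 2 u t\<close> times
  \<open>odd_poly\<close>.\<close>

definition even_poly :: "nat \<Rightarrow> nat \<Rightarrow> nat \<Rightarrow> nat \<Rightarrow> nat \<Rightarrow> nat \<Rightarrow> nat \<Rightarrow> nat \<Rightarrow>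
    complex \<Rightarrow> complex \<Rightarrow> complex \<Rightarrow> complex \<Rightarrow> complex poly" where
  "even_poly a p n1 n2 n3 n4 e f b1 b2 b3 b4 =
     ([:1, b1:] * [:1, b2:] - [:0, of_nat a:]) * ([:1, b3:] * [:1, b4:] - [:0, of_nat p:])
     - [:0, 1:] * weight_poly n1 n2 b1 b2 * weight_poly n3 n4 b3 b4 - [:0, 0, 4 * of_nat e * of_nat f:]"

definition odd_poly :: "nat \<Rightarrow> nat \<Rightarrow> nat \<Rightarrow> nat \<Rightarrow> nat \<Rightarrow> nat \<Rightarrow>
    complex \<Rightarrow> complex \<Rightarrow> complex \<Rightarrow> complex \<Rightarrow> complex poly" where
  "odd_poly n1 n2 n3 n4 e f b1 b2 b3 b4 =
     Polynomial.smult (of_nat e) (weight_poly n3 n4 b3 b4) + Polynomial.smult (of_nat f) (weight_poly n1 n2 b1 b2)"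

lemma poly_even_poly: "poly (even_poly a p n1 n2 n3 n4 e f b1 b2 b3 b4) t =
    ((1 + b1 * t) * (1 + b2 * t) - t * of_nat a) * ((1 + b3 * t) * (1 + b4 * t) - t * of_nat p) -
    t * (of_nat n1 * (1 + b2 * t) + of_nat n2 * (1 + b1 * t)) *
      (of_nat n3 * (1 + b4 * t) + of_nat n4 * (1 + b3 * t)) - t * t * (4 * of_nat e * of_nat f)"
  unfolding even_poly_def weight_poly_def poly_mult poly_add poly_diff poly_smult
  by (simp add: mult_ac)

lemma poly_odd_poly: "poly (odd_poly n1 n2 n3 n4 e f b1 b2 b3 b4) t =
    of_nat e * (of_nat n3 * (1 + b4 * t) + of_nat n4 * (1 + b3 * t)) +
    of_nat f * (of_nat n1 * (1 + b2 * t) + of_nat n2 * (1 + b1 * t))"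
  unfolding odd_poly_def weight_poly_def poly_add poly_smult by (simp add: mult_ac)

text \<open>The exponent of \<open>u\<close> will be the order of the join. It splits into
  \<open>k1\<close> and \<open>k2\<close> for the explicit powers, \<open>2 m1\<close> and
  \<open>2 m2\<close> for homogenizing the factors \<open>s1\<close> and \<open>s2\<close>, and 4
  for the bracket.\<close>

lemma bass_scaling:
  fixes u :: complex
  assumes u: "u \<noteq> 0"
  shows "u ^ (k1 + 2 * m1 + (k2 + 2 * m2) + 4) * ((x2 / u) ^ k1 * s1 * ((x4 / u) ^ k2 * s2) *
    ((x1 / u * (x2 / u) - A) * (x3 / u * (x4 / u) - P) -
     (n1 * (x2 / u) + n2 * (x1 / u) + 2 * e) * (n3 * (x4 / u) + n4 * (x3 / u) + 2 * f))) =
    x2 ^ k1 * (u\<^sup>2) ^ m1 * s1 * (x4 ^ k2 * (u\<^sup>2) ^ m2 * s2) *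
    ((x1 * x2 - u\<^sup>2 * A) * (x3 * x4 - u\<^sup>2 * P) -
      u\<^sup>2 * (n1 * x2 + n2 * x1 + 2 * e * u) * (n3 * x4 + n4 * x3 + 2 * f * u))"
proof -
  have "u ^ 2 * (x1 / u * (x2 / u) - A) = x1 * x2 - u\<^sup>2 * A" "u ^ 2 * (x3 / u * (x4 / u) - P) = x3 * x4 - u\<^sup>2 * P"
    "u * (n1 * (x2 / u) + n2 * (x1 / u) + 2 * e) = n1 * x2 + n2 * x1 + 2 * e * u"
    "u * (n3 * (x4 / u) + n4 * (x3 / u) + 2 * f) = n3 * x4 + n4 * x3 + 2 * f * u"
    "u ^ k1 * (x2 / u) ^ k1 = x2 ^ k1" "u ^ k2 * (x4 / u) ^ k2 = x4 ^ k2"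
    using u by (auto simp: power2_eq_square algebra_simps power_divide)
  note eqs = this[symmetric]
  show ?thesis unfolding eqs
    by (simp add: power_add power_mult power2_eq_square power4_eq_xxxx algebra_simps)
qed

text \<open>On a cell of degree \<open>d\<close> in the join, the Bass matrix is \<open>u\<close>
  times \<open>cell_entry\<close> with weight \<open>(1 + (d - 1) u^2) / u\<close>. The punctured
  neighbourhood avoids division by \<open>u\<close> and the finitely many zeros of the quantities
  inverted in the elimination.\<close>

lemma zeta_join:
  assumes G1: "semi_regular_bipartite V E V1 V2 q1 q2" and S1: "is_core V E V1 V2 q1 q2 S1"
    and n12: "card V1 \<le> card V2"
    and G2: "semi_regular_bipartite W F V3 V4 q3 q4" and S2: "is_core W F V3 V4 q3 q4 S2"
    and n34: "card V3 \<le> card V4"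
  defines "b1 \<equiv> of_nat (q1 + card W) - 1" and "b2 \<equiv> of_nat (q2 + card W) - 1"
    and "b3 \<equiv> of_nat (q3 + card V) - 1" and "b4 \<equiv> of_nat (q4 + card V) - 1"
  shows "\<forall>\<^sub>F u in at 0. ihara_zeta (join_E E V F W) u *
    (poly (homog_poly S1 (card V2 - card V1) b1 b2 * homog_poly S2 (card V4 - card V3) b3 b4) (u\<^sup>2) *
     (poly (even_poly (q1 * q2) (q3 * q4) (card V1) (card V2) (card V3) (card V4)
         (card V1 * q1) (card V3 * q3) b1 b2 b3 b4) (u\<^sup>2) -
      2 * u * u\<^sup>2 * poly (odd_poly (card V1) (card V2) (card V3) (card V4)
         (card V1 * q1) (card V3 * q3) b1 b2 b3 b4) (u\<^sup>2)) *
     (1 - u\<^sup>2) ^ (card V1 * q1 + card V * card W + card V3 * q3)) = (1 - u\<^sup>2) ^ (card V + card W)"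
proof -
  note s1 = semi_regular_adj_sums[OF G1] and s2 = semi_regular_adj_sums[OF G2]
  note c1 = semi_regular_counts[OF G1] and c2 = semi_regular_counts[OF G2]
  have g: "simple_graph V E" "simple_graph W F" using G1 G2 by (auto simp: semi_regular_bipartite_def)
  have fin: "finite V" "finite W" using s1(5-7) s2(5-7) by auto
  let ?J = "join_V V W" and ?E = "join_E E V F W"
  obtain r where r: "r > 0" "\<And>u. norm u < r \<Longrightarrow> ihara_zeta ?E u * (set_det ?J (bass_entry ?J ?E u) *
     (1 - u\<^sup>2) ^ (card V1 * q1 + card V * card W + card V3 * q3)) = (1 - u\<^sup>2) ^ card ?J"
    using ihara_bass[OF simple_graph_join[OF g] sum_degree_join[OF G1 G2, symmetric]] by metis
  have ev0: "\<forall>\<^sub>F u in at 0. norm u < r"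
    unfolding eventually_at using r(1) by (intro exI[of _ r]) (auto simp: dist_norm)
  have nz: "\<forall>\<^sub>F u in at 0. poly p u \<noteq> 0" if "poly p 0 = 1" for p :: "complex poly"
    by (rule eventually_poly_nonzero) (use that in auto)
  let ?p1 = "[:1, 0, b1:] * [:1, 0, b2:] - [:0, 0, of_nat (q1 * q2):]"
  let ?p2 = "[:1, 0, b3:] * [:1, 0, b4:] - [:0, 0, of_nat (q3 * q4):]"
  have ev: "\<forall>\<^sub>F u in at 0. poly [:1, 0, b2:] u \<noteq> 0 \<and> poly [:1, 0, b4:] u \<noteq> 0 \<and> poly ?p1 u \<noteq> 0 \<and> poly ?p2 u \<noteq> 0"
    by (intro eventually_conj nz) auto
  have deg: "Polynomial.degree S1 = card V1 - 1" "Polynomial.degree S2 = card V3 - 1"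
    "lead_coeff S1 = 1" "lead_coeff S2 = 1"
    using S1 S2 by (auto simp: is_core_def)
  have "\<forall>\<^sub>F u in at (0::complex). u \<noteq> 0" by (simp add: eventually_neq_at_within)
  with ev0 ev show ?thesis
  proof eventually_elim
    case (elim u)
    define x1 where "x1 = 1 + b1 * u\<^sup>2"
    define x2 where "x2 = 1 + b2 * u\<^sup>2"
    define x3 where "x3 = 1 + b3 * u\<^sup>2"
    define x4 where "x4 = 1 + b4 * u\<^sup>2"
    have u: "u \<noteq> 0" "norm u < r" using elim by auto
    have h: "x2 / u \<noteq> 0" "x4 / u \<noteq> 0" "x1 / u * (x2 / u) \<noteq> of_nat (q1 * q2)" "x3 / u * (x4 / u) \<noteq> of_nat (q3 * q4)"
      using elim by (auto simp: x1_def x2_def x3_def x4_def power2_eq_square field_simps)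
    let ?w = "case_sum (two_valued V1 (x1 / u) (x2 / u)) (two_valued V3 (x3 / u) (x4 / u))"
    have dg: "x \<in> V1 \<Longrightarrow> Defs.degree V E x = q1" "x \<in> V2 \<Longrightarrow> Defs.degree V E x = q2"
      "y \<in> V3 \<Longrightarrow> Defs.degree W F y = q3" "y \<in> V4 \<Longrightarrow> Defs.degree W F y = q4" for x y
      using G1 G2 by (auto simp: semi_regular_bipartite_def)
    have sub: "x \<in> V1 \<Longrightarrow> x \<in> V" "x \<in> V2 \<Longrightarrow> x \<in> V" "y \<in> V3 \<Longrightarrow> y \<in> W" "y \<in> V4 \<Longrightarrow> y \<in> W" for x y
      using s1(7) s2(7) by auto
    have wt: "1 + u\<^sup>2 * (of_nat (Defs.degree ?J ?E z) - 1) = u * ?w z" if z: "z \<in> ?J" for z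
    proof -
      consider x where "z = Inl x" "x \<in> V1" | x where "z = Inl x" "x \<in> V2" "x \<notin> V1"
        | y where "z = Inr y" "y \<in> V3" | y where "z = Inr y" "y \<in> V4" "y \<notin> V3"
        using z s1(7,8) s2(7,8) unfolding join_V_def by blast
      thus ?thesis
        using sub dg u(1)
        by cases (simp_all add: degree_join[OF g] two_valued_def, simp_all add: b1_def b2_def b3_def b4_def
            x1_def x2_def x3_def x4_def algebra_simps)
    qed
    have "set_det ?J (bass_entry ?J ?E u) = set_det ?J (\<lambda>x y. u * cell_entry ?E ?w x y)"
    proof (rule set_det_cong)
      fix x y assume "x \<in> ?J"
      from wt[OF this] show "bass_entry ?J ?E u x y = u * cell_entry ?E ?w x y"
        unfolding bass_entry_def cell_entry_def right_diff_distrib[of u] by (cases "x = y") simp_all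
    qed
    also have "\<dots> = u ^ (card V + card W) * set_det ?J (cell_entry ?E ?w)"
      unfolding set_det_smult card_join_V[OF fin] ..
    also have "card V + card W = (card V2 - card V1) + 2 * (card V1 - 1) + ((card V4 - card V3) + 2 * (card V3 - 1)) + 4"
      using c1(2,7) c2(2,7) n12 n34 by simp
    also have "set_det ?J (cell_entry ?E ?w) = (x2 / u) ^ (card V2 - card V1) * poly S1 (x1 / u * (x2 / u)) *
      ((x4 / u) ^ (card V4 - card V3) * poly S2 (x3 / u * (x4 / u))) *
      ((x1 / u * (x2 / u) - of_nat (q1 * q2)) * (x3 / u * (x4 / u) - of_nat (q3 * q4)) -
       (of_nat (card V1) * (x2 / u) + of_nat (card V2) * (x1 / u) + 2 * of_nat (card V1 * q1)) *
       (of_nat (card V3) * (x4 / u) + of_nat (card V4) * (x3 / u) + 2 * of_nat (card V3 * q3)))"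
      by (rule set_det_cell_join[OF G1 S1 G2 S2 h])
    finally have "set_det ?J (bass_entry ?J ?E u) =
      x2 ^ (card V2 - card V1) * (u\<^sup>2) ^ (card V1 - 1) * poly S1 (x1 / u * (x2 / u)) *
      (x4 ^ (card V4 - card V3) * (u\<^sup>2) ^ (card V3 - 1) * poly S2 (x3 / u * (x4 / u))) *
      ((x1 * x2 - u\<^sup>2 * of_nat (q1 * q2)) * (x3 * x4 - u\<^sup>2 * of_nat (q3 * q4)) -
        u\<^sup>2 * (of_nat (card V1) * x2 + of_nat (card V2) * x1 + 2 * of_nat (card V1 * q1) * u) *
        (of_nat (card V3) * x4 + of_nat (card V4) * x3 + 2 * of_nat (card V3 * q3) * u))"
      unfolding bass_scaling[OF u(1)] .
    also have "x2 ^ (card V2 - card V1) * (u\<^sup>2) ^ (card V1 - 1) * poly S1 (x1 / u * (x2 / u)) =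
        poly (homog_poly S1 (card V2 - card V1) b1 b2) (u\<^sup>2)"
      using u(1) deg by (subst poly_homog_poly) (auto simp: x1_def x2_def power2_eq_square)
    also have "x4 ^ (card V4 - card V3) * (u\<^sup>2) ^ (card V3 - 1) * poly S2 (x3 / u * (x4 / u)) =
        poly (homog_poly S2 (card V4 - card V3) b3 b4) (u\<^sup>2)"
      using u(1) deg by (subst poly_homog_poly) (auto simp: x3_def x4_def power2_eq_square)
    also have "(x1 * x2 - u\<^sup>2 * of_nat (q1 * q2)) * (x3 * x4 - u\<^sup>2 * of_nat (q3 * q4)) -
        u\<^sup>2 * (of_nat (card V1) * x2 + of_nat (card V2) * x1 + 2 * of_nat (card V1 * q1) * u) *
        (of_nat (card V3) * x4 + of_nat (card V4) * x3 + 2 * of_nat (card V3 * q3) * u) =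
      poly (even_poly (q1 * q2) (q3 * q4) (card V1) (card V2) (card V3) (card V4)
         (card V1 * q1) (card V3 * q3) b1 b2 b3 b4) (u\<^sup>2) -
      2 * u * u\<^sup>2 * poly (odd_poly (card V1) (card V2) (card V3) (card V4)
         (card V1 * q1) (card V3 * q3) b1 b2 b3 b4) (u\<^sup>2)"
    proof -
      have "D - t * (A + 2 * e * u) * (B + 2 * f * u) =
          D - t * A * B - t * u\<^sup>2 * (4 * e * f) - 2 * u * t * (e * B + f * A)" for D t A B e f :: complex
        by (simp add: algebra_simps power2_eq_square)
      thus ?thesis unfolding poly_even_poly poly_odd_poly x1_def x2_def x3_def x4_def by (simp only:)
    qed
    finally show ?case
      using r(2)[OF u(2)] unfolding card_join_V[OF fin] poly_mult by simp
  qed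
qed

section \<open>Recovering the parameters\<close>

text \<open>Since \<open>n3 n4 q3 q4 = f^2\<close>, the degree product determines
  \<open>n3 n4\<close>. Together with the sum this fixes \<open>n3\<close> and \<open>n4\<close> up
  to order, and the order is prescribed.\<close>

lemma parameters_from_product:
  fixes n3 n4 q3 q4 n3' n4' q3' q4' f :: nat
  assumes N: "n3 + n4 = n3' + n4'" and le: "n3 \<le> n4" "n3' \<le> n4'" and f: "f \<ge> 1"
    and e: "n3 * q3 = f" "n4 * q4 = f" "n3' * q3' = f" "n4' * q4' = f" and p: "q3 * q4 = q3' * q4'"
  shows "n3 = n3' \<and> n4 = n4' \<and> q3 = q3' \<and> q4 = q4'"
proof -
  have pos: "q3 > 0" "q4 > 0" "n3 > 0" "n4 > 0" "n3' > 0" "n4' > 0" "q3' > 0" "q4' > 0"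
    using e f by (auto intro: gr0I)
  have "(n3 * n4) * (q3 * q4) = (n3' * n4') * (q3' * q4')"
    using e by (metis mult.assoc mult.left_commute)
  hence prod: "n3 * n4 = n3' * n4'" using p pos by simp
  have "(int n3 - int n3') * (int n3 - int n4') = int n3 * (int n3 - (int n3' + int n4')) + int (n3' * n4')"
    by (simp add: algebra_simps)
  also have "int n3' + int n4' = int n3 + int n4" using N by linarith
  also have "int n3 * (int n3 - (int n3 + int n4)) + int (n3' * n4') = 0"
    unfolding prod[symmetric] by (simp add: algebra_simps)
  finally have "n3 = n3' \<or> n3 = n4'" by simp
  hence n: "n3 = n3'" "n4 = n4'" using N le by auto
  have "q3 = q3'" "q4 = q4'" using e n pos by (metis mult_cancel1 less_irrefl)+
  thus ?thesis using n by simp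
qed

text \<open>Multiplying the hypothesis \<open>eq\<close> by \<open>N = n3 + n4\<close> and using \<open>N * q3 * q4 = f * (q3 + q4)\<close>
  turns it into \<open>f * (M * N - e * N - f * M) * (q3 + q4 - q3' - q4') = 0\<close>. Since \<open>M \<le> 2 * e\<close> and
  \<open>N \<le> 2 * f\<close>, the middle factor vanishes only for perfect matchings, where all degrees are 1.\<close>

lemma product_from_coefficient:
  fixes n3 n4 q3 q4 n3' n4' q3' q4' e f M :: nat
  assumes N: "n3 + n4 = n3' + n4'" and le: "n3 \<le> n4" "n3' \<le> n4'" and f: "f \<ge> 1"
    and ef: "n3 * q3 = f" "n4 * q4 = f" "n3' * q3' = f" "n4' * q4' = f"
    and M: "M \<le> 2 * e" "M \<ge> 1"
    and eq: "(e * (n3 + n4) + f * M) * (q3 + q4 + q3' * q4') + e * (n3' * q4' + n4' * q3') =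
      (e * (n3 + n4) + f * M) * (q3' + q4' + q3 * q4) + e * (n3 * q4 + n4 * q3)"
  shows "q3 * q4 = q3' * q4'"
proof -
  define N where "N = int n3 + int n4"
  define \<sigma> where "\<sigma> = int q3 + int q4"
  define \<sigma>' where "\<sigma>' = int q3' + int q4'"
  define c where "c = int e * N + int f * int M"
  have pos: "q3 > 0" "q4 > 0" "n3 > 0" "n4 > 0" "q3' > 0" "q4' > 0" using ef f by (auto intro: gr0I)
  have N': "N = int n3' + int n4'" using assms(1) unfolding N_def by linarith
  have Npos: "N > 0" using pos by (simp add: N_def)
  have i: "int n3 * int q3 = int f" "int n4 * int q4 = int f" "int n3' * int q3' = int f" "int n4' * int q4' = int f"
    using ef by (simp_all flip: of_nat_mult)
  have p: "N * (int q3 * int q4) = int f * \<sigma>" "N * (int q3' * int q4') = int f * \<sigma>'"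
  proof -
    have "N * (int q3 * int q4) = (int n3 * int q3) * int q4 + (int n4 * int q4) * int q3"
      by (simp add: N_def algebra_simps)
    thus "N * (int q3 * int q4) = int f * \<sigma>" unfolding i by (simp add: \<sigma>_def algebra_simps)
    have "N * (int q3' * int q4') = (int n3' * int q3') * int q4' + (int n4' * int q4') * int q3'"
      by (simp add: N' algebra_simps)
    thus "N * (int q3' * int q4') = int f * \<sigma>'" unfolding i by (simp add: \<sigma>'_def algebra_simps)
  qed
  have s: "int n3 * int q4 + int n4 * int q3 = N * \<sigma> - 2 * int f"
    "int n3' * int q4' + int n4' * int q3' = N * \<sigma>' - 2 * int f"
  proof -
    have "int n3 * int q4 + int n4 * int q3 = N * \<sigma> - int n3 * int q3 - int n4 * int q4"
      by (simp add: N_def \<sigma>_def algebra_simps)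
    thus "int n3 * int q4 + int n4 * int q3 = N * \<sigma> - 2 * int f" unfolding i by simp
    have "int n3' * int q4' + int n4' * int q3' = N * \<sigma>' - int n3' * int q3' - int n4' * int q4'"
      by (simp add: N' \<sigma>'_def algebra_simps)
    thus "int n3' * int q4' + int n4' * int q3' = N * \<sigma>' - 2 * int f" unfolding i by simp
  qed
  have "int ((e * (n3 + n4) + f * M) * (q3 + q4 + q3' * q4') + e * (n3' * q4' + n4' * q3')) =
    int ((e * (n3 + n4) + f * M) * (q3' + q4' + q3 * q4) + e * (n3 * q4 + n4 * q3))"
    using eq by (simp only:)
  hence "c * (\<sigma> + int q3' * int q4') + int e * (int n3' * int q4' + int n4' * int q3') =
    c * (\<sigma>' + int q3 * int q4) + int e * (int n3 * int q4 + int n4 * int q3)"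
    by (simp add: c_def N_def \<sigma>_def \<sigma>'_def)
  hence "c * (\<sigma> + int q3' * int q4') + int e * (N * \<sigma>' - 2 * int f) =
    c * (\<sigma>' + int q3 * int q4) + int e * (N * \<sigma> - 2 * int f)" unfolding s .
  hence "N * (c * (\<sigma> + int q3' * int q4') + int e * (N * \<sigma>' - 2 * int f)) =
    N * (c * (\<sigma>' + int q3 * int q4) + int e * (N * \<sigma> - 2 * int f))" by simp
  hence "c * (N * \<sigma> + N * (int q3' * int q4')) + int e * N * (N * \<sigma>' - 2 * int f) =
    c * (N * \<sigma>' + N * (int q3 * int q4)) + int e * N * (N * \<sigma> - 2 * int f)" by (simp add: algebra_simps)
  hence "int f * (int M * N - int e * N - int f * int M) * (\<sigma> - \<sigma>') = 0"
    unfolding p c_def by (simp add: algebra_simps)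
  hence "\<sigma> = \<sigma>' \<or> int M * N = int e * N + int f * int M" using f by auto
  thus ?thesis
  proof
    assume "\<sigma> = \<sigma>'"
    hence "N * (int q3 * int q4) = N * (int q3' * int q4')" using p by simp
    thus ?thesis using Npos by (simp flip: of_nat_mult)
  next
    assume h: "int M * N = int e * N + int f * int M"
    have "int M * N \<le> 2 * int e * N" using M Npos by (intro mult_right_mono) auto
    hence "2 * int f * int M \<le> N * int M" using h by (simp add: algebra_simps)
    hence "2 * int f \<le> N" using M by simp
    hence f2: "2 * f \<le> n3 + n4" by (simp add: N_def)
    \<comment> \<open>The chain \<open>2 f <= n + m <= 2 m <= 2 m b = 2 f\<close> must consist of
      equalities.\<close>
    have one: "a = 1 \<and> b = 1" if "n * a = f" "m * b = f" "n \<le> m" "n + m = n3 + n4" "a > 0" "b > 0" for n m a b :: nat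
    proof -
      have "m > 0" using that f by (auto intro: gr0I)
      have "n + m \<ge> 2 * (m * b)" using f2 that by simp
      moreover have "m * 1 \<le> m * b" by (rule mult_le_mono2) (use that(6) in simp)
      ultimately have "m = n" "m * b = m" using that by linarith+
      hence "b = 1" using \<open>m > 0\<close> by simp
      thus ?thesis using that \<open>m = n\<close> \<open>m > 0\<close> by simp
    qed
    show ?thesis using one[OF ef(1,2) le(1) refl pos(1,2)] one[OF ef(3,4) le(2) N[symmetric] pos(5,6)] by simp
  qed
qed

section \<open>Recovery from the characteristic polynomial\<close>

lemma core_poly_inj:
  assumes "core_poly S k = core_poly T k"
  shows "S = T"
proof -
  have "pcompose S [:0, 0, 1:] = pcompose T [:0, 0, 1:]"
    using assms unfolding core_poly_def by (simp add: monom_eq_0_iff)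
  hence "pcompose (S - T) [:0, 0, 1:] = 0" by (simp add: pcompose_diff)
  hence "S - T = 0" by (subst (asm) pcompose_eq_0_iff) auto
  thus ?thesis by simp
qed

lemma quotient_poly_eq:
  "quotient_poly a p M N e f = [:of_nat a * of_nat p - 4 * of_nat e * of_nat f,
     - (2 * of_nat (e * N + f * M)), - of_nat (a + p + M * N), 0, 1:]"
  by (simp add: quotient_poly_def algebra_simps)

lemma poly_core_poly_minus: "poly (core_poly S k) (- x) = (-1) ^ k * poly (core_poly S k) x"
  by (simp add: poly_core_poly power_minus[of x])

text \<open>Comparing degrees fixes \<open>n3 + n4\<close> and thus the parity of
  \<open>n4 - n3\<close>, so \<open>x\<close> to \<open>- x\<close> multiplies both core factors by
  the same sign. Subtraction isolates the only odd term of \<open>quotient_poly\<close>, with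
  coefficient \<open>- 2 (e N + f M)\<close>. As the core factors are monic, these coefficients
  agree and then so do the factors; the coefficient of \<open>x^2\<close> finally yields
  \<open>q3 q4\<close>.\<close>

lemma char_poly_determines:
  fixes S T :: "complex poly"
  assumes S: "lead_coeff S = 1" "Polynomial.degree S = n3 - 1"
    and T: "lead_coeff T = 1" "Polynomial.degree T = n3' - 1"
    and le: "1 \<le> n3" "n3 \<le> n4" "1 \<le> n3'" "n3' \<le> n4'"
    and M: "M \<ge> 1" and e: "e \<ge> 1"
    and ef: "n3 * q3 = f" "n4 * q4 = f" "n3' * q3' = f'" "n4' * q4' = f'" and f: "f \<ge> 1"
    and eq: "core_poly S (n4 - n3) * quotient_poly a (q3 * q4) M (n3 + n4) e f =
       core_poly T (n4' - n3') * quotient_poly a (q3' * q4') M (n3' + n4') e f'"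
  shows "n3 = n3' \<and> n4 = n4' \<and> q3 = q3' \<and> q4 = q4' \<and> S = T"
proof -
  let ?X = "core_poly S (n4 - n3)" and ?Y = "core_poly T (n4' - n3')"
  let ?Q = "quotient_poly a (q3 * q4) M (n3 + n4) e f" and ?R = "quotient_poly a (q3' * q4') M (n3' + n4') e f'"
  note lX = lead_coeff_core_poly[OF S(1), of "n4 - n3"] and lY = lead_coeff_core_poly[OF T(1), of "n4' - n3'"]
  have XY: "?X \<noteq> 0" "?Y \<noteq> 0"
    using lX(1) lY(1) leading_coeff_0_iff[of ?X] leading_coeff_0_iff[of ?Y] zero_neq_one by metis+
  have degQ: "Polynomial.degree ?Q = 4" "Polynomial.degree ?R = 4" "?Q \<noteq> 0" "?R \<noteq> 0"
  proof -
    have "Polynomial.degree [:x, y, z, 0, 1:] = 4" for x y z :: complex by simp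
    thus d: "Polynomial.degree ?Q = 4" "Polynomial.degree ?R = 4" unfolding quotient_poly_eq by this+
    show "?Q \<noteq> 0" "?R \<noteq> 0" using d degree_0 zero_neq_numeral by metis+
  qed
  have "Polynomial.degree (?X * ?Q) = Polynomial.degree (?Y * ?R)" by (simp only: eq)
  hence "n4 - n3 + 2 * (n3 - 1) + 4 = n4' - n3' + 2 * (n3' - 1) + 4"
    unfolding degree_mult_eq[OF XY(1) degQ(3)] degree_mult_eq[OF XY(2) degQ(4)] lX(2) lY(2) degQ(1,2) S(2) T(2) .
  moreover have "n4 - n3 + 2 * (n3 - 1) + 4 = n3 + n4 + 2" "n4' - n3' + 2 * (n3' - 1) + 4 = n3' + n4' + 2"
    using le by auto
  ultimately have N: "n3 + n4 = n3' + n4'" by simp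
  have parity: "(-1::complex) ^ (n4 - n3) = (-1) ^ (n4' - n3')"
  proof -
    have "n4 - n3 + 2 * n3 = n4' - n3' + 2 * n3'" using N le by linarith
    hence "(-1::complex) ^ (n4 - n3 + 2 * n3) = (-1) ^ (n4' - n3' + 2 * n3')" by (simp only:)
    thus ?thesis by (simp add: power_add)
  qed
  define c where "c = complex_of_nat (e * (n3 + n4) + f * M)"
  define c' where "c' = complex_of_nat (e * (n3' + n4') + f' * M)"
  have minus: "poly ?X x * poly ?Q (- x) = poly ?Y x * poly ?R (- x)" for x
  proof -
    have "poly (?X * ?Q) (- x) = poly (?Y * ?R) (- x)" by (simp only: eq)
    thus ?thesis unfolding poly_mult poly_core_poly_minus parity by simp
  qed
  have plus: "poly ?X x * poly ?Q x = poly ?Y x * poly ?R x" for x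
    using arg_cong[OF eq, of "\<lambda>p. poly p x"] unfolding poly_mult .
  have odd: "poly ?Q (- x) - poly ?Q x = 4 * c * x" "poly ?R (- x) - poly ?R x = 4 * c' * x" for x
    unfolding quotient_poly_eq c_def c'_def by (simp_all add: algebra_simps)
  have sm: "Polynomial.smult c ?X = Polynomial.smult c' ?Y"
  proof (rule poly_eq_off_finite[of "{0}"])
    fix x :: complex assume "x \<notin> {0}"
    hence x: "x \<noteq> 0" by simp
    have "poly ?X x * (4 * c * x) = poly ?Y x * (4 * c' * x)"
      unfolding odd[symmetric] right_diff_distrib by (simp only: plus minus)
    thus "poly (Polynomial.smult c ?X) x = poly (Polynomial.smult c' ?Y) x" using x by (simp add: mult.commute)
  qed simp
  hence "lead_coeff (Polynomial.smult c ?X) = lead_coeff (Polynomial.smult c' ?Y)" by simp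
  hence cc: "c = c'" unfolding lead_coeff_smult lX(1) lY(1) by simp
  have "c \<noteq> 0" using e le(1) unfolding c_def of_nat_eq_0_iff by simp
  hence X: "?X = ?Y" using sm unfolding cc by (metis smult_cancel)
  have "e * (n3 + n4) + f * M = e * (n3' + n4') + f' * M"
    using cc unfolding c_def c'_def of_nat_eq_iff .
  hence "f * M = f' * M" unfolding N by (rule add_left_imp_eq)
  hence ff: "f = f'" using M by simp
  have "?Y * ?Q = ?Y * ?R" using eq unfolding X .
  hence "?Q = ?R" unfolding mult_left_cancel[OF XY(2)] .
  hence "coeff ?Q 2 = coeff ?R 2" by (rule arg_cong)
  moreover have "coeff [:x, y, z, 0, 1:] 2 = z" for x y z :: complex by (simp add: numeral_2_eq_2)
  ultimately have "complex_of_nat (a + q3 * q4 + M * (n3 + n4)) = of_nat (a + q3' * q4' + M * (n3' + n4'))"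
    unfolding quotient_poly_eq by (simp only: neg_equal_iff_equal)
  hence "a + q3 * q4 + M * (n3 + n4) = a + q3' * q4' + M * (n3' + n4')" unfolding of_nat_eq_iff .
  hence "q3 * q4 = q3' * q4'" using N by simp
  hence par: "n3 = n3' \<and> n4 = n4' \<and> q3 = q3' \<and> q4 = q4'"
    by (intro parameters_from_product[OF N le(2,4) f]) (use ef ff in auto)
  thus ?thesis using X core_poly_inj by metis
qed

section \<open>Recovery from the zeta function\<close>

lemma even_odd_split:
  fixes A A' B B' :: "complex poly"
  assumes "\<forall>\<^sub>F u in at 0. poly A (u\<^sup>2) - 2 * u * u\<^sup>2 * poly B (u\<^sup>2) = poly A' (u\<^sup>2) - 2 * u * u\<^sup>2 * poly B' (u\<^sup>2)"
  shows "A = A'" "B = B'"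
proof -
  define C where "C = pcompose (A - A') [:0, 0, 1:] - [:0, 0, 0, 2:] * pcompose (B - B') [:0, 0, 1:]"
  have C: "poly C u = (poly A (u\<^sup>2) - poly A' (u\<^sup>2)) - 2 * u * u\<^sup>2 * (poly B (u\<^sup>2) - poly B' (u\<^sup>2))" for u
    by (simp add: C_def poly_pcompose power2_eq_square)
  \<comment> \<open>A nonzero polynomial has no zeros in some punctured neighbourhood of 0, so
    agreement near 0 becomes an identity for all \<open>u\<close>.\<close>
  have "C = 0"
  proof (rule ccontr)
    assume "C \<noteq> 0"
    from eventually_poly_nonzero[OF this, of 0] assms have "\<forall>\<^sub>F u in at (0::complex). False"
      by eventually_elim (simp add: C algebra_simps)
    thus False by simp
  qed
  hence z: "(poly A (u\<^sup>2) - poly A' (u\<^sup>2)) - 2 * u * u\<^sup>2 * (poly B (u\<^sup>2) - poly B' (u\<^sup>2)) = 0" for u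
    using C[of u] by simp
  \<comment> \<open>The substitution of \<open>- u\<close> changes the sign of the odd part
    only.\<close>
  have a: "poly A (u\<^sup>2) - poly A' (u\<^sup>2) = 0" and b: "u * u\<^sup>2 * (poly B (u\<^sup>2) - poly B' (u\<^sup>2)) = 0" for u
    using z[of u] z[of "- u"] by simp_all
  show "A = A'"
  proof (rule poly_eq_off_finite[of "{}"])
    fix t show "poly A t = poly A' t" using a[of "csqrt t"] by simp
  qed simp
  show "B = B'"
  proof (rule poly_eq_off_finite[of "{0}"])
    fix t :: complex assume "t \<notin> {0}"
    thus "poly B t = poly B' t" using b[of "csqrt t"] by simp
  qed simp
qed

lemma odd_poly_eq:
  "odd_poly n1 n2 n3 n4 e f b1 b2 b3 b4 =
    [:of_nat (e * (n3 + n4) + f * (n1 + n2)),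
      of_nat e * (of_nat n3 * b4 + of_nat n4 * b3) + of_nat f * (of_nat n1 * b2 + of_nat n2 * b1):]"
  by (simp add: odd_poly_def weight_poly_def algebra_simps)

lemma even_poly_eq:
  fixes b1 b2 b3 b4 :: complex and a p n1 n2 n3 n4 e f :: nat
  defines "A \<equiv> b1 + b2 - of_nat a" and "B \<equiv> b3 + b4 - of_nat p"
    and "mb \<equiv> of_nat n1 * b2 + of_nat n2 * b1" and "nb \<equiv> of_nat n3 * b4 + of_nat n4 * b3"
    and "m \<equiv> of_nat n1 + of_nat n2" and "n \<equiv> of_nat n3 + of_nat n4"
  shows "even_poly a p n1 n2 n3 n4 e f b1 b2 b3 b4 =
    [:1, A + B - m * n, b3 * b4 + A * B + b1 * b2 - m * nb - n * mb - 4 * of_nat e * of_nat f,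
      A * (b3 * b4) + B * (b1 * b2) - mb * nb, b1 * b2 * (b3 * b4):]"
proof -
  have "[:1, b1:] * [:1, b2:] - [:0, of_nat a:] = [:1, A, b1 * b2:]"
    "[:1, b3:] * [:1, b4:] - [:0, of_nat p:] = [:1, B, b3 * b4:]" by (simp_all add: A_def B_def)
  moreover have "weight_poly n1 n2 b1 b2 = [:m, mb:]" "weight_poly n3 n4 b3 b4 = [:n, nb:]"
    by (simp_all add: weight_poly_def m_def mb_def n_def nb_def)
  ultimately show ?thesis unfolding even_poly_def by (simp add: algebra_simps)
qed

text \<open>Every nonzero \<open>y\<close> has the form \<open>(1 + b t) (1 + c t) / t\<close>,
  because \<open>1 + (b + c - y) t + b c t^2\<close> is not constant and so has a root. That root is
  nonzero, and \<open>1 + c t\<close> cannot vanish as \<open>y t\<close> does not. Hence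
  \<open>S\<close> and \<open>T\<close> agree off 0.\<close>

lemma homog_poly_inj:
  assumes S: "lead_coeff S = 1" and T: "lead_coeff T = 1" and deg: "Polynomial.degree S = Polynomial.degree T"
    and bc: "b \<noteq> 0" "c \<noteq> 0" and eq: "homog_poly S k b c = homog_poly T k b c"
  shows "S = T"
proof (rule poly_eq_off_finite[of "{0}"])
  fix y :: complex assume "y \<notin> {0}"
  hence y: "y \<noteq> 0" by simp
  have "\<not> constant (poly [:1, b + c - y, b * c:])" using bc by (simp add: constant_degree)
  then obtain t where t: "poly [:1, b + c - y, b * c:] t = 0"
    using fundamental_theorem_of_algebra by blast
  have t0: "t \<noteq> 0" using t by auto
  have "(1 + b * t) * (1 + c * t) = y * t" using t by (simp add: algebra_simps)
  hence yt: "(1 + b * t) * (1 + c * t) / t = y" and ct: "1 + c * t \<noteq> 0" using t0 y by auto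
  have "(1 + c * t) ^ k * t ^ Polynomial.degree S * poly S y = (1 + c * t) ^ k * t ^ Polynomial.degree T * poly T y"
    using poly_homog_poly[OF S t0, of k b c] poly_homog_poly[OF T t0, of k b c] unfolding yt eq by (simp only:)
  thus "poly S y = poly T y" unfolding deg using ct t0 by simp
qed simp

text \<open>\<open>X\<close> and \<open>Y\<close> are what cross-multiplication of the two Bass
  formulas leaves in front of the brackets: the last summand in each exponent of
  \<open>1 - t\<close> is the order of the other join. The constant and linear coefficients of the
  identity \<open>AB\<close>, free of \<open>X\<close> and \<open>Y\<close>, do the work; only when
  all parameters agree can \<open>X = Y\<close> be used to compare \<open>S\<close> with
  \<open>T\<close>.\<close>

lemma zeta_determines:
  fixes S T R :: "complex poly" and n1 n2 n3 n4 n3' n4' q1 q2 q3 q4 q3' q4' e f f' :: nat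
  defines "b1 \<equiv> of_nat (q1 + (n3 + n4)) - 1" and "b2 \<equiv> of_nat (q2 + (n3 + n4)) - 1"
    and "b3 \<equiv> of_nat (q3 + (n1 + n2)) - 1" and "b4 \<equiv> of_nat (q4 + (n1 + n2)) - 1"
    and "d1 \<equiv> of_nat (q1 + (n3' + n4')) - 1" and "d2 \<equiv> of_nat (q2 + (n3' + n4')) - 1"
    and "d3 \<equiv> of_nat (q3' + (n1 + n2)) - 1" and "d4 \<equiv> of_nat (q4' + (n1 + n2)) - 1"
  defines "X \<equiv> homog_poly R (n2 - n1) b1 b2 * homog_poly S (n4 - n3) b3 b4 *
      [:1, -1:] ^ (e + (n1 + n2) * (n3 + n4) + f + (n1 + n2 + (n3' + n4')))"
    and "Y \<equiv> homog_poly R (n2 - n1) d1 d2 * homog_poly T (n4' - n3') d3 d4 *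
      [:1, -1:] ^ (e + (n1 + n2) * (n3' + n4') + f' + (n1 + n2 + (n3 + n4)))"
  assumes S: "lead_coeff S = 1" "Polynomial.degree S = n3 - 1"
    and T: "lead_coeff T = 1" "Polynomial.degree T = n3' - 1"
    and R: "Polynomial.degree R = n1 - 1"
    and le: "1 \<le> n3" "n3 \<le> n4" "1 \<le> n3'" "n3' \<le> n4'" "1 \<le> n1" "n1 \<le> n2"
    and q: "1 \<le> q1" "1 \<le> q2" "1 \<le> q3" "1 \<le> q4" "1 \<le> q3'" "1 \<le> q4'" and qn: "q1 \<le> n2"
    and e: "n1 * q1 = e" "n2 * q2 = e"
    and ef: "n3 * q3 = f" "n4 * q4 = f" "n3' * q3' = f'" "n4' * q4' = f'"
    and eqA: "X * even_poly (q1 * q2) (q3 * q4) n1 n2 n3 n4 e f b1 b2 b3 b4 =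
       Y * even_poly (q1 * q2) (q3' * q4') n1 n2 n3' n4' e f' d1 d2 d3 d4"
    and eqB: "X * odd_poly n1 n2 n3 n4 e f b1 b2 b3 b4 = Y * odd_poly n1 n2 n3' n4' e f' d1 d2 d3 d4"
  shows "n3 = n3' \<and> n4 = n4' \<and> q3 = q3' \<and> q4 = q4' \<and> S = T"
proof -
  let ?A = "even_poly (q1 * q2) (q3 * q4) n1 n2 n3 n4 e f b1 b2 b3 b4"
  let ?A' = "even_poly (q1 * q2) (q3' * q4') n1 n2 n3' n4' e f' d1 d2 d3 d4"
  let ?B = "odd_poly n1 n2 n3 n4 e f b1 b2 b3 b4"
  let ?B' = "odd_poly n1 n2 n3' n4' e f' d1 d2 d3 d4"
  let ?M = "n1 + n2"
  \<comment> \<open>Degrees in the join are at least 2, so the numbers \<open>degree - 1\<close> do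
    not vanish. This keeps the degrees of \<open>homog_poly\<close> and \<open>even_poly\<close>
    from dropping.\<close>
  have nz: "complex_of_nat n - 1 \<noteq> 0" if "n \<ge> 2" for n 
    using that of_nat_eq_iff[of n 1, where 'a = complex] by simp
  have b: "b1 \<noteq> 0" "b2 \<noteq> 0" "b3 \<noteq> 0" "b4 \<noteq> 0" "d1 \<noteq> 0" "d2 \<noteq> 0" "d3 \<noteq> 0" "d4 \<noteq> 0"
    unfolding b1_def b2_def b3_def b4_def d1_def d2_def d3_def d4_def by (rule nz, use q le in linarith)+
  have hom0: "homog_poly U k x y \<noteq> 0" for U k x y using poly_homog_poly_0[of U k x y] by (metis poly_0 zero_neq_one)
  have X0: "X \<noteq> 0" "Y \<noteq> 0" unfolding X_def Y_def by (simp_all add: hom0)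
  have deg4: "Polynomial.degree [:1, x, y, z, w:] = 4" if "w \<noteq> 0" for x y z w :: complex using that by simp
  have dA: "Polynomial.degree ?A = 4" "Polynomial.degree ?A' = 4"
    unfolding even_poly_eq by (rule deg4, use b in simp)+
  hence A0: "?A \<noteq> 0" "?A' \<noteq> 0" using degree_0 zero_neq_numeral by metis+
  have dX: "Polynomial.degree X = n2 - n1 + 2 * (n1 - 1) + (n4 - n3 + 2 * (n3 - 1)) +
      (e + ?M * (n3 + n4) + f + (?M + (n3' + n4')))"
    unfolding X_def using b hom0 by (simp add: degree_mult_eq degree_homog_poly degree_power_eq S R)
  have dY: "Polynomial.degree Y = n2 - n1 + 2 * (n1 - 1) + (n4' - n3' + 2 * (n3' - 1)) +
      (e + ?M * (n3' + n4') + f' + (?M + (n3 + n4)))"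
    unfolding Y_def using b hom0 by (simp add: degree_mult_eq degree_homog_poly degree_power_eq T R)
  have "Polynomial.degree (X * ?A) = Polynomial.degree (Y * ?A')" by (simp only: eqA)
  hence "Polynomial.degree X = Polynomial.degree Y"
    unfolding degree_mult_eq[OF X0(1) A0(1)] degree_mult_eq[OF X0(2) A0(2)] dA by simp
  moreover have "n4 - n3 + 2 * (n3 - 1) + 2 = n3 + n4" "n4' - n3' + 2 * (n3' - 1) + 2 = n3' + n4'"
    using le by auto
  \<comment> \<open>The orders of the second graphs enter both degrees symmetrically and cancel;
    equality of the numbers of edges remains.\<close>
  ultimately have m: "?M * (n3 + n4) + f = ?M * (n3' + n4') + f'" unfolding dX dY by linarith

  have "X * (?A * ?B') = X * (?A' * ?B)"
  proof -
    have "X * (?A * ?B') = (X * ?A) * ?B'" by (simp only: mult.assoc)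
    also have "\<dots> = ?A' * (Y * ?B')" unfolding eqA by (simp only: mult_ac)
    also have "\<dots> = X * (?A' * ?B)" unfolding eqB[symmetric] by (simp only: mult_ac)
    finally show ?thesis .
  qed
  hence AB: "?A * ?B' = ?A' * ?B" unfolding mult_left_cancel[OF X0(1)] .
  have c0: "coeff ([:1, x1, x2, x3, x4:] * [:y0, y1:]) 0 = y0"
    and c1: "coeff ([:1, x1, x2, x3, x4:] * [:y0, y1:]) 1 = x1 * y0 + y1" for x1 x2 x3 x4 y0 y1 :: complex
    by (simp_all add: coeff_mult)
  have "coeff (?A * ?B') 0 = coeff (?A' * ?B) 0" by (simp only: AB)
  hence cc: "e * (n3' + n4') + f' * ?M = e * (n3 + n4) + f * ?M"
    unfolding even_poly_eq odd_poly_eq c0 of_nat_eq_iff .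
  have N: "n3 + n4 = n3' + n4'"
  proof -
    \<comment> \<open>The edge count gives \<open>f' - f = M D\<close> and the constant coefficient
      gives \<open>e D = M (f' - f)\<close>. Hence \<open>(e - M^2) D = 0\<close>, while
      \<open>e <= n1 n2 < M^2\<close>.\<close>
    define D where "D = int (n3 + n4) - int (n3' + n4')"
    have 1: "int f' - int f = int ?M * D"
      using arg_cong[OF m, of int] unfolding D_def by (simp add: algebra_simps)
    have "int e * D = int ?M * (int f' - int f)"
      using arg_cong[OF cc, of int] unfolding D_def by (simp add: algebra_simps)
    hence "(int e - int ?M * int ?M) * D = 0" unfolding 1 by (simp add: algebra_simps)
    moreover have "int e < int ?M * int ?M"
    proof -
      have "e \<le> n1 * n2" using e(1) qn by auto
      also have "n1 * n2 < n1 * n2 + n1 * n1" using le by simp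
      also have "\<dots> \<le> ?M * ?M" by (simp add: algebra_simps)
      finally show ?thesis by (metis of_nat_less_iff of_nat_mult)
    qed
    ultimately have "D = 0" by auto
    thus ?thesis unfolding D_def by linarith
  qed
  have ff: "f = f'" using m unfolding N by simp
  have bd: "d1 = b1" "d2 = b2" unfolding b1_def b2_def d1_def d2_def N by simp_all
  have fpos: "f \<ge> 1" using ef(1) le(1) q(3) by (metis mult_le_mono nat_mult_1)
  have "coeff (?A * ?B') 1 = coeff (?A' * ?B) 1" by (simp only: AB)
  hence "(b1 + b2 - of_nat (q1 * q2) + (b3 + b4 - of_nat (q3 * q4)) - (of_nat n1 + of_nat n2) * (of_nat n3 + of_nat n4)) *
       of_nat (e * (n3' + n4') + f' * ?M) +
       (of_nat e * (of_nat n3' * d4 + of_nat n4' * d3) + of_nat f' * (of_nat n1 * d2 + of_nat n2 * d1)) =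
    (d1 + d2 - of_nat (q1 * q2) + (d3 + d4 - of_nat (q3' * q4')) - (of_nat n1 + of_nat n2) * (of_nat n3' + of_nat n4')) *
       of_nat (e * (n3 + n4) + f * ?M) +
       (of_nat e * (of_nat n3 * b4 + of_nat n4 * b3) + of_nat f * (of_nat n1 * b2 + of_nat n2 * b1))"
    unfolding even_poly_eq odd_poly_eq c1 .
  moreover have Nc: "of_nat n3' + of_nat n4' = (of_nat n3 + of_nat n4 :: complex)"
    unfolding of_nat_add[symmetric] N ..
  moreover define c where "c = complex_of_nat (e * (n3 + n4) + f * ?M)"
  moreover define w where "w = of_nat n3 * b4 + of_nat n4 * b3"
  moreover define w' where "w' = of_nat n3' * d4 + of_nat n4' * d3"
  moreover have lin: "c * x + y = c * x' + y'"
    if "(K + x - L) * c + (y + G) = (K + x' - L) * c + (y' + G)" for K L G x y x' y' :: complex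
    using that by (simp add: algebra_simps)
  ultimately have 1: "c * (b3 + b4 - of_nat (q3 * q4)) + of_nat e * w' = c * (d3 + d4 - of_nat (q3' * q4')) + of_nat e * w"
    unfolding bd ff[symmetric] N[symmetric] Nc by (intro lin) (simp only: w_def w'_def c_def)
  \<comment> \<open>Joining raises every degree of the second graph by \<open>M\<close>; this shift
    contributes equally to both sides and drops out.\<close>
  have "w' = of_nat (n3' * q4' + n4' * q3') + (of_nat n3' + of_nat n4') * (of_nat ?M - 1)"
    "w = of_nat (n3 * q4 + n4 * q3) + (of_nat n3 + of_nat n4) * (of_nat ?M - 1)"
    unfolding b3_def b4_def d3_def d4_def w_def w'_def by (simp_all add: algebra_simps)
  moreover have "b3 + b4 = of_nat (q3 + q4) + 2 * (of_nat ?M - 1)" "d3 + d4 = of_nat (q3' + q4') + 2 * (of_nat ?M - 1)"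
    unfolding b3_def b4_def d3_def d4_def by simp_all
  moreover have "c * x + c * p' + E * y = c * x' + c * p + E * y'"
    if "c * (x + r - p) + E * (y + s) = c * (x' + r - p') + E * (y' + s)" for x x' y y' p p' r s E :: complex
    using that by (simp add: algebra_simps)
  ultimately have "c * of_nat (q3 + q4) + c * of_nat (q3' * q4') + of_nat e * of_nat (n3' * q4' + n4' * q3') =
      c * of_nat (q3' + q4') + c * of_nat (q3 * q4) + of_nat e * of_nat (n3 * q4 + n4 * q3)"
    using 1 unfolding Nc by metis
  hence "complex_of_nat ((e * (n3 + n4) + f * ?M) * (q3 + q4 + q3' * q4') + e * (n3' * q4' + n4' * q3')) =
      of_nat ((e * (n3 + n4) + f * ?M) * (q3' + q4' + q3 * q4) + e * (n3 * q4 + n4 * q3))"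
    unfolding c_def of_nat_mult[symmetric] of_nat_add[symmetric] distrib_left add.assoc .
  hence eq: "(e * (n3 + n4) + f * ?M) * (q3 + q4 + q3' * q4') + e * (n3' * q4' + n4' * q3') =
      (e * (n3 + n4) + f * ?M) * (q3' + q4' + q3 * q4) + e * (n3 * q4 + n4 * q3)"
    unfolding of_nat_eq_iff .
  have "?M \<le> 2 * e"
  proof -
    have "n2 * 1 \<le> n2 * q2" using q(2) by (rule mult_le_mono2)
    thus ?thesis using e(2) le(6) by linarith
  qed
  hence "q3 * q4 = q3' * q4'"
    using product_from_coefficient[OF N le(2,4) fpos ef(1,2) _ _ _ _ eq] ef(3,4) ff le(5) by simp
  hence par: "n3 = n3' \<and> n4 = n4' \<and> q3 = q3' \<and> q4 = q4'"
    by (intro parameters_from_product[OF N le(2,4) fpos ef(1,2)]) (use ef(3,4) ff in auto)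
  hence d: "d3 = b3" "d4 = b4" unfolding b3_def b4_def d3_def d4_def by simp_all
  have BB: "?B' = ?B" unfolding bd d using par ff by simp
  \<comment> \<open>The constant coefficient \<open>e N + f M\<close> of the odd part is positive,
    so the odd part can be cancelled.\<close>
  have "?B \<noteq> 0"
  proof -
    have "e * (n3 + n4) + f * ?M > 0" using fpos le by simp
    hence "poly ?B 0 \<noteq> 0" unfolding odd_poly_eq by (simp del: of_nat_add of_nat_mult)
    thus ?thesis by auto
  qed
  hence "X = Y" using eqB unfolding BB by simp
  hence h: "homog_poly S (n4 - n3) b3 b4 = homog_poly T (n4 - n3) b3 b4"
    unfolding X_def Y_def bd d using par ff hom0 by simp
  have "Polynomial.degree S = Polynomial.degree T" using S T par by simp
  from homog_poly_inj[OF S(1) T(1) this b(3,4) h]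
  show ?thesis using par by simp
qed

section \<open>Zeta function and spectrum\<close>

lemma ihara_zeta_0: "ihara_zeta E 0 = 1"
  by (simp add: ihara_zeta_def)

text \<open>The value of both zeta functions at 0 is 1, so the centre of the disc imposes nothing
  and the punctured filter suffices.\<close>

lemma ball_iff_eventually_at_0:
  fixes P :: "complex \<Rightarrow> bool"
  assumes "P 0"
  shows "(\<exists>r>0. \<forall>u. norm u < r \<longrightarrow> P u) \<longleftrightarrow> (\<forall>\<^sub>F u in at 0. P u)"
proof
  assume "\<exists>r>0. \<forall>u. norm u < r \<longrightarrow> P u"
  thus "\<forall>\<^sub>F u in at 0. P u" unfolding eventually_at by (auto simp: dist_norm)
next
  assume "\<forall>\<^sub>F u in at 0. P u"
  then obtain r where r: "r > 0" "\<And>u. u \<noteq> 0 \<Longrightarrow> norm u < r \<Longrightarrow> P u"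
    unfolding eventually_at by (auto simp: dist_norm)
  thus "\<exists>r>0. \<forall>u. norm u < r \<longrightarrow> P u" using assms by metis
qed

text \<open>A monic complex polynomial is the product of the linear factors given by its multiset of
  roots.\<close>

lemma spec_eq_iff_char_poly:
  assumes "lead_coeff (char_poly_graph V E) = 1" "lead_coeff (char_poly_graph V' E') = 1"
  shows "spec V E = spec V' E' \<longleftrightarrow> char_poly_graph V E = char_poly_graph V' E'"
proof
  assume "spec V E = spec V' E'"
  hence "proots (char_poly_graph V E) = proots (char_poly_graph V' E')" by (simp add: spec_def)
  thus "char_poly_graph V E = char_poly_graph V' E'"
    using complex_poly_decompose_multiset[of "char_poly_graph V E"]
      complex_poly_decompose_multiset[of "char_poly_graph V' E'"] assms by simp
qed (simp add: spec_def)

lemma lead_coeff_quotient_poly: "lead_coeff (quotient_poly a p M N e f) = 1"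
proof -
  have "lead_coeff [:x, y, z, 0, 1:] = 1" for x y z :: complex by simp
  thus ?thesis unfolding quotient_poly_eq .
qed

text \<open>Equality of zeta functions is required on some disc about 0, where the Euler product
  represents them.\<close>

theorem theorem5p1:
  fixes V :: "'a set" and E :: "'a \<Rightarrow> 'a \<Rightarrow> bool" and V1 V2 :: "'a set"
    and W :: "'b set" and F :: "'b \<Rightarrow> 'b \<Rightarrow> bool" and V3 V4 :: "'b set"
    and W' :: "'c set" and F' :: "'c \<Rightarrow> 'c \<Rightarrow> bool" and V3' V4' :: "'c set"
    and q1 q2 q3 q4 q3' q4' :: nat
  assumes G1: "semi_regular_bipartite V E V1 V2 q1 q2" and n12: "card V1 \<le> card V2"
      and G2: "semi_regular_bipartite W F V3 V4 q3 q4" and n34: "card V3 \<le> card V4"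
      and G2': "semi_regular_bipartite W' F' V3' V4' q3' q4'" and n34': "card V3' \<le> card V4'"
  shows "(\<exists>r>0. \<forall>u. norm u < r \<longrightarrow>
            ihara_zeta (join_E E V F W) u = ihara_zeta (join_E E V F' W') u)
         \<longleftrightarrow> spec (join_V V W) (join_E E V F W) = spec (join_V V W') (join_E E V F' W')"
proof -
  obtain R where R: "is_core V E V1 V2 q1 q2 R" using is_core_exists[OF G1 n12] .
  obtain S where S: "is_core W F V3 V4 q3 q4 S" using is_core_exists[OF G2 n34] .
  obtain T where T: "is_core W' F' V3' V4' q3' q4' T" using is_core_exists[OF G2' n34'] .
  have lR: "lead_coeff R = 1" "Polynomial.degree R = card V1 - 1"
    and lS: "lead_coeff S = 1" "Polynomial.degree S = card V3 - 1"
    and lT: "lead_coeff T = 1" "Polynomial.degree T = card V3' - 1"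
    using R S T by (auto simp: is_core_def)
  note c = semi_regular_counts[OF G1] and c2 = semi_regular_counts[OF G2] and c2' = semi_regular_counts[OF G2']
  let ?X = "join_V V W" and ?E = "join_E E V F W" and ?X' = "join_V V W'" and ?E' = "join_E E V F' W'"
  let ?M = "card V1 + card V2" and ?N = "card V3 + card V4" and ?N' = "card V3' + card V4'"
  let ?e = "card V1 * q1" and ?f = "card V3 * q3" and ?f' = "card V3' * q3'"
  have pos: "?M \<ge> 1" "?e \<ge> 1" "?f \<ge> 1" using c(2,4) c2(2,4) by simp_all
  note cp = char_poly_join[OF G1 R G2 S, unfolded c(7) c2(7)]
    and cp' = char_poly_join[OF G1 R G2' T, unfolded c(7) c2'(7)]
  note z = zeta_join[OF G1 R n12 G2 S n34, unfolded c(7) c2(7)]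
    and z' = zeta_join[OF G1 R n12 G2' T n34', unfolded c(7) c2'(7)]
  have one_minus: "\<forall>\<^sub>F u in at 0. (1 - u\<^sup>2 :: complex) \<noteq> 0"
    using eventually_poly_nonzero[of "[:1, 0, -1:]" 0] by (simp add: power2_eq_square)
  have "spec ?X ?E = spec ?X' ?E' \<longleftrightarrow> char_poly_graph ?X ?E = char_poly_graph ?X' ?E'"
    by (rule spec_eq_iff_char_poly)
       (simp_all only: cp cp' lead_coeff_mult lead_coeff_core_poly(1)[OF lR(1)]
         lead_coeff_core_poly(1)[OF lS(1)] lead_coeff_core_poly(1)[OF lT(1)] lead_coeff_quotient_poly mult_1)
  moreover have "(\<exists>r>0. \<forall>u. norm u < r \<longrightarrow> ihara_zeta ?E u = ihara_zeta ?E' u) \<longleftrightarrow>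
      (\<forall>\<^sub>F u in at 0. ihara_zeta ?E u = ihara_zeta ?E' u)"
    by (rule ball_iff_eventually_at_0) (simp add: ihara_zeta_0)
  moreover have "(\<forall>\<^sub>F u in at 0. ihara_zeta ?E u = ihara_zeta ?E' u) \<longleftrightarrow>
      char_poly_graph ?X ?E = char_poly_graph ?X' ?E'"
  proof
    assume h: "char_poly_graph ?X ?E = char_poly_graph ?X' ?E'"
    have ne: "core_poly R (card V2 - card V1) \<noteq> 0"
      using lead_coeff_core_poly(1)[OF lR(1)] by (metis leading_coeff_0_iff zero_neq_one)
    have "core_poly S (card V4 - card V3) * quotient_poly (q1 * q2) (q3 * q4) ?M ?N ?e ?f =
      core_poly T (card V4' - card V3') * quotient_poly (q1 * q2) (q3' * q4') ?M ?N' ?e ?f'"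
      using h unfolding cp cp' mult.assoc by (rule mult_left_cancel[OF ne, THEN iffD1])
    from char_poly_determines[OF lS lT c2(2) n34 c2'(2) n34' pos(1,2) refl c2(1)[symmetric] refl c2'(1)[symmetric] pos(3) this]
    have par: "card V3' = card V3" "card V4' = card V4" "q3' = q3" "q4' = q4" "T = S" by auto
    \<comment> \<open>With equal parameters and \<open>S = T\<close>, both zeta values solve the
      same equation \<open>z * k = w\<close>. Near 0 the right side, a power of
      \<open>1 - u^2\<close>, is nonzero, hence so is \<open>k\<close>.\<close>
    from z z'[unfolded par] one_minus show "\<forall>\<^sub>F u in at 0. ihara_zeta ?E u = ihara_zeta ?E' u"
    proof eventually_elim
      case (elim u)
      have "x = y" if "x * k = w" "y * k = w" "w \<noteq> 0" for x y k w :: complex using that by auto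
      from this[OF elim(1,2)] elim(3) show ?case by simp
    qed
  next
    assume zz: "\<forall>\<^sub>F u in at 0. ihara_zeta ?E u = ihara_zeta ?E' u"
    let ?b1 = "complex_of_nat (q1 + ?N) - 1" and ?b2 = "complex_of_nat (q2 + ?N) - 1"
      and ?b3 = "complex_of_nat (q3 + ?M) - 1" and ?b4 = "complex_of_nat (q4 + ?M) - 1"
    let ?d1 = "complex_of_nat (q1 + ?N') - 1" and ?d2 = "complex_of_nat (q2 + ?N') - 1"
      and ?d3 = "complex_of_nat (q3' + ?M) - 1" and ?d4 = "complex_of_nat (q4' + ?M) - 1"
    let ?A = "even_poly (q1 * q2) (q3 * q4) (card V1) (card V2) (card V3) (card V4) ?e ?f ?b1 ?b2 ?b3 ?b4"
    let ?A' = "even_poly (q1 * q2) (q3' * q4') (card V1) (card V2) (card V3') (card V4') ?e ?f' ?d1 ?d2 ?d3 ?d4"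
    let ?B = "odd_poly (card V1) (card V2) (card V3) (card V4) ?e ?f ?b1 ?b2 ?b3 ?b4"
    let ?B' = "odd_poly (card V1) (card V2) (card V3') (card V4') ?e ?f' ?d1 ?d2 ?d3 ?d4"
    let ?H = "homog_poly R (card V2 - card V1) ?b1 ?b2 * homog_poly S (card V4 - card V3) ?b3 ?b4"
    let ?H' = "homog_poly R (card V2 - card V1) ?d1 ?d2 * homog_poly T (card V4' - card V3') ?d3 ?d4"
    let ?m = "?e + ?M * ?N + ?f" and ?m' = "?e + ?M * ?N' + ?f'"
    \<comment> \<open>Cross-multiplying the two Bass formulas hands each side the power of
      \<open>1 - u^2\<close> that belongs to the vertices of the other join.\<close>
    let ?P = "?H * [:1, -1:] ^ (?m + (?M + ?N'))" and ?P' = "?H' * [:1, -1:] ^ (?m' + (?M + ?N))"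
    have "\<forall>\<^sub>F u in at 0. poly (?P * ?A) (u\<^sup>2) - 2 * u * u\<^sup>2 * poly (?P * ?B) (u\<^sup>2) =
        poly (?P' * ?A') (u\<^sup>2) - 2 * u * u\<^sup>2 * poly (?P' * ?B') (u\<^sup>2)"
      using z z' zz one_minus
    proof eventually_elim
      case (elim u)
      define \<zeta> where "\<zeta> = ihara_zeta ?E u"
      define w where "w = 1 - u\<^sup>2"
      define k where "k = poly ?A (u\<^sup>2) - 2 * u * u\<^sup>2 * poly ?B (u\<^sup>2)"
      define k' where "k' = poly ?A' (u\<^sup>2) - 2 * u * u\<^sup>2 * poly ?B' (u\<^sup>2)"
      have 1: "\<zeta> * (poly ?H (u\<^sup>2) * k * w ^ ?m) = w ^ (?M + ?N)"
        unfolding \<zeta>_def w_def k_def by (rule elim(1))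
      have 2: "\<zeta> * (poly ?H' (u\<^sup>2) * k' * w ^ ?m') = w ^ (?M + ?N')"
        unfolding \<zeta>_def w_def k'_def elim(3) by (rule elim(2))
      have w: "w \<noteq> 0" using elim(4) by (simp add: w_def)
      hence \<zeta>: "\<zeta> \<noteq> 0" using 1 by auto
      have "\<zeta> * (x * q) = \<zeta> * (y * p)" if "\<zeta> * x = p" "\<zeta> * y = q" for x y p q
        unfolding that[symmetric] by (simp only: mult_ac)
      from this[OF 1 2] have "\<zeta> * (poly ?H (u\<^sup>2) * k * w ^ ?m * w ^ (?M + ?N')) =
          \<zeta> * (poly ?H' (u\<^sup>2) * k' * w ^ ?m' * w ^ (?M + ?N))"
        by (simp only: mult.assoc)
      hence eq: "poly ?H (u\<^sup>2) * k * w ^ ?m * w ^ (?M + ?N') = poly ?H' (u\<^sup>2) * k' * w ^ ?m' * w ^ (?M + ?N)"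
        unfolding mult_left_cancel[OF \<zeta>] .
      have pw: "poly [:1, -1:] (u\<^sup>2) = w" by (simp add: w_def)
      have lin: "poly (h * [:1, -1:] ^ (i + j) * a) (u\<^sup>2) - t * poly (h * [:1, -1:] ^ (i + j) * b) (u\<^sup>2) =
          poly h (u\<^sup>2) * (poly a (u\<^sup>2) - t * poly b (u\<^sup>2)) * w ^ i * w ^ j" for h a b i j t
        unfolding poly_mult poly_power power_add pw by (simp add: algebra_simps)
      show ?case unfolding lin using eq unfolding k_def k'_def .
    qed
    note AB = even_odd_split[OF this]
    have "card V3 = card V3' \<and> card V4 = card V4' \<and> q3 = q3' \<and> q4 = q4' \<and> S = T"
      by (rule zeta_determines[OF lS lT lR(2) c2(2) n34 c2'(2) n34' c(2) n12 c(4,5) c2(4,5) c2'(4,5) c(6)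
            refl c(1)[symmetric] refl c2(1)[symmetric] refl c2'(1)[symmetric] AB])
    thus "char_poly_graph ?X ?E = char_poly_graph ?X' ?E'" unfolding cp cp' by simp
  qed
  ultimately show ?thesis by simp
qed

end
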